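(* Let $\alpha,\beta$ be integers with $\alpha\equiv\beta\equiv 7\pmod 9$ and $\alpha\equiv\beta\pmod{27}$. Then $|G_3|=3^{10}$, the nilpotency class of $G_3$ is $7$, $o(a)=o(b)=81$ and $o(c)=27$.
   Context: $G(\alpha,\beta)=\langle A,B\mid A^{[A,B]}=A^{\alpha},\ B^{[B,A]}=B^{\beta}\rangle$ with $[x,y]=x^{-1}y^{-1}xy$, $y^x=x^{-1}yx$, and $C=[A,B]$. The group $G(\alpha,\beta)$ is finite and nilpotent, hence the direct product of its Sylow subgroups; $G_3$ denotes its Sylow $3$-subgroup and $a,b,c$ denote the images of $A,B,C$ under the canonical projection $G(\alpha,\beta)\to G_3$. $o(x)$ is the order of $x$. *)

theory Defs
  imports "HOL-Algebra.Algebra"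
begin

text \<open>Words over generators of type 'g: a letter (x, False) is x, (x, True) is x inverse.\<close>
type_synonym 'g word = "('g \<times> bool) list"

definition inv_word :: "'g word \<Rightarrow> 'g word" where
  "inv_word w = rev (map (\<lambda>(x, e). (x, \<not> e)) w)"

definition pow_word :: "'g word \<Rightarrow> int \<Rightarrow> 'g word" where
  "pow_word w n = (if 0 \<le> n then concat (replicate (nat n) w)
                   else concat (replicate (nat (- n)) (inv_word w)))"

inductive word_eq :: "('g word \<times> 'g word) set \<Rightarrow> 'g word \<Rightarrow> 'g word \<Rightarrow> bool"
  for R where
  refl: "word_eq R w w"
| sym: "word_eq R u v \<Longrightarrow> word_eq R v u"
| trans: "word_eq R u v \<Longrightarrow> word_eq R v w \<Longrightarrow> word_eq R u w"
| cong: "word_eq R u v \<Longrightarrow> word_eq R (p @ u @ q) (p @ v @ q)"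
| cancel: "word_eq R [(x, b), (x, \<not> b)] []"
| rel: "(u, v) \<in> R \<Longrightarrow> word_eq R u v"

definition word_class :: "('g word \<times> 'g word) set \<Rightarrow> 'g word \<Rightarrow> 'g word set" where
  "word_class R w = {v. word_eq R w v}"

definition pres_mult :: "('g word \<times> 'g word) set \<Rightarrow> 'g word set \<Rightarrow> 'g word set \<Rightarrow> 'g word set" where
  "pres_mult R U V = word_class R ((SOME u. u \<in> U) @ (SOME v. v \<in> V))"

definition pres_group :: "('g word \<times> 'g word) set \<Rightarrow> 'g word set monoid" where
  "pres_group R = \<lparr>carrier = range (word_class R), monoid.mult = pres_mult R, one = word_class R []\<rparr>"

text \<open>Generators: False stands for A, True stands for B.\<close>
definition wA :: "bool word" where "wA = [(False, False)]"
definition wB :: "bool word" where "wB = [(True, False)]"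

definition comm_word :: "'g word \<Rightarrow> 'g word \<Rightarrow> 'g word" where
  "comm_word x y = inv_word x @ inv_word y @ x @ y"

definition conj_word :: "'g word \<Rightarrow> 'g word \<Rightarrow> 'g word" where
  "conj_word y x = inv_word x @ y @ x"

definition G_rels :: "int \<Rightarrow> int \<Rightarrow> (bool word \<times> bool word) set" where
  "G_rels \<alpha> \<beta> = {(conj_word wA (comm_word wA wB), pow_word wA \<alpha>),
                   (conj_word wB (comm_word wB wA), pow_word wB \<beta>)}"

definition Gab :: "int \<Rightarrow> int \<Rightarrow> bool word set monoid" where
  "Gab \<alpha> \<beta> = pres_group (G_rels \<alpha> \<beta>)"

definition genA :: "int \<Rightarrow> int \<Rightarrow> bool word set" where
  "genA \<alpha> \<beta> = word_class (G_rels \<alpha> \<beta>) wA"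

definition genB :: "int \<Rightarrow> int \<Rightarrow> bool word set" where
  "genB \<alpha> \<beta> = word_class (G_rels \<alpha> \<beta>) wB"

definition genC :: "int \<Rightarrow> int \<Rightarrow> bool word set" where
  "genC \<alpha> \<beta> = word_class (G_rels \<alpha> \<beta>) (comm_word wA wB)"

text \<open>Elements of p-power order (in a finite nilpotent group: the Sylow p-subgroup).\<close>
definition sylow_part :: "('a, 'b) monoid_scheme \<Rightarrow> nat \<Rightarrow> ('a, 'b) monoid_scheme" where
  "sylow_part G p = G\<lparr>carrier := {g \<in> carrier G. \<exists>k. group.ord G g = p ^ k}\<rparr>"

text \<open>Elements of order prime to p (in a finite nilpotent group: the complement
  of the Sylow p-subgroup in the direct decomposition).\<close>
definition pprime_part :: "('a, 'b) monoid_scheme \<Rightarrow> nat \<Rightarrow> 'a set" where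
  "pprime_part G p = {g \<in> carrier G. coprime (group.ord G g) p}"

definition sylow_proj :: "('a, 'b) monoid_scheme \<Rightarrow> nat \<Rightarrow> 'a \<Rightarrow> 'a" where
  "sylow_proj G p g = (THE x. x \<in> carrier (sylow_part G p) \<and>
       (\<exists>y \<in> pprime_part G p. g = x \<otimes>\<^bsub>G\<^esub> y))"

definition group_comm :: "('a, 'b) monoid_scheme \<Rightarrow> 'a \<Rightarrow> 'a \<Rightarrow> 'a" where
  "group_comm G x y = inv\<^bsub>G\<^esub> x \<otimes>\<^bsub>G\<^esub> inv\<^bsub>G\<^esub> y \<otimes>\<^bsub>G\<^esub> x \<otimes>\<^bsub>G\<^esub> y"

text \<open>lower_central G n is gamma_(n+1)(G): gamma_1 = G, gamma_(i+1) = [gamma_i, G].\<close>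
fun lower_central :: "('a, 'b) monoid_scheme \<Rightarrow> nat \<Rightarrow> 'a set" where
  "lower_central G 0 = carrier G"
| "lower_central G (Suc n) =
     generate G {group_comm G x y | x y. x \<in> lower_central G n \<and> y \<in> carrier G}"

definition nilpotency_class_is :: "('a, 'b) monoid_scheme \<Rightarrow> nat \<Rightarrow> bool" where
  "nilpotency_class_is G c \<longleftrightarrow> lower_central G c = {\<one>\<^bsub>G\<^esub>} \<and>
     (\<forall>d < c. lower_central G d \<noteq> {\<one>\<^bsub>G\<^esub>})"

end

theory Submission
  imports Defs "HOL-Number_Theory.Number_Theory"
begin

text \<open>
  Write \<open>C = [A, B]\<close> and \<open>S(n) = \<alpha> + \<dots> + \<alpha> ^ n\<close>. The relations give \<open>B\<inverse> A ^ n B = C ^ n A ^ S(n)\<close>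
  and its mirror image under \<open>A \<leftrightarrow> B\<close>, \<open>C \<leftrightarrow> C\<inverse>\<close>, \<open>\<alpha> \<leftrightarrow> \<beta>\<close>. Computing the conjugate of \<open>A\<close> by
  \<open>B ^ (\<beta> ^ j) = C ^ j B C ^ (-j)\<close> in two ways yields
  \<open>B ^ e(\<beta>) C ^ (\<beta> ^ j + j) = C ^ (\<alpha> ^ j + j) A ^ (- e(\<alpha>))\<close>, whose commutator with \<open>C\<close> lies in both
  \<open>\<langle>A\<rangle>\<close> and \<open>\<langle>B\<rangle>\<close> up to conjugation by \<open>C\<close> and is therefore central. So \<open>A\<close>, \<open>B\<close>, \<open>C\<close> have finite
  order; varying \<open>j\<close> shows that every prime dividing the order of \<open>A\<close> divides \<open>\<alpha> - 1\<close>. It follows that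
  the 3-parts of \<open>A\<close>, \<open>B\<close>, \<open>C\<close> generate a normal 3-subgroup \<open>\<langle>C\<rangle>\<langle>A\<rangle>\<langle>B\<rangle>\<close>, their 3'-parts a normal
  3'-subgroup, and the whole group is the direct product of the two.

  In the 3-part, 3-adic valuations in the relation above give \<open>a ^ 81 = b ^ 81 = c ^ 27 = 1\<close> and
  \<open>b ^ 27 \<in> \<langle>a ^ 27\<rangle>\<close>, whence order at most \<open>3 ^ 10\<close> and class at most 7. All the lower bounds
  follow from \<open>a ^ 27 \<noteq> 1\<close> alone, and that is seen in an explicit action on the
  \<open>3 ^ 7\<close> cosets of \<open>\<langle>c\<rangle>\<close>.
\<close>

section \<open>The Macdonald relations\<close>

text \<open>Finiteness is not known at first, so \<alpha> and \<beta> cannot be inverted modulo the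
  orders of the generators; the early arguments use roots of \<open>A\<close> and \<open>B\<close>,
  obtained by conjugating with \<open>C\<close>, instead of inverse exponents. The key relation
  moves \<open>\<alpha> ^ j\<close> copies of \<open>A\<close>, so this number must be nonnegative.
  The index 2 works for either sign and gives finite orders; after that the exponents may be shifted
  until they are positive, and every index becomes available. The hypothesis that \<alpha> and
  \<beta> agree modulo 27 lets one index serve both generators and makes the leftover power of
  \<open>C\<close> a 27th power. This produces the overlap of order 3 between
  \<open>\<langle>a\<rangle>\<close> and \<open>\<langle>b\<rangle>\<close>: the order is 27 * 81 *
  81 / 3. No consequence of the relations can show that \<open>a ^ 27\<close> is nontrivial, hence
  the model. On the cosets of \<open>\<langle>c\<rangle>\<close> each generator is given by 27
  affine maps modulo 81, and these depend on \<alpha> and \<beta> modulo 81 only, which leaves 27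
  cases to evaluate.\<close>

definition geo_sum :: "int \<Rightarrow> nat \<Rightarrow> int" where
  "geo_sum x n = (\<Sum>i=1..n. x ^ i)"

lemma geo_sum_0 [simp]: "geo_sum x 0 = 0"
  by (simp add: geo_sum_def)

lemma geo_sum_Suc: "geo_sum x (Suc n) = geo_sum x n + x ^ Suc n"
  by (simp add: geo_sum_def)

lemma geo_sum_eq: "(x - 1) * geo_sum x n = x * (x ^ n - 1)"
  by (induction n) (simp_all add: geo_sum_Suc algebra_simps)

text \<open>With \<open>M = x ^ j\<close>, the first term comes from moving one generator across
  \<open>C ^ (j + M)\<close>, the sum from conjugating \<open>M\<close> copies of it by the other
  generator.\<close>

definition key_exp :: "int \<Rightarrow> nat \<Rightarrow> int" where
  "key_exp x j = x ^ (j + nat (x ^ j)) - geo_sum x (nat (x ^ j))"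

context group
begin

lemma int_pow_intertwine:
  assumes "x \<otimes> c = c \<otimes> y" "x \<in> carrier G" "y \<in> carrier G" "c \<in> carrier G"
  shows "x [^] (i::int) \<otimes> c = c \<otimes> y [^] i"
proof -
  have nat: "x [^] (n::nat) \<otimes> c = c \<otimes> y [^] n" for n
  proof (induction n)
    case (Suc n)
    have "x [^] Suc n \<otimes> c = x [^] n \<otimes> c \<otimes> y" using assms by (simp add: m_assoc)
    then show ?case using Suc assms by (simp add: m_assoc)
  qed (use assms in simp)
  show ?thesis
  proof (cases i rule: int_cases2)
    case (nonneg n)
    then show ?thesis using nat by (simp add: int_pow_int)
  next
    case (nonpos n)
    have "c = inv (x [^] n) \<otimes> (x [^] n \<otimes> c)" using assms by (simp add: m_assoc[symmetric])
    then have "c \<otimes> inv (y [^] n) = inv (x [^] n) \<otimes> c"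
      using nat[of n] assms by (metis inv_closed inv_solve_right m_assoc m_closed nat_pow_closed)
    then show ?thesis using nonpos assms by (simp add: int_pow_neg int_pow_int)
  qed
qed

lemma int_pow_commute:
  assumes "x \<otimes> c = c \<otimes> x" "x \<in> carrier G" "c \<in> carrier G"
  shows "x [^] (i::int) \<otimes> c = c \<otimes> x [^] i"
  using int_pow_intertwine[OF assms(1) assms(2,2,3)] .

lemma nat_pow_commute:
  assumes "x \<otimes> c = c \<otimes> x" "x \<in> carrier G" "c \<in> carrier G"
  shows "x [^] (i::nat) \<otimes> c = c \<otimes> x [^] i"
  using int_pow_commute[OF assms, of "int i"] by (simp add: int_pow_int)

end

locale macdonald = group G for G (structure) +
  fixes A B C :: 'a and \<alpha> \<beta> :: int
  assumes A_closed [simp, intro]: "A \<in> carrier G"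
    and B_closed [simp, intro]: "B \<in> carrier G"
    and C_closed [simp, intro]: "C \<in> carrier G"
    and AB: "A \<otimes> B = B \<otimes> A \<otimes> C"
    and AC: "A \<otimes> C = C \<otimes> A [^] \<alpha>"
    and CB: "C \<otimes> B = B [^] \<beta> \<otimes> C"
begin

text \<open>This symmetry halves the work: facts about \<open>A\<close> become facts about
  \<open>B\<close>. \<open>C\<close> is inverted because [B, A] is the inverse of [A, B].\<close>

lemma swap: "macdonald G B A (inv C) \<beta> \<alpha>"
proof unfold_locales
  have "A \<otimes> B \<otimes> inv C = B \<otimes> A" using AB by (simp add: inv_solve_right')
  then show "B \<otimes> A = A \<otimes> B \<otimes> inv C" by simp
  have "B \<otimes> inv C = inv C \<otimes> (C \<otimes> B) \<otimes> inv C" by (simp add: m_assoc[symmetric])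
  also have "\<dots> = inv C \<otimes> B [^] \<beta>" unfolding CB by (simp add: m_assoc)
  finally show "B \<otimes> inv C = inv C \<otimes> B [^] \<beta>" .
  have "inv C \<otimes> A = inv C \<otimes> (A \<otimes> C) \<otimes> inv C" by (simp add: m_assoc)
  also have "\<dots> = A [^] \<alpha> \<otimes> inv C" unfolding AC by (simp add: m_assoc[symmetric])
  finally show "inv C \<otimes> A = A [^] \<alpha> \<otimes> inv C" .
qed auto

lemma A_C_pow: "A [^] (i::int) \<otimes> C [^] (j::nat) = C [^] j \<otimes> A [^] (i * \<alpha> ^ j)"
proof (induction j)
  case (Suc j)
  have "A [^] i \<otimes> C [^] Suc j = C [^] j \<otimes> (A [^] (i * \<alpha> ^ j) \<otimes> C)"
    using Suc by (simp add: m_assoc[symmetric])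
  also have "A [^] (i * \<alpha> ^ j) \<otimes> C = C \<otimes> (A [^] \<alpha>) [^] (i * \<alpha> ^ j)"
    by (rule int_pow_intertwine) (auto simp: AC)
  also have "(A [^] \<alpha>) [^] (i * \<alpha> ^ j) = A [^] (i * \<alpha> ^ Suc j)"
    by (simp add: int_pow_pow algebra_simps)
  finally show ?case by (simp add: m_assoc)
qed simp

lemma C_B_pow: "C [^] (j::nat) \<otimes> B [^] (i::int) = B [^] (i * \<beta> ^ j) \<otimes> C [^] j"
proof (induction j arbitrary: i)
  case (Suc j)
  have 1: "(B [^] \<beta>) [^] i \<otimes> C = C \<otimes> B [^] i"
    by (rule int_pow_intertwine) (auto simp: CB)
  have "C [^] Suc j \<otimes> B [^] i = C [^] j \<otimes> (C \<otimes> B [^] i)" by (simp add: m_assoc)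
  also have "\<dots> = C [^] j \<otimes> B [^] (\<beta> * i) \<otimes> C" using 1 by (simp add: int_pow_pow m_assoc)
  also have "\<dots> = B [^] (i * \<beta> ^ Suc j) \<otimes> C [^] Suc j" using Suc
    by (simp add: m_assoc algebra_simps)
  finally show ?case .
qed simp

text \<open>Conjugation by \<open>B\<close> sends \<open>A\<close> to
  \<open>A C = C A ^ \<alpha>\<close>. In the n-th power of the latter, collecting the factors
  \<open>C\<close> on the left turns the exponents of \<open>A\<close> into
  \<open>\<alpha>, ..., \<alpha> ^ n\<close>.\<close>

lemma A_pow_B: "A [^] (n::nat) \<otimes> B = B \<otimes> (C [^] n \<otimes> A [^] geo_sum \<alpha> n)"
proof (induction n)
  case (Suc n)
  have "A [^] Suc n \<otimes> B = A \<otimes> (A [^] n \<otimes> B)"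
    by (subst nat_pow_Suc2) (auto simp: m_assoc)
  also have "\<dots> = (A \<otimes> B) \<otimes> (C [^] n \<otimes> A [^] geo_sum \<alpha> n)" 
    using Suc by (simp add: m_assoc)
  also have "\<dots> = B \<otimes> ((A [^] (1::int) \<otimes> C [^] Suc n) \<otimes> A [^] geo_sum \<alpha> n)"
    unfolding AB by (subst nat_pow_Suc2) (auto simp: m_assoc)
  also have "\<dots> = B \<otimes> (C [^] Suc n \<otimes> A [^] geo_sum \<alpha> (Suc n))" 
    unfolding A_C_pow geo_sum_Suc 
    by (simp add: m_assoc int_pow_mult[symmetric] add.commute del: nat_pow_Suc power_Suc)
  finally show ?case .
qed simp

lemma B_pow_A: "B [^] (n::nat) \<otimes> A = A \<otimes> (inv C [^] n \<otimes> B [^] geo_sum \<beta> n)"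
  by (rule macdonald.A_pow_B[OF swap])

lemma key_relation:
  assumes "\<alpha> ^ j \<ge> 0" "\<beta> ^ j \<ge> 0"
  shows "B [^] key_exp \<beta> j \<otimes> C [^] (nat (\<beta> ^ j) + j) = C [^] (nat (\<alpha> ^ j) + j) \<otimes> A [^] (- key_exp \<alpha> j)"
proof -
  define M N where "M = nat (\<alpha> ^ j)" and "N = nat (\<beta> ^ j)"
  have M: "int M = \<alpha> ^ j" and N: "int N = \<beta> ^ j" using assms by (auto simp: M_def N_def)
  have BN: "B [^] N = C [^] j \<otimes> B \<otimes> inv (C [^] j)"
    using C_B_pow[of j 1] N by (simp add: inv_solve_right int_pow_int[symmetric])
  \<comment> \<open>First reduction of \<open>A C ^ j B\<close>: \<open>A\<close> passes
    \<open>C ^ j\<close>, becomes \<open>A ^ M\<close>, and this passes \<open>B\<close>.\<close>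
  have "A [^] (1::int) \<otimes> C [^] j \<otimes> B = C [^] j \<otimes> (A [^] M \<otimes> B)"
    unfolding A_C_pow using M by (simp add: m_assoc int_pow_int[symmetric])
  also have "\<dots> = C [^] j \<otimes> B \<otimes> (C [^] M \<otimes> A [^] geo_sum \<alpha> M)"
    unfolding A_pow_B by (simp add: m_assoc)
  also have "\<dots> = C [^] j \<otimes> B \<otimes> inv (C [^] j) \<otimes> (C [^] (M + j) \<otimes> A [^] geo_sum \<alpha> M)"
    by (subst add.commute) (simp add: m_assoc[symmetric] nat_pow_mult[symmetric], simp add: m_assoc)
  finally have 1: "A \<otimes> C [^] j \<otimes> B = B [^] N \<otimes> (C [^] (M + j) \<otimes> A [^] geo_sum \<alpha> M)"
    by (simp add: BN)
  \<comment> \<open>Second reduction: \<open>C ^ j B = B ^ N C ^ j\<close>, so that \<open>A\<close>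
    meets \<open>B ^ N\<close> and the mirrored formula applies.\<close>
  have "A \<otimes> C [^] j \<otimes> B = A \<otimes> (B [^] N \<otimes> C [^] j)"
    unfolding BN by (simp add: m_assoc)
  then have 2: "A \<otimes> B [^] N \<otimes> C [^] j = B [^] N \<otimes> C [^] (M + j) \<otimes> A [^] geo_sum \<alpha> M"
    using 1 by (simp add: m_assoc)
  have "inv C [^] N = inv (C [^] N)" by (simp add: nat_pow_inv)
  then have "B [^] N \<otimes> A \<otimes> B [^] (- geo_sum \<beta> N) \<otimes> C [^] N = A"
    unfolding B_pow_A by (simp add: int_pow_neg m_assoc) 
  then have "A \<otimes> B [^] N = B [^] N \<otimes> A \<otimes> B [^] (- geo_sum \<beta> N) \<otimes> (C [^] N \<otimes> B [^] int N)"
    by (simp add: m_assoc[symmetric] int_pow_int)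
  also have "\<dots> = B [^] N \<otimes> A \<otimes> B [^] (key_exp \<beta> j) \<otimes> C [^] N"
    unfolding C_B_pow key_exp_def N_def[symmetric] N
    by (simp add: m_assoc[symmetric] power_add algebra_simps int_pow_mult[symmetric])
       (simp add: m_assoc int_pow_mult[symmetric])
  finally have "B [^] N \<otimes> (A \<otimes> (B [^] (key_exp \<beta> j) \<otimes> C [^] (N + j))) 
      = B [^] N \<otimes> (C [^] (M + j) \<otimes> A [^] geo_sum \<alpha> M)"
    using 2 by (simp add: m_assoc nat_pow_mult[symmetric])
  then have 3: "A \<otimes> (B [^] (key_exp \<beta> j) \<otimes> C [^] (N + j)) = C [^] (M + j) \<otimes> A [^] geo_sum \<alpha> M"
    by (subst (asm) l_cancel) auto
  have "A \<otimes> (C [^] (M + j) \<otimes> A [^] (- key_exp \<alpha> j)) = A [^] (1::int) \<otimes> C [^] (M + j) \<otimes> A [^] (- key_exp \<alpha> j)"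
    by (simp add: m_assoc)
  also have "\<dots> = C [^] (M + j) \<otimes> A [^] geo_sum \<alpha> M"
    unfolding A_C_pow key_exp_def M_def[symmetric] by (simp add: m_assoc int_pow_mult[symmetric] add.commute)
  finally have "A \<otimes> (B [^] (key_exp \<beta> j) \<otimes> C [^] (N + j)) = A \<otimes> (C [^] (M + j) \<otimes> A [^] (- key_exp \<alpha> j))"
    using 3 by simp
  then show ?thesis unfolding M_def N_def by (subst (asm) l_cancel) auto
qed


lemma A_pow_central:
  assumes "\<alpha> ^ j \<ge> 0" "\<beta> ^ j \<ge> 0"
  shows "A [^] (key_exp \<alpha> j * (\<alpha> - 1)) \<otimes> B = B \<otimes> A [^] (key_exp \<alpha> j * (\<alpha> - 1))"
proof -
  define p q where "p = nat (\<beta> ^ j) + j" and "q = nat (\<alpha> ^ j) + j"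
  define r f where "r = key_exp \<alpha> j" and "f = key_exp \<beta> j"
  have R: "B [^] f \<otimes> C [^] p = C [^] q \<otimes> A [^] (- r)"
    unfolding p_def q_def r_def f_def by (rule key_relation[OF assms])
  define y where "y = inv C \<otimes> B [^] f \<otimes> C"
  \<comment> \<open>As \<beta> and \<alpha> are not known to be invertible modulo the orders, these
    conjugates enter as roots: \<open>B = b ^ \<beta>\<close> and
    \<open>A = a ^ (\<alpha> ^ p)\<close>.\<close>
  define b where "b = inv C \<otimes> B \<otimes> C"
  define a where "a = C [^] p \<otimes> A \<otimes> inv (C [^] p)"
  have closed [simp]: "y \<in> carrier G" "b \<in> carrier G" "a \<in> carrier G" by (auto simp: y_def b_def a_def)
  have y_b: "y = b [^] f"
  proof -
    have "B [^] f \<otimes> C = C \<otimes> b [^] f"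
      by (rule int_pow_intertwine) (auto simp: b_def m_assoc[symmetric])
    then show ?thesis by (simp add: y_def m_assoc) (simp add: m_assoc[symmetric])
  qed
  have B_b: "B = b [^] \<beta>"
  proof -
    have "B [^] \<beta> \<otimes> C = C \<otimes> b [^] \<beta>"
      by (rule int_pow_intertwine) (auto simp: b_def m_assoc[symmetric])
    then have "C \<otimes> B = C \<otimes> b [^] \<beta>" by (simp add: CB)
    then show ?thesis by (subst (asm) l_cancel) auto
  qed
  have a_pow: "a [^] i \<otimes> C [^] p = C [^] p \<otimes> A [^] i" for i :: int
    by (rule int_pow_intertwine) (auto simp: a_def m_assoc)
  have A_a: "A = a [^] (\<alpha> ^ p)"
  proof -
    have "a [^] (\<alpha> ^ p) \<otimes> C [^] p = A [^] (1::int) \<otimes> C [^] p"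
      unfolding a_pow A_C_pow by simp
    then show ?thesis by (subst (asm) r_cancel) auto
  qed
  \<comment> \<open>Comparing \<open>R\<close> with its conjugate by \<open>C\<close> isolates
    \<open>z\<close>. It is a power of \<open>b\<close>, so it commutes with \<open>B\<close>; it is
    also a power of \<open>a\<close>, so it commutes with \<open>A\<close>, and hence with
    \<open>C\<close>.\<close>
  define z where "z = inv y \<otimes> B [^] f"
  have zb: "z = b [^] (\<beta> * f - f)"
    unfolding z_def y_b by (subst B_b) (simp add: int_pow_pow int_pow_neg[symmetric] int_pow_mult[symmetric])
  have zB: "z \<otimes> B = B \<otimes> z"
    unfolding zb by (subst (1 2) B_b) (simp add: int_pow_mult[symmetric] add.commute)
  have "y \<otimes> C [^] p = inv C \<otimes> (B [^] f \<otimes> C [^] p) \<otimes> C"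
  proof -
    have "C \<otimes> C [^] p = C [^] p \<otimes> C" by (metis C_closed nat_pow_comm nat_pow_Suc nat_pow_Suc2)
    then show ?thesis by (simp add: y_def m_assoc)
  qed
  also have "\<dots> = inv C \<otimes> C [^] q \<otimes> (A [^] (- r) \<otimes> C [^] (1::nat))"
    unfolding R by (simp add: m_assoc)
  also have "\<dots> = inv C \<otimes> (C [^] q \<otimes> C) \<otimes> A [^] (- r * \<alpha>)"
    unfolding A_C_pow by (simp add: m_assoc)
  also have "C [^] q \<otimes> C = C \<otimes> C [^] q" by (metis C_closed nat_pow_Suc nat_pow_Suc2)
  finally have yC: "y \<otimes> C [^] p = C [^] q \<otimes> A [^] (- r * \<alpha>)" by (simp add: m_assoc[symmetric])
  have "y \<otimes> (C [^] p \<otimes> A [^] (r * (\<alpha> - 1))) = C [^] q \<otimes> (A [^] (- r * \<alpha>) \<otimes> A [^] (r * (\<alpha> - 1)))"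
    using yC by (simp add: m_assoc[symmetric])
  also have "\<dots> = B [^] f \<otimes> C [^] p" unfolding R by (simp add: int_pow_mult[symmetric] algebra_simps)
  also have "\<dots> = y \<otimes> (z \<otimes> C [^] p)" unfolding z_def by (simp add: m_assoc) (simp add: m_assoc[symmetric])
  finally have zA: "C [^] p \<otimes> A [^] (r * (\<alpha> - 1)) = z \<otimes> C [^] p"
    by (subst (asm) l_cancel) (auto simp: z_def)
  then have za: "z = a [^] (r * (\<alpha> - 1))"
    unfolding a_pow[symmetric] by (subst (asm) r_cancel) (auto simp: z_def)
  have z_closed [simp]: "z \<in> carrier G" by (simp add: z_def)
  have zA': "z \<otimes> A = A \<otimes> z"
    unfolding za by (subst (1 2) A_a) (simp add: int_pow_mult[symmetric] add.commute)
  have "z \<otimes> (B \<otimes> A) \<otimes> C = z \<otimes> (A \<otimes> B)" using AB by (simp add: m_assoc)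
  also have "\<dots> = (B \<otimes> A) \<otimes> C \<otimes> z" using zA' zB AB by (metis A_closed B_closed m_assoc z_closed)
  also have "z \<otimes> (B \<otimes> A) = (B \<otimes> A) \<otimes> z" using zA' zB by (metis A_closed B_closed m_assoc z_closed)
  finally have "z \<otimes> C = C \<otimes> z" by (simp add: m_assoc) 
  then have "C [^] p \<otimes> z = z \<otimes> C [^] p" by (intro nat_pow_commute) auto
  then have "C [^] p \<otimes> A [^] (r * (\<alpha> - 1)) = C [^] p \<otimes> z" using zA by simp
  then have "A [^] (r * (\<alpha> - 1)) = z" by (subst (asm) l_cancel) auto
  then show ?thesis using zB by (simp add: r_def)
qed

text \<open>Commuting with \<open>A\<close> and \<open>B\<close>, the power \<open>A ^ i\<close>
  commutes with their commutator \<open>C\<close>; but conjugation by \<open>C\<close> raises it to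
  the power \<alpha>.\<close>

lemma central_pow_trivial:
  assumes "A [^] (i::int) \<otimes> B = B \<otimes> A [^] i"
  shows "A [^] (i * (\<alpha> - 1)) = \<one>"
proof -
  let ?z = "A [^] i"
  have zA: "?z \<otimes> A = A \<otimes> ?z" by (rule int_pow_commute) auto
  have "(B \<otimes> A) \<otimes> (?z \<otimes> C) = B \<otimes> (?z \<otimes> A) \<otimes> C" using zA by (simp add: m_assoc)
  also have "\<dots> = ?z \<otimes> (A \<otimes> B)" using assms AB by (simp add: m_assoc[symmetric])
  also have "\<dots> = A \<otimes> (?z \<otimes> B)" using zA by (simp add: m_assoc[symmetric])
  also have "\<dots> = (B \<otimes> A) \<otimes> (C \<otimes> ?z)" using AB assms by (simp add: m_assoc[symmetric])
  finally have "?z \<otimes> C = C \<otimes> ?z" by (subst (asm) l_cancel) auto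
  moreover have "?z \<otimes> C = C \<otimes> A [^] (i * \<alpha>)" using A_C_pow[of i 1] by simp
  ultimately have "?z = A [^] (i * \<alpha>)" by (metis C_closed A_closed int_pow_closed l_cancel)
  then show ?thesis by (simp add: int_pow_diff algebra_simps)
qed

lemma A_pow_trivial:
  assumes "\<alpha> ^ j \<ge> 0" "\<beta> ^ j \<ge> 0"
  shows "A [^] (key_exp \<alpha> j * (\<alpha> - 1) * (\<alpha> - 1)) = \<one>"
  by (rule central_pow_trivial[OF A_pow_central[OF assms]])

end

section \<open>Finiteness of the orders\<close>

lemma geo_sum_eq_sum: "geo_sum x n = x * (\<Sum>i<n. x ^ i)"
  by (induction n) (simp_all add: geo_sum_Suc algebra_simps)

lemma power_sum_mult: "(\<Sum>i<n * k. x ^ i) = (\<Sum>i<k. x ^ i) * (\<Sum>i<n. (x ^ k) ^ i)"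
  for x :: int
proof (induction n)
  case (Suc n)
  have add: "(\<Sum>i<a + b. x ^ i) = (\<Sum>i<a. x ^ i) + x ^ a * (\<Sum>i<b. x ^ i)" for a b
    by (induction b) (simp_all add: algebra_simps power_add)
  have "(\<Sum>i<Suc n * k. x ^ i) = (\<Sum>i<n * k + k. x ^ i)" by (simp add: add.commute)
  also have "\<dots> = (\<Sum>i<k. x ^ i) * (\<Sum>i<n. (x ^ k) ^ i) + (x ^ k) ^ n * (\<Sum>i<k. x ^ i)"
    unfolding add Suc by (simp add: power_mult[symmetric] mult.commute)
  also have "\<dots> = (\<Sum>i<k. x ^ i) * (\<Sum>i<Suc n. (x ^ k) ^ i)" by (simp add: algebra_simps)
  finally show ?case .
qed simp

text \<open>Peel off one prime \<open>p\<close> of \<open>k = p * l\<close>: the sum of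
  \<open>k\<close> terms is the sum of \<open>l\<close> terms in \<open>x\<close> times a sum of
  \<open>p\<close> terms in \<open>x ^ l\<close>, each of them 1 modulo \<open>p\<close>.\<close>

lemma dvd_power_sum:
  fixes x :: int
  assumes "k > 0" "\<And>p. Factorial_Ring.prime p \<Longrightarrow> p dvd k \<Longrightarrow> int p dvd x - 1" "k dvd n"
  shows "int k dvd (\<Sum>i<n. x ^ i)"
proof -
  have "int k dvd (\<Sum>i<k. x ^ i)"
    using assms(1,2)
  proof (induction k rule: less_induct)
    case (less k)
    show ?case
    proof (cases "k = 1")
      case False
      then obtain p where p: "Factorial_Ring.prime p" "p dvd k" using prime_factor_nat by blast
      then obtain l where k: "k = p * l" by (auto elim: dvdE)
      have l: "l > 0" "l < k" using less.prems(1) p k prime_gt_1_nat[OF p(1)] by auto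
      have IH: "int l dvd (\<Sum>i<l. x ^ i)" using less.IH[OF l(2,1)] less.prems(2) k by auto
      have "[x = 1] (mod int p)" using less.prems(2)[OF p] by (simp add: cong_iff_dvd_diff)
      then have "[(\<Sum>i<p. (x ^ l) ^ i) = (\<Sum>i<p. (1 ^ l) ^ i)] (mod int p)"
        by (intro cong_sum cong_pow)
      then have "int p dvd (\<Sum>i<p. (x ^ l) ^ i)" by (simp add: cong_dvd_iff)
      then show ?thesis using IH
        by (simp add: k power_sum_mult mult.commute[of "int p"] mult_dvd_mono)
    qed simp
  qed
  moreover obtain q where "n = q * k" using assms(3) by (metis dvd_def mult.commute)
  ultimately show ?thesis by (simp add: power_sum_mult)
qed

lemma dvd_geo_sum:
  assumes "k > 0" "\<And>p. Factorial_Ring.prime p \<Longrightarrow> p dvd k \<Longrightarrow> int p dvd x - 1" "k dvd n"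
  shows "int k dvd geo_sum x n"
  using dvd_power_sum[OF assms] by (simp add: geo_sum_eq_sum)

lemma dvd_power_diff_one:
  assumes "k > 0" "\<And>p. Factorial_Ring.prime p \<Longrightarrow> p dvd k \<Longrightarrow> int p dvd x - 1" "k dvd n"
  shows "int k dvd x ^ n - 1"
  using dvd_power_sum[OF assms] by (simp add: power_diff_1_eq)

lemma key_exp_eq:
  assumes "x ^ j \<ge> 0"
  shows "(x - 1) * key_exp x j = x ^ nat (x ^ j) * (x ^ Suc j - x ^ j - x) + x"
proof -
  have "(x - 1) * key_exp x j = (x - 1) * x ^ (j + nat (x ^ j)) - x * (x ^ nat (x ^ j) - 1)"
    unfolding key_exp_def geo_sum_eq[symmetric] by (simp add: algebra_simps)
  then show ?thesis by (simp add: algebra_simps power_add)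
qed

text \<open>The index 2 is chosen because \<open>x ^ 2\<close> is nonnegative for either sign of
  \<open>x\<close>. Multiplied by \<open>x - 1\<close>, the exponent is \<open>x\<close> times a
  number that is 1 modulo \<open>x\<close>, so its vanishing would make \<open>x\<close> a
  unit.\<close>

lemma key_exp_2_nonzero:
  assumes "\<bar>x\<bar> \<ge> 2" shows "key_exp x 2 \<noteq> 0"
proof
  assume "key_exp x 2 = 0"
  then have "x ^ nat (x ^ 2) * (x ^ 3 - x ^ 2 - x) + x = 0"
    using key_exp_eq[of x 2] by (simp add: eval_nat_numeral)
  then have "x * (x ^ nat (x ^ 2) * (x ^ 2 - x - 1) + 1) = 0"
    by (simp add: algebra_simps eval_nat_numeral)
  then have "x ^ nat (x ^ 2) * (x ^ 2 - x - 1) + 1 = 0" using assms by auto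
  then have "x ^ nat (x ^ 2) * (- (x ^ 2 - x - 1)) = 1" by (simp add: algebra_simps)
  then have "x ^ nat (x ^ 2) dvd 1" by (metis dvd_triv_left)
  moreover have "x dvd x ^ nat (x ^ 2)" using assms by (intro dvd_power) auto
  ultimately have "x dvd 1" using dvd_trans by blast
  then show False using assms by auto
qed

section \<open>Cyclic subgroups and products of subgroups\<close>

context group
begin

lemma int_pow_eq_nat_pow:
  assumes "x \<in> carrier G" "ord x > 0"
  shows "\<exists>n::nat. x [^] (z::int) = x [^] n"
proof -
  have "int (ord x) dvd z mod int (ord x) - z" by (metis dvd_minus_mod dvd_diff_commute)
  then have "x [^] z = x [^] (int (nat (z mod int (ord x))))"
    using assms by (simp add: int_pow_eq)
  then show ?thesis by (metis int_pow_int)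
qed

lemma generate_pow_mem:
  assumes "x \<in> carrier G"
  shows "y \<in> generate G {x [^] (k::nat)} \<longleftrightarrow> (\<exists>z::int. y = x [^] (int k * z))"
  using assms by (auto simp: generate_pow int_pow_pow int_pow_int[symmetric])

text \<open>The rules for moving letters past powers of \<open>C\<close>, and powers of one
  generator past the other, take natural exponents; finite order provides them.\<close>

lemma generate_pow_mem_nat:
  assumes "x \<in> carrier G" "ord x > 0"
  shows "y \<in> generate G {x [^] (k::nat)} \<longleftrightarrow> (\<exists>n::nat. y = x [^] (k * n))"
proof -
  have "(x [^] k) [^] ord x = \<one>" using assms by (metis nat_pow_pow mult.commute nat_pow_one pow_ord_eq_1)
  then have "ord (x [^] k) dvd ord x" using assms by (simp add: pow_eq_id)
  then have "ord (x [^] k) \<noteq> 0" using assms by auto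
  then show ?thesis using assms by (auto simp: generate_pow_nat nat_pow_pow)
qed

lemma set_mult_memI: "h \<in> H \<Longrightarrow> k \<in> K \<Longrightarrow> h \<otimes> k \<in> H <#> K"
  by (auto simp: set_mult_def)

lemma set_mult_memE:
  assumes "x \<in> H <#> K" obtains h k where "h \<in> H" "k \<in> K" "x = h \<otimes> k"
  using assms by (auto simp: set_mult_def)

lemma subgroup_set_mult:
  assumes "subgroup H G" "subgroup K G" "\<And>k h. k \<in> K \<Longrightarrow> h \<in> H \<Longrightarrow> k \<otimes> h \<in> H <#> K"
  shows "subgroup (H <#> K) G"
proof (rule subgroup.intro)
  interpret H: subgroup H G by fact
  interpret K: subgroup K G by fact
  show "H <#> K \<subseteq> carrier G" by (simp add: setmult_subset_G H.subset K.subset)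
  show "\<one> \<in> H <#> K" using set_mult_memI[OF H.one_closed K.one_closed] by simp
  fix x assume "x \<in> H <#> K"
  then obtain h k where x: "h \<in> H" "k \<in> K" "x = h \<otimes> k" by (rule set_mult_memE)
  then have "inv x = inv k \<otimes> inv h" by (simp add: inv_mult_group)
  then show "inv x \<in> H <#> K" using assms(3) x by simp
  fix y assume "y \<in> H <#> K"
  then obtain h' k' where y: "h' \<in> H" "k' \<in> K" "y = h' \<otimes> k'" by (rule set_mult_memE)
  obtain h'' k'' where kh: "h'' \<in> H" "k'' \<in> K" "k \<otimes> h' = h'' \<otimes> k''"
    using assms(3)[OF x(2) y(1)] by (rule set_mult_memE)
  have "x \<otimes> y = h \<otimes> (k \<otimes> h') \<otimes> k'" using x y by (simp add: m_assoc)
  also have "\<dots> = (h \<otimes> h'') \<otimes> (k'' \<otimes> k')" unfolding kh(3) using x y kh by (simp add: m_assoc)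
  finally show "x \<otimes> y \<in> H <#> K" using set_mult_memI[of "h \<otimes> h''" H "k'' \<otimes> k'" K] x y kh by simp
qed

lemma card_set_mult:
  assumes "subgroup H G" "subgroup K G" "finite H" "finite K"
  shows "card (H <#> K) * card (H \<inter> K) = card H * card K"
proof -
  interpret H: subgroup H G by fact
  interpret K: subgroup K G by fact
  let ?f = "\<lambda>(h, k). h \<otimes> k"
  let ?fib = "\<lambda>x. {p \<in> H \<times> K. ?f p = x}"
  have HK: "H <#> K = ?f ` (H \<times> K)" unfolding set_mult_def by auto
  have fib: "card (?fib x) = card (H \<inter> K)" if xm: "x \<in> H <#> K" for x
  proof -
    obtain h k where x: "h \<in> H" "k \<in> K" "x = h \<otimes> k" using xm by (rule set_mult_memE)
    \<comment> \<open>The fibre over \<open>h k\<close> is a torsor under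
      \<open>H \<inter> K\<close>.\<close>
    have "bij_betw (\<lambda>u. (h \<otimes> u, inv u \<otimes> k)) (H \<inter> K) (?fib x)"
    proof (rule bij_betw_byWitness[where f' = "\<lambda>(h', k'). inv h \<otimes> h'"])
      show "\<forall>u\<in>H \<inter> K. (case (h \<otimes> u, inv u \<otimes> k) of (h', k') \<Rightarrow> inv h \<otimes> h') = u"
        using x by (auto simp: m_assoc[symmetric])
      show "(\<lambda>u. (h \<otimes> u, inv u \<otimes> k)) ` (H \<inter> K) \<subseteq> ?fib x"
      proof clarsimp
        fix u assume u: "u \<in> H" "u \<in> K"
        have "u \<otimes> (inv u \<otimes> k) = k" using u x(2) by (simp add: m_assoc[symmetric])
        then have "h \<otimes> u \<otimes> (inv u \<otimes> k) = h \<otimes> k" using u x(1,2) by (simp add: m_assoc)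
        then show "h \<otimes> u \<in> H \<and> inv u \<otimes> k \<in> K \<and> h \<otimes> u \<otimes> (inv u \<otimes> k) = x"
          using u x by simp
      qed
      have aux: "inv h \<otimes> h' = k \<otimes> inv k'" if "h' \<in> H" "k' \<in> K" "h' \<otimes> k' = x" for h' k'
      proof -
        have "inv h \<otimes> h' = inv h \<otimes> (h' \<otimes> k') \<otimes> inv k'" using that(1,2) x(1) by (simp add: m_assoc)
        also have "\<dots> = inv h \<otimes> (h \<otimes> k) \<otimes> inv k'" using that(3) x(3) by simp
        also have "\<dots> = k \<otimes> inv k'" using that(1,2) x(1,2) by (simp add: m_assoc[symmetric])
        finally show ?thesis .
      qed
      have mem: "inv h \<otimes> h' \<in> H \<inter> K" if "h' \<in> H" "k' \<in> K" "h' \<otimes> k' = x" for h' k'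
        using that(1,2) x(1,2) aux[OF that] by (metis H.m_closed H.m_inv_closed IntI K.m_closed K.m_inv_closed)
      then show "(\<lambda>(h', k'). inv h \<otimes> h') ` ?fib x \<subseteq> H \<inter> K" by auto
      have "h \<otimes> (inv h \<otimes> h') = h' \<and> inv (inv h \<otimes> h') \<otimes> k = k'"
        if "h' \<in> H" "k' \<in> K" "h' \<otimes> k' = x" for h' k'
      proof
        show "h \<otimes> (inv h \<otimes> h') = h'" using that(1) x(1) by (simp add: m_assoc[symmetric])
        show "inv (inv h \<otimes> h') \<otimes> k = k'"
          unfolding aux[OF that] using that(2) x(2) by (simp add: inv_mult_group m_assoc)
      qed
      then show "\<forall>p\<in>?fib x. (h \<otimes> (case p of (h', k') \<Rightarrow> inv h \<otimes> h'),
          inv (case p of (h', k') \<Rightarrow> inv h \<otimes> h') \<otimes> k) = p"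
        by auto
    qed
    then show ?thesis by (simp add: bij_betw_same_card)
  qed
  have fin: "finite (H \<times> K)" using assms by simp
  have "card H * card K = card (H \<times> K)" by (simp add: card_cartesian_product)
  also have "\<dots> = (\<Sum>x\<in>?f ` (H \<times> K). card (?fib x))"
    using fin by (intro sum.image_gen[of _ "\<lambda>_. 1::nat", simplified])
  also have "\<dots> = (\<Sum>x\<in>H <#> K. card (H \<inter> K))" unfolding HK[symmetric] by (intro sum.cong) (auto simp: fib)
  finally show ?thesis by simp
qed

end

section \<open>Orders of the generators and their primes\<close>

context macdonald
begin

lemma change_exponents:
  assumes "int (ord A) dvd \<alpha>' - \<alpha>" "int (ord B) dvd \<beta>' - \<beta>"
  shows "macdonald G A B C \<alpha>' \<beta>'"
proof unfold_locales
  have "A [^] \<alpha> = A [^] \<alpha>'" "B [^] \<beta> = B [^] \<beta>'" using assms by (auto simp: int_pow_eq)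
  then show "A \<otimes> C = C \<otimes> A [^] \<alpha>'" "C \<otimes> B = B [^] \<beta>' \<otimes> C" using AC CB by auto
qed (use AB in auto)

lemma ord_A_pos:
  assumes "\<bar>\<alpha>\<bar> \<ge> 2" shows "ord A > 0"
proof -
  have "A [^] (key_exp \<alpha> 2 * (\<alpha> - 1) * (\<alpha> - 1)) = \<one>" by (rule A_pow_trivial) auto
  then have "int (ord A) dvd key_exp \<alpha> 2 * (\<alpha> - 1) * (\<alpha> - 1)" by (simp add: int_pow_eq_id)
  moreover have "key_exp \<alpha> 2 * (\<alpha> - 1) * (\<alpha> - 1) \<noteq> 0" using key_exp_2_nonzero[OF assms] assms by auto
  ultimately show ?thesis by (metis dvd_0_left_iff neq0_conv of_nat_0)
qed

lemma C_pow_ord_A: "C [^] ord A \<otimes> A [^] geo_sum \<alpha> (ord A) = \<one>"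
  using A_pow_B[of "ord A"] by simp

text \<open>The conjugation formula for \<open>A ^ ord A\<close> shows that \<open>C ^ ord A\<close>
  is a power of \<open>A\<close>. It therefore commutes with \<open>A\<close>, while conjugation by
  it raises \<open>A\<close> to the power \<open>\<alpha> ^ ord A\<close>.\<close>

lemma ord_A_dvd: "int (ord A) dvd \<alpha> ^ ord A - 1"
proof -
  let ?m = "ord A"
  have "C [^] ?m = inv (A [^] geo_sum \<alpha> ?m)" using C_pow_ord_A by (simp add: inv_equality)
  then have "C [^] ?m = A [^] (- geo_sum \<alpha> ?m)" by (simp add: int_pow_neg)
  then have "A [^] (1::int) \<otimes> C [^] ?m = C [^] ?m \<otimes> A [^] (1::int)"
    by (simp only: int_pow_mult[symmetric] A_closed add.commute)
  then have "A [^] (\<alpha> ^ ?m) = A [^] (1::int)" unfolding A_C_pow by (subst (asm) l_cancel) auto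
  then show ?thesis using int_pow_eq[OF A_closed, of 1 "\<alpha> ^ ?m"] by simp
qed

text \<open>Let \<open>d\<close> be the order of \<alpha> modulo \<open>p\<close>. The index
  \<open>j = totient d\<close> makes \<open>\<alpha> ^ (\<alpha> ^ j)\<close> congruent to \<alpha>
  modulo \<open>p\<close>. Then the vanishing of the key exponent modulo \<open>p\<close> collapses
  to \<open>\<alpha> ^ j = 1\<close>, that is \<open>d dvd totient d\<close>, and this forces
  \<open>d = 1\<close>.\<close>

lemma prime_dvd_ord_A:
  assumes "\<alpha> > 0" "\<beta> > 0" "ord A > 0" "Factorial_Ring.prime p" "p dvd ord A"
  shows "int p dvd \<alpha> - 1"
proof (rule ccontr)
  assume np: "\<not> int p dvd \<alpha> - 1"
  define n where "n = nat \<alpha>"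
  have \<alpha>: "\<alpha> = int n" "n > 0" using assms(1) by (auto simp: n_def)
  have pr: "Factorial_Ring.prime (int p)" using assms(4) by simp
  have "int p dvd \<alpha> ^ ord A - 1" using ord_A_dvd assms(5) by (meson dvd_trans int_dvd_int_iff)
  then have "[\<alpha> ^ ord A = 1] (mod int p)" by (simp add: cong_iff_dvd_diff)
  then have cn: "[n ^ ord A = 1] (mod p)" unfolding \<alpha> by (metis cong_int_iff of_nat_1 of_nat_power)
  define d where "d = Pocklington.ord p n"
  have d_dvd: "d dvd ord A" using cn unfolding d_def ord_divides[symmetric] .
  have d0: "d > 0" using d_dvd assms(3) by (metis dvd_0_left_iff neq0_conv)
  \<comment> \<open>Euler's theorem modulo \<open>d\<close> requires \<alpha> to be prime to
    \<open>d\<close>. This holds because \<open>d\<close> divides \<open>ord A\<close>, modulo which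
    a power of \<alpha> is 1.\<close>
  have "coprime (\<alpha> ^ ord A) (int (ord A))"
    using ord_A_dvd by (metis cong_iff_dvd_diff cong_sym cong_imp_coprime coprime_1_left)
  then have "coprime n (ord A)" unfolding \<alpha> using assms(3)
    by (simp add: coprime_int_iff flip: of_nat_power)
  then have "coprime n d" "coprime n p" using d_dvd assms(5) by (auto intro: coprime_divisors[OF dvd_refl])
  define j where "j = totient d"
  have cd: "[n ^ j = 1] (mod d)" unfolding j_def by (rule euler_theorem) fact
  then have "[n ^ (n ^ j) = n ^ 1] (mod p)"
    using order_divides_expdiff[of p n "n ^ j" 1] \<open>coprime n p\<close>
    unfolding d_def by (simp only: coprime_commute)
  then have c1: "[\<alpha> ^ nat (\<alpha> ^ j) = \<alpha>] (mod int p)"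
    unfolding \<alpha> by (metis cong_int_iff nat_int of_nat_power power_one_right)
  have "int p dvd key_exp \<alpha> j * (\<alpha> - 1) * (\<alpha> - 1)"
    using A_pow_trivial[of j] assms by (simp add: int_pow_eq_id) (meson dvd_trans int_dvd_int_iff)
  then have "int p dvd (\<alpha> - 1) * key_exp \<alpha> j" using np pr by (auto simp: prime_dvd_mult_iff)
  then have "int p dvd \<alpha> ^ nat (\<alpha> ^ j) * (\<alpha> ^ Suc j - \<alpha> ^ j - \<alpha>) + \<alpha>"
    using key_exp_eq[of \<alpha> j] assms by simp
  moreover have "[\<alpha> ^ nat (\<alpha> ^ j) * (\<alpha> ^ Suc j - \<alpha> ^ j - \<alpha>) + \<alpha> = \<alpha> * (\<alpha> ^ Suc j - \<alpha> ^ j - \<alpha>) + \<alpha>] (mod int p)"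
    by (intro cong_add cong_mult c1 cong_refl)
  moreover have "\<alpha> * (\<alpha> ^ Suc j - \<alpha> ^ j - \<alpha>) + \<alpha> = \<alpha> * ((\<alpha> - 1) * (\<alpha> ^ j - 1))"
    by (simp add: algebra_simps)
  ultimately have "int p dvd \<alpha> * ((\<alpha> - 1) * (\<alpha> ^ j - 1))" by (metis cong_dvd_iff)
  moreover have "\<not> int p dvd \<alpha>" unfolding \<alpha> int_dvd_int_iff
    using \<open>coprime n p\<close> assms(4) by (metis coprime_absorb_right not_prime_unit)
  ultimately have "int p dvd \<alpha> ^ j - 1" using np pr by (auto simp: prime_dvd_mult_iff)
  then have "[n ^ j = 1] (mod p)"
    unfolding \<alpha> by (metis cong_iff_dvd_diff cong_int_iff of_nat_1 of_nat_power)
  then have "d dvd totient d" unfolding ord_divides d_def j_def .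
  moreover have "totient d > 0" using d0 by simp
  ultimately have "d \<le> totient d" by (auto intro: dvd_imp_le)
  then have "d = 1" using totient_less[of d] d0 by (cases "d = 1") auto
  then have "[n ^ 1 = 1] (mod p)" unfolding d_def using ord_divides[of n 1 p] by simp
  then have "[\<alpha> = 1] (mod int p)" unfolding \<alpha> by (metis cong_int_iff of_nat_1 power_one_right)
  then show False using np by (simp add: cong_iff_dvd_diff)
qed

lemma C_pow_ord_A_eq_one:
  assumes "ord A > 0" "\<And>p. Factorial_Ring.prime p \<Longrightarrow> p dvd ord A \<Longrightarrow> int p dvd \<alpha> - 1"
  shows "C [^] ord A = \<one>"
proof -
  have "A [^] geo_sum \<alpha> (ord A) = \<one>" using dvd_geo_sum[OF assms dvd_refl] by (simp add: int_pow_eq_id)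
  then show ?thesis using C_pow_ord_A by simp
qed

end

section \<open>Normal Hall subgroups\<close>

lemma dvd_mult_gcd:
  fixes n m1 m2 x y :: int
  assumes "n dvd m1 * m2" "m1 dvd x" "gcd n m2 dvd y"
  shows "n dvd x * y"
proof -
  have "n dvd gcd (m1 * n) (m1 * m2)" using assms(1) by simp
  then have "n dvd \<bar>m1\<bar> * gcd n m2" by (simp add: gcd_mult_left abs_mult)
  moreover have "\<bar>m1\<bar> dvd x" using assms(2) by simp
  ultimately show ?thesis using assms(3) by (meson dvd_trans mult_dvd_mono)
qed

text \<open>The exponent \<open>k\<close> acts as an idempotent: 1 modulo \<open>m1\<close> and 0
  modulo \<open>m2\<close>. The locale serves three times: with the 3-part and the 3'-part of the
  orders in either role, and with \<open>81 1 1\<close>, where it factors the whole 3-part into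
  three cyclic subgroups.\<close>

locale macdonald_split = macdonald +
  fixes m1 m2 k :: nat
  assumes gen: "carrier G = generate G {A, B}"
    and ord_A: "ord A > 0" "ord A dvd m1 * m2"
    and ord_B: "ord B > 0" "ord B dvd m1 * m2"
    and primes_A: "\<And>p. Factorial_Ring.prime p \<Longrightarrow> p dvd ord A \<Longrightarrow> int p dvd \<alpha> - 1"
    and primes_B: "\<And>p. Factorial_Ring.prime p \<Longrightarrow> p dvd ord B \<Longrightarrow> int p dvd \<beta> - 1"
    and k: "m2 dvd k" "int m1 dvd int k - 1"
begin

abbreviation "PA \<equiv> generate G {A [^] k}"
abbreviation "PB \<equiv> generate G {B [^] k}"
abbreviation "PC \<equiv> generate G {C [^] k}"
abbreviation "PX \<equiv> PC <#> PA"

definition "PS \<equiv> PX <#> PB"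

lemma swap_split: "macdonald_split G B A (inv C) \<beta> \<alpha> m1 m2 k"
  by (intro macdonald_split.intro swap macdonald_split_axioms.intro)
     (use ord_A ord_B primes_A primes_B k gen in \<open>auto simp: insert_commute\<close>)

lemma C_pow_ord: "C [^] ord A = \<one>"
  by (rule C_pow_ord_A_eq_one[OF ord_A(1) primes_A])

lemma ord_C_dvd: "ord C dvd ord A"
  using C_pow_ord by (simp add: pow_eq_id)

lemma ord_C: "ord C > 0"
  using ord_C_dvd ord_A(1) by (metis dvd_0_left_iff neq0_conv)

text \<open>As \<open>m1\<close> divides \<open>k - 1\<close>, multiplying such an exponent by
  \<open>k\<close> does not change the power of \<open>A\<close>.\<close>

lemma PA_mem_of_dvd:
  assumes "int (gcd (ord A) m2) dvd z"
  shows "A [^] z \<in> PA"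
proof -
  have "int (ord A) dvd (int k - 1) * z"
    using dvd_mult_gcd[of "int (ord A)" "int m1" "int m2"] ord_A(2) k(2) assms
    by (metis gcd_int_int_eq of_nat_dvd_iff of_nat_mult)
  then have "A [^] z = A [^] (int k * z)" by (simp add: int_pow_eq algebra_simps)
  then show ?thesis by (auto simp: generate_pow_mem)
qed

text \<open>Here the condition on the primes of \<open>ord A\<close> keeps the subgroups closed
  under conjugation: \<open>gcd (ord A) m2\<close> divides \<open>k\<close>, and each of its primes
  divides \<open>\<alpha> - 1\<close>.\<close>

lemma PA_geo_sum: "A [^] geo_sum \<alpha> (k * n) \<in> PA"
  and PA_power_diff: "A [^] (1 - \<alpha> ^ (k * n)) \<in> PA"
proof -
  let ?g = "gcd (ord A) m2"
  have g: "?g > 0" "?g dvd k * n" using ord_A(1) k(1) by auto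
  have pr: "int p dvd \<alpha> - 1" if "Factorial_Ring.prime p" "p dvd ?g" for p
    using primes_A[OF that(1)] that(2) by simp
  show "A [^] geo_sum \<alpha> (k * n) \<in> PA"
    by (rule PA_mem_of_dvd, rule dvd_geo_sum[OF g(1) pr g(2)])
  have "int ?g dvd \<alpha> ^ (k * n) - 1"
    by (rule dvd_power_diff_one[OF g(1) pr g(2)])
  then show "A [^] (1 - \<alpha> ^ (k * n)) \<in> PA" by (intro PA_mem_of_dvd) (metis dvd_diff_commute)
qed

lemma subgroup_PA: "subgroup PA G" and subgroup_PB: "subgroup PB G" and subgroup_PC: "subgroup PC G"
  by (auto intro: generate_is_subgroup)

lemma PA_PC:
  assumes "a \<in> PA" "c \<in> PC"
  shows "\<exists>a'\<in>PA. a \<otimes> c = c \<otimes> a'"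
proof -
  obtain z where a: "a = A [^] (int k * z)" using assms by (auto simp: generate_pow_mem)
  obtain n where c: "c = C [^] (k * n)" using assms ord_C by (auto simp: generate_pow_mem_nat)
  have "a \<otimes> c = c \<otimes> A [^] (int k * (z * \<alpha> ^ (k * n)))"
    unfolding a c A_C_pow by (simp add: mult.assoc)
  moreover have "A [^] (int k * (z * \<alpha> ^ (k * n))) \<in> PA" by (auto simp: generate_pow_mem)
  ultimately show ?thesis by blast
qed

lemma subgroup_PX: "subgroup PX G"
proof (rule subgroup_set_mult[OF subgroup_PC subgroup_PA])
  fix a c assume "a \<in> PA" "c \<in> PC"
  then show "a \<otimes> c \<in> PC <#> PA" using PA_PC[of a c] set_mult_memI[of c PC] by auto
qed

text \<open>The mirror image replaces \<open>C\<close> by its inverse; \<open>PC\<close> must stay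
  the same for facts to transfer by symmetry.\<close>

lemma inv_C_gen: "generate G {inv C [^] k} = PC"
proof -
  have "y \<in> generate G {inv C [^] k} \<longleftrightarrow> y \<in> PC" for y
  proof -
    have "(\<exists>z::int. y = C [^] - (int k * z)) \<longleftrightarrow> (\<exists>z::int. y = C [^] (int k * z))"
      by (metis minus_minus mult_minus_right)
    then show ?thesis by (simp add: generate_pow_mem int_pow_inv int_pow_neg)
  qed
  then show ?thesis by blast
qed

lemma PC_carrier: "c \<in> PC \<Longrightarrow> c \<in> carrier G"
  and PA_carrier: "a \<in> PA \<Longrightarrow> a \<in> carrier G"
  and PB_carrier: "b \<in> PB \<Longrightarrow> b \<in> carrier G"
  and PX_carrier: "x \<in> PX \<Longrightarrow> x \<in> carrier G"
  using subgroup.mem_carrier[OF subgroup_PC] subgroup.mem_carrier[OF subgroup_PA]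
    subgroup.mem_carrier[OF subgroup_PB] subgroup.mem_carrier[OF subgroup_PX] by auto

lemma PB_PC:
  assumes "b \<in> PB" "c \<in> PC"
  shows "\<exists>b'\<in>PB. b \<otimes> c = c \<otimes> b'"
  using macdonald_split.PA_PC[OF swap_split, of b c] assms inv_C_gen by simp

lemma PC_A:
  assumes "c \<in> PC"
  shows "\<exists>a\<in>PA. c \<otimes> A = A \<otimes> (c \<otimes> a)"
proof -
  obtain n where c: "c = C [^] (k * n)" using assms ord_C by (auto simp: generate_pow_mem_nat)
  have "A \<otimes> (c \<otimes> A [^] (1 - \<alpha> ^ (k * n))) = (A [^] (1::int) \<otimes> c) \<otimes> A [^] (1 - \<alpha> ^ (k * n))"
    unfolding c by (simp add: m_assoc)
  also have "\<dots> = c \<otimes> A"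
    unfolding c A_C_pow by (simp add: m_assoc int_pow_mult[symmetric])
  finally show ?thesis using PA_power_diff[of n] by metis
qed

lemma PB_A:
  assumes "b \<in> PB"
  shows "\<exists>c\<in>PC. \<exists>b'\<in>PB. b \<otimes> A = A \<otimes> (c \<otimes> b')"
proof -
  obtain n where b: "b = B [^] (k * n)" using assms ord_B by (auto simp: generate_pow_mem_nat)
  have "inv C [^] (k * n) \<in> PC"
    unfolding inv_C_gen[symmetric] using ord_C by (subst generate_pow_mem_nat) auto
  moreover have "B [^] geo_sum \<beta> (k * n) \<in> PB" by (rule macdonald_split.PA_geo_sum[OF swap_split])
  ultimately show ?thesis unfolding b B_pow_A by blast
qed

lemma PA_B:
  assumes "a \<in> PA"
  shows "\<exists>x\<in>PX. a \<otimes> B = B \<otimes> x"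
proof -
  obtain n where a: "a = A [^] (k * n)" using assms ord_A by (auto simp: generate_pow_mem_nat)
  have "C [^] (k * n) \<in> PC" using ord_C by (auto simp: generate_pow_mem_nat)
  then show ?thesis unfolding a A_pow_B using PA_geo_sum set_mult_memI by blast
qed

lemma PX_A:
  assumes "x \<in> PX"
  shows "\<exists>x'\<in>PX. x \<otimes> A = A \<otimes> x'"
proof -
  obtain c a where x: "c \<in> PC" "a \<in> PA" "x = c \<otimes> a" using assms by (rule set_mult_memE)
  obtain a' where a': "a' \<in> PA" "c \<otimes> A = A \<otimes> (c \<otimes> a')" using PC_A[OF x(1)] by blast
  obtain z where z: "a = A [^] (int k * z)" using x(2) by (auto simp: generate_pow_mem)
  have "a \<otimes> A = A \<otimes> a" unfolding z by (rule int_pow_commute) auto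
  then have "x \<otimes> A = (c \<otimes> A) \<otimes> a" using x PC_carrier PA_carrier by (simp add: m_assoc)
  also have "\<dots> = A \<otimes> (c \<otimes> (a' \<otimes> a))" unfolding a' using x a' PC_carrier PA_carrier by (simp add: m_assoc)
  finally show ?thesis using set_mult_memI[OF x(1) subgroup.m_closed[OF subgroup_PA a'(1) x(2)]] by blast
qed

text \<open>\<open>PB_A\<close> crosses a single letter \<open>A\<close>, so elements of
  \<open>PA\<close> are crossed letter by letter; the powers of \<open>C\<close> that arise are
  absorbed into \<open>PX\<close>.\<close>

lemma PB_A_pow:
  assumes "b \<in> PB"
  shows "\<exists>x\<in>PX. \<exists>b'\<in>PB. b \<otimes> A [^] (n::nat) = A [^] n \<otimes> (x \<otimes> b')"
proof (induction n)
  case 0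
  have "b \<otimes> A [^] (0::nat) = A [^] (0::nat) \<otimes> (\<one> \<otimes> b)" using assms PB_carrier by simp
  then show ?case using assms subgroup.one_closed[OF subgroup_PX] by blast
next
  case (Suc n)
  then obtain x b' where x: "x \<in> PX" "b' \<in> PB" "b \<otimes> A [^] n = A [^] n \<otimes> (x \<otimes> b')" by blast
  obtain c b'' where c: "c \<in> PC" "b'' \<in> PB" "b' \<otimes> A = A \<otimes> (c \<otimes> b'')" using PB_A[OF x(2)] by blast
  obtain x' where x': "x' \<in> PX" "x \<otimes> A = A \<otimes> x'" using PX_A[OF x(1)] by blast
  note closed = assms[THEN PB_carrier] x(1)[THEN PX_carrier] x(2)[THEN PB_carrier]
    c(1)[THEN PC_carrier] c(2)[THEN PB_carrier] x'(1)[THEN PX_carrier]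
  have "b \<otimes> A [^] Suc n = (b \<otimes> A [^] n) \<otimes> A" using closed by (simp add: m_assoc)
  also have "\<dots> = A [^] n \<otimes> (x \<otimes> (b' \<otimes> A))" unfolding x(3) using closed by (simp add: m_assoc)
  also have "\<dots> = A [^] n \<otimes> ((x \<otimes> A) \<otimes> (c \<otimes> b''))" unfolding c(3) using closed by (simp add: m_assoc)
  also have "\<dots> = A [^] Suc n \<otimes> ((x' \<otimes> c) \<otimes> b'')" unfolding x'(2) using closed by (simp add: m_assoc)
  finally have eq: "b \<otimes> A [^] Suc n = A [^] Suc n \<otimes> ((x' \<otimes> c) \<otimes> b'')" .
  have "c \<otimes> \<one> \<in> PX" by (rule set_mult_memI[OF c(1) subgroup.one_closed[OF subgroup_PA]])
  then have "x' \<otimes> c \<in> PX" using x'(1) closed subgroup.m_closed[OF subgroup_PX] by simp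
  then show ?case using eq c(2) by blast
qed

lemma PC_subset_PX: "PC \<subseteq> PX"
proof
  fix c assume c: "c \<in> PC"
  show "c \<in> PX" using set_mult_memI[OF c subgroup.one_closed[OF subgroup_PA]] PC_carrier[OF c] by simp
qed

lemma PA_subset_PX: "PA \<subseteq> PX"
proof
  fix a assume a: "a \<in> PA"
  show "a \<in> PX" using set_mult_memI[OF subgroup.one_closed[OF subgroup_PC] a] PA_carrier[OF a] by simp
qed

lemma subgroup_PS: "subgroup PS G"
  unfolding PS_def
proof (rule subgroup_set_mult[OF subgroup_PX subgroup_PB])
  fix b x assume b: "b \<in> PB" and "x \<in> PX"
  then obtain c a where x: "c \<in> PC" "a \<in> PA" "x = c \<otimes> a" by (meson set_mult_memE)
  obtain b' where b': "b' \<in> PB" "b \<otimes> c = c \<otimes> b'" using PB_PC[OF b x(1)] by blast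
  obtain n where a: "a = A [^] (k * n)" using x(2) ord_A by (auto simp: generate_pow_mem_nat)
  obtain x' b'' where x': "x' \<in> PX" "b'' \<in> PB" "b' \<otimes> a = a \<otimes> (x' \<otimes> b'')"
    using PB_A_pow[OF b'(1)] unfolding a by blast
  note closed = b[THEN PB_carrier] b'(1)[THEN PB_carrier] x'(2)[THEN PB_carrier]
    x(1)[THEN PC_carrier] x(2)[THEN PA_carrier] x'(1)[THEN PX_carrier]
  have "b \<otimes> x = (b \<otimes> c) \<otimes> a" unfolding x(3) using closed by (simp add: m_assoc)
  also have "\<dots> = c \<otimes> (b' \<otimes> a)" unfolding b'(2) using closed by (simp add: m_assoc)
  also have "\<dots> = (c \<otimes> a \<otimes> x') \<otimes> b''" unfolding x'(3) using closed by (simp add: m_assoc)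
  finally have eq: "b \<otimes> x = (c \<otimes> a \<otimes> x') \<otimes> b''" .
  have "c \<otimes> a \<otimes> x' \<in> PX"
    using set_mult_memI[OF x(1,2)] x'(1) subgroup.m_closed[OF subgroup_PX] by blast
  then show "b \<otimes> x \<in> PX <#> PB" unfolding eq using x'(2) by (rule set_mult_memI)
qed

lemma PX_subset_PS: "PX \<subseteq> PS"
proof
  fix x assume x: "x \<in> PX"
  show "x \<in> PS" unfolding PS_def
    using set_mult_memI[OF x subgroup.one_closed[OF subgroup_PB]] PX_carrier[OF x] by simp
qed

lemma PB_subset_PS: "PB \<subseteq> PS"
proof
  fix b assume b: "b \<in> PB"
  show "b \<in> PS" unfolding PS_def
    using set_mult_memI[OF subgroup.one_closed[OF subgroup_PX] b] PB_carrier[OF b] by simp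
qed

lemma A_pow_mem: "A [^] k \<in> PS" and B_pow_mem: "B [^] k \<in> PS" and C_pow_mem: "C [^] k \<in> PS"
  using PX_subset_PS PA_subset_PX PC_subset_PX PB_subset_PS by (auto intro: generate.incl)

lemma PS_carrier: "s \<in> PS \<Longrightarrow> s \<in> carrier G"
  by (rule subgroup.mem_carrier[OF subgroup_PS])

lemma PS_A:
  assumes "s \<in> PS"
  shows "\<exists>s'\<in>PS. s \<otimes> A = A \<otimes> s'"
proof -
  obtain x b where s: "x \<in> PX" "b \<in> PB" "s = x \<otimes> b" using assms unfolding PS_def by (rule set_mult_memE)
  obtain x' b' where xb: "x' \<in> PX" "b' \<in> PB" "b \<otimes> A [^] (1::nat) = A [^] (1::nat) \<otimes> (x' \<otimes> b')"
    using PB_A_pow[OF s(2)] by blast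
  obtain x'' where x'': "x'' \<in> PX" "x \<otimes> A = A \<otimes> x''" using PX_A[OF s(1)] by blast
  note closed = s(1)[THEN PX_carrier] s(2)[THEN PB_carrier] xb(1)[THEN PX_carrier] xb(2)[THEN PB_carrier]
    x''(1)[THEN PX_carrier]
  have "s \<otimes> A = x \<otimes> (b \<otimes> A)" unfolding s(3) using closed by (simp add: m_assoc)
  also have "\<dots> = (x \<otimes> A) \<otimes> (x' \<otimes> b')" using xb(3) closed by (simp add: m_assoc)
  also have "\<dots> = A \<otimes> ((x'' \<otimes> x') \<otimes> b')" unfolding x''(2) using closed by (simp add: m_assoc)
  finally show ?thesis
    unfolding PS_def using set_mult_memI[OF subgroup.m_closed[OF subgroup_PX x''(1) xb(1)] xb(2)] by blast
qed

lemma PS_B: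
  assumes "s \<in> PS"
  shows "\<exists>s'\<in>PS. s \<otimes> B = B \<otimes> s'"
proof -
  obtain x b where s: "x \<in> PX" "b \<in> PB" "s = x \<otimes> b" using assms unfolding PS_def by (rule set_mult_memE)
  obtain c a where x: "c \<in> PC" "a \<in> PA" "x = c \<otimes> a" using s(1) by (rule set_mult_memE)
  obtain z where z: "b = B [^] (int k * z)" using s(2) by (auto simp: generate_pow_mem)
  have bB: "b \<otimes> B = B \<otimes> b" unfolding z by (rule int_pow_commute) auto
  obtain x' where x': "x' \<in> PX" "a \<otimes> B = B \<otimes> x'" using PA_B[OF x(2)] by blast
  have "\<exists>b'\<in>PB. c \<otimes> B = B \<otimes> (c \<otimes> b')"
    using macdonald_split.PC_A[OF swap_split, of c] x(1) inv_C_gen by simp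
  then obtain b' where b': "b' \<in> PB" "c \<otimes> B = B \<otimes> (c \<otimes> b')" by blast
  note closed = s(1)[THEN PX_carrier] s(2)[THEN PB_carrier] x(1)[THEN PC_carrier] x(2)[THEN PA_carrier]
    x'(1)[THEN PX_carrier] b'(1)[THEN PB_carrier]
  have "s \<otimes> B = c \<otimes> (a \<otimes> B) \<otimes> b" unfolding s(3) x(3) using closed bB by (simp add: m_assoc)
  also have "\<dots> = (c \<otimes> B) \<otimes> x' \<otimes> b" unfolding x'(2) using closed by (simp add: m_assoc)
  also have "\<dots> = B \<otimes> (c \<otimes> b' \<otimes> x' \<otimes> b)" unfolding b'(2) using closed by (simp add: m_assoc)
  finally have eq: "s \<otimes> B = B \<otimes> (c \<otimes> b' \<otimes> x' \<otimes> b)" .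
  have "c \<in> PS" "b' \<in> PS" "x' \<in> PS" "b \<in> PS"
    using x(1) b'(1) x'(1) s(2) PX_subset_PS PC_subset_PX PB_subset_PS by auto
  then have "c \<otimes> b' \<otimes> x' \<otimes> b \<in> PS" by (intro subgroup.m_closed[OF subgroup_PS])
  then show ?thesis using eq by blast
qed

lemma PS_normal: "PS \<lhd> G"
proof -
  define N where "N = {g \<in> carrier G. \<forall>s\<in>PS. \<exists>s'\<in>PS. s \<otimes> g = g \<otimes> s'}"
  have N_mult: "g \<otimes> h \<in> N" if "g \<in> N" "h \<in> N" for g h
  proof -
    have "\<exists>s'\<in>PS. s \<otimes> (g \<otimes> h) = (g \<otimes> h) \<otimes> s'" if s: "s \<in> PS" for s
    proof -
      obtain s' where s': "s' \<in> PS" "s \<otimes> g = g \<otimes> s'" using s \<open>g \<in> N\<close> by (auto simp: N_def)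
      obtain s'' where s'': "s'' \<in> PS" "s' \<otimes> h = h \<otimes> s''" using s' \<open>h \<in> N\<close> by (auto simp: N_def)
      note closed = PS_carrier[OF s] PS_carrier[OF s'(1)] PS_carrier[OF s''(1)]
      have gh: "g \<in> carrier G" "h \<in> carrier G" using \<open>g \<in> N\<close> \<open>h \<in> N\<close> by (auto simp: N_def)
      have "s \<otimes> (g \<otimes> h) = g \<otimes> s' \<otimes> h" unfolding s'(2)[symmetric] using gh closed by (simp add: m_assoc)
      also have "\<dots> = g \<otimes> (s' \<otimes> h)" using gh closed by (simp add: m_assoc)
      also have "\<dots> = (g \<otimes> h) \<otimes> s''" unfolding s''(2) using gh closed by (simp add: m_assoc)
      finally show ?thesis using s''(1) by blast
    qed
    then show ?thesis using that by (auto simp: N_def)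
  qed
  have N_one: "\<one> \<in> N" using PS_carrier by (auto simp: N_def)
  have N_pow: "g [^] (n::nat) \<in> N" if "g \<in> N" for g n
    by (induction n) (use N_one N_mult that in auto)
  have AN: "A \<in> N" and BN: "B \<in> N" using PS_A PS_B by (auto simp: N_def)
  \<comment> \<open>Membership in \<open>N\<close> is a one-sided inclusion, so closure under
    inverses is not automatic. For an element of finite order the inverse is a natural
    power.\<close>
  have N_inv: "inv g \<in> N" if gN: "g \<in> N" "ord g > 0" for g
  proof -
    have g: "g \<in> carrier G" using that by (simp add: N_def)
    obtain n :: nat where "g [^] (-1::int) = g [^] n" using int_pow_eq_nat_pow[OF g gN(2)] by blast
    then have "inv g = g [^] n" using g by (simp add: int_pow_neg)
    then show ?thesis using N_pow[OF that(1)] by simp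
  qed
  have gN: "g \<in> N" if "g \<in> generate G {A, B}" for g
    using that
  proof (induction rule: generate.induct)
    case (inv h)
    then have "h \<in> N" "ord h > 0" using AN BN ord_A ord_B by auto
    then show ?case by (rule N_inv)
  qed (use N_one AN BN N_mult in auto)
  show ?thesis
  proof (rule normal_invI[OF subgroup_PS])
    fix g s assume g: "g \<in> carrier G" and s: "s \<in> PS"
    have "inv g \<in> N" using gN[of "inv g"] inv_closed[OF g] unfolding gen by blast
    then obtain s' where s': "s' \<in> PS" "s \<otimes> inv g = inv g \<otimes> s'" using s by (auto simp: N_def)
    have "g \<otimes> s \<otimes> inv g = g \<otimes> (inv g \<otimes> s')" using s'(2) g s PS_carrier by (simp add: m_assoc)
    also have "\<dots> = s'" using g s' PS_carrier by (simp add: m_assoc[symmetric])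
    finally show "g \<otimes> s \<otimes> inv g \<in> PS" using s' by simp
  qed
qed

lemma ord_pow_dvd:
  assumes "x \<in> carrier G" "ord x dvd m1 * m2"
  shows "ord (x [^] k) dvd m1"
proof -
  have "ord x dvd k * m1" using assms(2) k(1) by (metis dvd_trans mult.commute mult_dvd_mono dvd_refl)
  then have "(x [^] k) [^] m1 = \<one>" using assms(1) by (simp add: nat_pow_pow pow_eq_id)
  then show ?thesis using assms by (simp add: pow_eq_id)
qed

lemma finite_PA: "finite PA" and finite_PB: "finite PB" and finite_PC: "finite PC"
proof -
  have "finite (generate G {x [^] k})" if "x \<in> carrier G" "ord x > 0" for x
  proof -
    have "(x [^] k) [^] ord x = \<one>" using that by (metis nat_pow_pow mult.commute nat_pow_one pow_ord_eq_1)
    then have "ord (x [^] k) dvd ord x" using that by (simp add: pow_eq_id)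
    then have "ord (x [^] k) \<noteq> 0" using that by auto
    moreover have "x [^] k \<in> carrier G" using that by simp
    ultimately show ?thesis using generate_pow_card[of "x [^] k"] by (metis card.infinite)
  qed
  then show "finite PA" "finite PB" "finite PC" using ord_A ord_B ord_C by auto
qed

lemma finite_PS: "finite PS"
  unfolding PS_def set_mult_def using finite_PA finite_PB finite_PC by auto

text \<open>This makes \<open>PS\<close> a 3-group or a group of order prime to 3, according to the
  choice of \<open>m1\<close>.\<close>

lemma card_PS_dvd: "card PS dvd m1 ^ 3"
proof -
  have "card PX dvd card PC * card PA"
    using card_set_mult[OF subgroup_PC subgroup_PA finite_PC finite_PA] by (metis dvd_triv_left)
  moreover have "card PS dvd card PX * card PB"
  proof -
    have "finite PX" using finite_PS PX_subset_PS finite_subset by blast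
    then show ?thesis
      using card_set_mult[OF subgroup_PX subgroup_PB _ finite_PB] unfolding PS_def by (metis dvd_triv_left)
  qed
  moreover have "card PC dvd m1" "card PA dvd m1" "card PB dvd m1"
    using ord_pow_dvd[of C] ord_pow_dvd[of A] ord_pow_dvd[of B] ord_A ord_B dvd_trans[OF ord_C_dvd ord_A(2)]
    by (simp_all add: generate_pow_card[symmetric])
  ultimately have "card PS dvd m1 * m1 * m1" by (meson dvd_trans mult_dvd_mono)
  then show ?thesis by (simp add: power3_eq_cube)
qed

end

section \<open>Relations in the 3-part\<close>

text \<open>For \<open>x mod 9 = 7\<close> the difference \<open>x - 1\<close> has 3-adic valuation
  exactly 1, and each cubing raises the valuation of the power minus 1 by exactly 1.\<close>

lemma pow3_expand:
  fixes x :: int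
  assumes "x mod 9 = 7"
  shows "\<exists>u. x ^ 3 ^ i = 1 + 3 ^ Suc i * u \<and> \<not> 3 dvd u"
proof (induction i)
  case 0
  have "x = 1 + 3 ^ Suc 0 * (2 + 3 * (x div 9))" using assms by simp presburger
  moreover have "\<not> 3 dvd 2 + 3 * (x div 9)" by presburger
  ultimately show ?case by (metis power_0 power_one_right)
next
  case (Suc i)
  then obtain u where u: "x ^ 3 ^ i = 1 + 3 ^ Suc i * u" "\<not> 3 dvd u" by blast
  define q :: int where "q = 3 ^ i"
  have "x ^ 3 ^ Suc i = (x ^ 3 ^ i) ^ 3" by (simp add: power_mult[symmetric] mult.commute)
  also have "\<dots> = 1 + 3 ^ Suc (Suc i) * (u + 3 * (q * u ^ 2 + q ^ 2 * u ^ 3))"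
    unfolding u(1) by (simp add: q_def[symmetric]) (simp add: algebra_simps power2_eq_square power3_eq_cube)
  finally show ?case using u(2) by (metis dvd_add_times_triv_right_iff mult.commute)
qed

lemma geo_sum_pow3:
  assumes "x mod 9 = 7"
  shows "\<exists>u. geo_sum x (3 ^ i) = 3 ^ i + 3 ^ Suc i * u"
proof (induction i)
  case 0
  have "geo_sum x (3 ^ 0) = 3 ^ 0 + 3 ^ Suc 0 * (2 + 3 * (x div 9))"
    using assms by (simp add: geo_sum_def) presburger
  then show ?case by blast
next
  case (Suc i)
  then obtain u where u: "geo_sum x (3 ^ i) = 3 ^ i + 3 ^ Suc i * u" by blast
  obtain v where "x ^ 3 ^ i = 1 + 3 ^ Suc i * v" using pow3_expand[OF assms] by blast
  then obtain w where w: "x ^ 3 ^ i = 1 + 3 * w" by (auto simp: mult.assoc)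
  have "geo_sum x (3 ^ Suc i) = geo_sum x (3 ^ i) * (\<Sum>j<3. (x ^ 3 ^ i) ^ j)"
    unfolding geo_sum_eq_sum by (simp add: power_sum_mult mult.assoc)
  also have "(\<Sum>j<3. (x ^ 3 ^ i) ^ j) = 3 + 9 * (w + w ^ 2)"
    unfolding w by (simp add: eval_nat_numeral algebra_simps)
  also have "geo_sum x (3 ^ i) * (3 + 9 * (w + w ^ 2))
      = 3 ^ Suc i + 3 ^ Suc (Suc i) * (u + w + w ^ 2 + 3 * u * (w + w ^ 2))"
    unfolding u by (simp add: algebra_simps)
  finally show ?case by blast
qed

lemma geo_sum_27_mult:
  assumes "x mod 9 = 7"
  shows "81 dvd geo_sum x (27 * n) - int (27 * n)"
proof -
  obtain u where u: "geo_sum x 27 = 27 + 81 * u" using geo_sum_pow3[OF assms, of 3] by auto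
  obtain v where v: "x ^ 27 = 1 + 81 * v" using pow3_expand[OF assms, of 3] by auto
  have "[(\<Sum>j<n. (x ^ 27) ^ j) = (\<Sum>j<n. 1 ^ j)] (mod 81)"
    unfolding v by (intro cong_sum cong_pow) (simp add: cong_iff_dvd_diff)
  moreover have "[geo_sum x 27 = 27] (mod 81)" unfolding u by (simp add: cong_iff_dvd_diff)
  ultimately have "[geo_sum x 27 * (\<Sum>j<n. (x ^ 27) ^ j) = 27 * (\<Sum>j<n. 1 ^ j)] (mod 81)"
    by (rule cong_mult[rotated])
  moreover have "geo_sum x (27 * n) = geo_sum x 27 * (\<Sum>j<n. (x ^ 27) ^ j)"
    unfolding geo_sum_eq_sum using power_sum_mult[of x n 27] by (simp add: mult.assoc mult.commute[of 27])
  ultimately show ?thesis by (simp add: cong_iff_dvd_diff)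
qed

text \<open>The valuation of \<open>key_exp x 1\<close> is too large when \<open>x mod 27 = 25\<close>.\<close>
definition good_index :: "int \<Rightarrow> nat" where
  "good_index x = (if x mod 27 = 25 then 2 else 1)"

text \<open>Reducing at each step keeps the numbers small in the evaluation below. The modulus 243
  is one power of 3 beyond the valuation 4 to be detected.\<close>

fun pow_mod :: "int \<Rightarrow> nat \<Rightarrow> int" where
  "pow_mod x 0 = 1"
| "pow_mod x (Suc n) = x * pow_mod x n mod 243"

lemma pow_mod_cong: "[pow_mod x n = x ^ n] (mod 243)"
proof (induction n)
  case (Suc n)
  then show ?case using cong_mult[OF cong_refl[of x] Suc] by (simp add: cong_def)
qed simp

text \<open>All residues \<open>r\<close> modulo 243 with \<open>r mod 9 = 7\<close>, with the index \<open>j\<close> to use and \<open>r ^ j mod 81\<close>.\<close>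
definition residue_triples :: "(int \<times> nat \<times> nat) list" where
  "residue_triples = [
    (7, 1, 7), (16, 1, 16), (25, 2, 58), (34, 1, 34), (43, 1, 43), (52, 2, 31), (61, 1, 61), (70, 1, 70), (79, 2, 4),
    (88, 1, 7), (97, 1, 16), (106, 2, 58), (115, 1, 34), (124, 1, 43), (133, 2, 31), (142, 1, 61), (151, 1, 70), (160, 2, 4),
    (169, 1, 7), (178, 1, 16), (187, 2, 58), (196, 1, 34), (205, 1, 43), (214, 2, 31), (223, 1, 61), (232, 1, 70), (241, 2, 4)]"

text \<open>81 and 162 are the residues modulo 243 of valuation exactly 4. One of the four belongs
  to the factor \<open>x - 1\<close>, so the key exponent is 27 times a unit.\<close>

lemma residue_triples_check:
  "list_all (\<lambda>(r, j, n). j = good_index r \<and> r ^ j mod 81 = int n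
     \<and> (pow_mod r n * (r ^ Suc j - r ^ j - r) + r) mod 243 \<in> {81, 162}) residue_triples"
  by code_simp

lemma residue_triples_complete:
  assumes "r mod 9 = (7::int)" "0 \<le> r" "r < 243"
  shows "\<exists>j n. (r, j, n) \<in> set residue_triples"
proof -
  have "r \<in> fst ` set residue_triples"
    unfolding residue_triples_def using assms by simp presburger
  then show ?thesis by force
qed

lemma key_exp_valuation:
  assumes "x mod 9 = 7" "x > 0"
  shows "\<exists>u. key_exp x (good_index x) = 27 * u \<and> \<not> 3 dvd u"
proof -
  define r where "r = x mod 243"
  have x: "[x = r] (mod 243)" by (simp add: r_def cong_def)
  have r9: "r mod 9 = 7" using cong_dvd_modulus[OF x, of 9] assms(1) by (simp add: cong_def)
  obtain j n where "(r, j, n) \<in> set residue_triples"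
    using residue_triples_complete[OF r9] by (auto simp: r_def)
  then have jn: "j = good_index r" "r ^ j mod 81 = int n"
    "(pow_mod r n * (r ^ Suc j - r ^ j - r) + r) mod 243 \<in> {81, 162}"
    using residue_triples_check by (auto simp: list_all_iff)
  have j: "j = good_index x"
    using cong_dvd_modulus[OF x, of 27] unfolding jn(1) good_index_def by (simp add: cong_def)
  define M where "M = nat (x ^ j)"
  have "[int M = r ^ j] (mod 243)" using assms(2) cong_pow[OF x, of j] by (simp add: M_def)
  then have "[int M = r ^ j] (mod 81)" by (rule cong_dvd_modulus) simp
  then have "int (M mod 81) = int n" using jn(2) by (simp add: cong_def zmod_int)
  then have Mn: "M mod 81 = n" by simp
  \<comment> \<open>Hence the exponent \<open>x ^ j\<close> matters only modulo 81, and the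
    tabulated value of \<open>r ^ j mod 81\<close> can replace it.\<close>
  have r81: "[r ^ 81 = 1] (mod 243)"
    using pow3_expand[OF r9, of 4] by (auto simp: cong_iff_dvd_diff)
  have "r ^ M = (r ^ 81) ^ (M div 81) * r ^ n"
    unfolding Mn[symmetric] by (simp add: power_mult[symmetric] power_add[symmetric])
  then have "[r ^ M = 1 ^ (M div 81) * r ^ n] (mod 243)"
    using cong_mult[OF cong_pow[OF r81] cong_refl] by metis
  then have "[r ^ M = pow_mod r n] (mod 243)" using cong_trans[OF _ cong_sym[OF pow_mod_cong]] by simp
  then have "[x ^ M = pow_mod r n] (mod 243)" using cong_trans[OF cong_pow[OF x]] by blast
  then have "[(x - 1) * key_exp x j = pow_mod r n * (r ^ Suc j - r ^ j - r) + r] (mod 243)"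
    unfolding key_exp_eq[OF zero_le_power[OF less_imp_le[OF assms(2)]]] M_def[symmetric]
    by (intro cong_add cong_mult cong_diff cong_pow x)
  then have v: "((x - 1) * key_exp x j) mod 243 \<in> {81, 162}" using jn(3) by (simp add: cong_def)
  define w where "w = 2 + 3 * (x div 9)"
  have w: "x - 1 = 3 * w" "\<not> 3 dvd w" unfolding w_def using assms(1) by presburger+
  define P where "P = w * key_exp x j"
  have "(3 * P) mod 243 \<in> {81, 162}" using v unfolding w(1) P_def by (simp add: mult.assoc)
  moreover have "(3 * P) mod 243 = 3 * (P mod 81)" using mod_mult_mult1[of 3 P 81] by simp
  ultimately have "P mod 81 = 27 \<or> P mod 81 = 54" by auto
  then obtain c where c: "P mod 81 = 27 * c" "c = 1 \<or> c = 2" by force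
  obtain d where "d = P div 81" by blast
  then have "P = 81 * d + P mod 81" by simp
  then have P: "P = 27 * (3 * d + c)" unfolding c(1) by presburger
  have Q: "\<not> 3 dvd 3 * d + c" using c(2) by presburger
  have "coprime (27::int) w"
    using w(2) prime_imp_coprime[of "3::int" w] coprime_power_left_iff[of "3::int" 3 w] by simp
  moreover have "27 dvd w * key_exp x j" using P unfolding P_def[symmetric] by (metis dvd_triv_left)
  ultimately have "27 dvd key_exp x j" using coprime_dvd_mult_right_iff by blast
  then obtain u where u: "key_exp x j = 27 * u" by blast
  have "27 * (w * u) = 27 * (3 * d + c)" unfolding P[symmetric] P_def u by simp
  then have "w * u = 3 * d + c" by simp
  then have "\<not> 3 dvd u" using Q by (metis dvd_mult)
  then show ?thesis using u unfolding j by blast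
qed


section \<open>Exponents of the generators of the 3-part\<close>

lemma (in group) unit_pow_inverse:
  assumes "x \<in> carrier G" "x [^] ((3::nat) ^ s) = \<one>" "\<not> 3 dvd (w::int)"
  shows "\<exists>w'. x [^] (w * w') = x"
proof -
  have "coprime w (3 ^ s)"
    using assms(3) prime_imp_coprime[of "3::int" w] by (simp add: coprime_commute)
  then obtain w' where "[w * w' = 1] (mod 3 ^ s)" using cong_solve_coprime_int by blast
  then have "3 ^ s dvd 1 - w * w'" by (metis cong_iff_dvd_diff cong_sym)
  moreover have "int (ord x) dvd 3 ^ s"
    using assms(1,2) by (metis of_nat_dvd_iff of_nat_numeral of_nat_power pow_eq_id)
  ultimately have "int (ord x) dvd 1 - w * w'" by (meson dvd_trans)
  then have "x [^] (w * w') = x [^] (1::int)" using int_pow_eq[OF assms(1)] by blast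
  then show ?thesis using assms(1) by auto
qed

locale macdonald_3 = macdonald +
  fixes s :: nat
  assumes A_3pow: "A [^] ((3::nat) ^ s) = \<one>"
    and B_3pow: "B [^] ((3::nat) ^ s) = \<one>"
    and gen: "carrier G = generate G {A, B}"
    and \<alpha>: "\<alpha> mod 9 = 7" "\<alpha> > 0" and \<beta>: "\<beta> mod 9 = 7" "\<beta> > 0"
    and \<alpha>\<beta>: "\<alpha> mod 27 = \<beta> mod 27"
begin

lemma swap_3: "macdonald_3 G B A (inv C) \<beta> \<alpha> s"
  by (intro macdonald_3.intro swap macdonald_3_axioms.intro)
     (use A_3pow B_3pow gen \<alpha> \<beta> \<alpha>\<beta> in \<open>auto simp: insert_commute\<close>)

lemma unit_pow_A:
  assumes "\<not> 3 dvd (w::int)" "A [^] (i * w) = \<one>" shows "A [^] i = \<one>"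
proof -
  obtain w' where "A [^] (w * w') = A" using unit_pow_inverse[OF A_closed A_3pow assms(1)] by blast
  then have "A [^] i = (A [^] (w * w')) [^] i" by simp
  also have "\<dots> = (A [^] (i * w)) [^] w'" by (simp add: int_pow_pow ac_simps)
  finally show ?thesis using assms(2) by simp
qed

lemma \<alpha>_unit: obtains u where "\<alpha> - 1 = 3 * u" "\<not> 3 dvd u"
  using pow3_expand[OF \<alpha>(1), of 0] by auto

text \<open>\<open>key_exp \<alpha> j * (\<alpha> - 1)\<close> is 81 times a unit, 27 from the key
  exponent and 3 from \<open>\<alpha> - 1\<close>; since \<open>A\<close> has 3-power order, the
  unit can be divided out.\<close>

lemma A_pow_81_central: "A [^] (81::int) \<otimes> B = B \<otimes> A [^] (81::int)"
  and A_pow_243: "A [^] (243::int) = \<one>"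
proof -
  obtain v where v: "key_exp \<alpha> (good_index \<alpha>) = 27 * v" "\<not> 3 dvd v"
    using key_exp_valuation[OF \<alpha>] by blast
  obtain u where u: "\<alpha> - 1 = 3 * u" "\<not> 3 dvd u" by (rule \<alpha>_unit)
  have uv: "\<not> 3 dvd v * u" using u v prime_dvd_mult_iff[of "3::int" v u] by simp
  have "A [^] (81 * (v * u)) \<otimes> B = B \<otimes> A [^] (81 * (v * u))"
    using A_pow_central[of "good_index \<alpha>"] \<alpha>(2) \<beta>(2) unfolding v(1) u(1) by (simp add: ac_simps)
  note comm = this
  obtain w' where w': "A [^] (v * u * w') = A" using unit_pow_inverse[OF A_closed A_3pow uv] by blast
  have "A [^] (81::int) = (A [^] (v * u * w')) [^] (81::int)" using w' by simp
  also have "\<dots> = (A [^] (81 * (v * u))) [^] w'" unfolding int_pow_pow[OF A_closed] by (simp add: ac_simps)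
  finally show "A [^] (81::int) \<otimes> B = B \<otimes> A [^] (81::int)"
    using int_pow_commute[OF comm] by simp
  then have "A [^] (81 * (\<alpha> - 1)) = \<one>" by (rule central_pow_trivial)
  moreover have "81 * (\<alpha> - 1) = 243 * u" unfolding u(1) by simp
  ultimately show "A [^] (243::int) = \<one>" using unit_pow_A[OF u(2)] by metis
qed

lemma B_pow_81_central: "B [^] (81::int) \<otimes> A = A \<otimes> B [^] (81::int)"
  by (rule macdonald_3.A_pow_81_central[OF swap_3])

lemma A_pow_243_cong: "243 dvd j - i \<Longrightarrow> A [^] (i::int) = A [^] j"
  using A_pow_243 by (simp add: int_pow_eq int_pow_eq_id) (meson dvd_trans)

text \<open>\<open>A ^ 81\<close> commutes with \<open>B\<close>, whereas the conjugation formula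
  produces \<open>C ^ 81\<close> when it crosses \<open>B\<close>; the accompanying geometric sum is
  81 modulo 243.\<close>

lemma C_pow_81: "C [^] (81::nat) = \<one>"
proof -
  obtain u where u: "geo_sum \<alpha> 81 = 81 + 243 * u" using geo_sum_pow3[OF \<alpha>(1), of 4] by auto
  have "B \<otimes> A [^] (81::int) = A [^] (81::nat) \<otimes> B"
    using A_pow_81_central by (simp flip: int_pow_int)
  also have "\<dots> = B \<otimes> (C [^] (81::nat) \<otimes> A [^] geo_sum \<alpha> 81)" by (rule A_pow_B)
  also have "A [^] geo_sum \<alpha> 81 = A [^] (81::int)" unfolding u by (rule A_pow_243_cong) simp
  finally have "A [^] (81::int) = C [^] (81::nat) \<otimes> A [^] (81::int)" by (subst (asm) l_cancel) auto
  then show ?thesis by simp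
qed

text \<open>As \<alpha> and \<beta> agree modulo 27, the same index serves both, and the two powers
  of \<open>C\<close> in the key relation have exponents congruent modulo 27.\<close>

lemma B_pow_eq:
  obtains t n :: nat and y :: int
  where "B [^] (27 * y) = C [^] (27 * t) \<otimes> A [^] (27 * n)" "\<not> 3 dvd n" "\<not> 3 dvd y"
proof -
  define j where "j = good_index \<alpha>"
  have j: "good_index \<beta> = j" using \<alpha>\<beta> by (simp add: j_def good_index_def)
  obtain x where x: "key_exp \<alpha> j = 27 * x" "\<not> 3 dvd x" unfolding j_def using key_exp_valuation[OF \<alpha>] by blast
  obtain y where y: "key_exp \<beta> j = 27 * y" "\<not> 3 dvd y" unfolding j[symmetric] using key_exp_valuation[OF \<beta>] by blast
  define p q where "p = nat (\<beta> ^ j) + j" and "q = nat (\<alpha> ^ j) + j"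
  have R: "B [^] (27 * y) \<otimes> C [^] p = C [^] q \<otimes> A [^] (- (27 * x))"
    using key_relation[of j] \<alpha>(2) \<beta>(2) unfolding x y p_def q_def by simp
  have "[\<alpha> ^ j = \<beta> ^ j] (mod 27)" using \<alpha>\<beta> by (intro cong_pow) (simp add: cong_def)
  then have "[int q = int p] (mod 27)" using \<alpha>(2) \<beta>(2) by (simp add: p_def q_def cong_add_rcancel)
  \<comment> \<open>\<open>C ^ (80 p)\<close> is the inverse of \<open>C ^ p\<close> because
    \<open>C ^ 81\<close> is trivial; written this way the exponent stays natural.\<close>
  then have "[int q + int (80 * p) = int p + int (80 * p)] (mod 27)" by (rule cong_add) simp
  moreover have "[int p + int (80 * p) = 0] (mod 27)" by (simp add: cong_iff_dvd_diff)
  ultimately have "27 dvd int (q + 80 * p)" by (metis cong_0_iff cong_trans of_nat_add)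
  then have "27 dvd q + 80 * p" by presburger
  then obtain t where t: "q + 80 * p = 27 * t" by blast
  have Cp: "C [^] (p + 80 * p) = \<one>"
    using C_pow_81 by (simp add: pow_eq_id)
  have "B [^] (27 * y) = B [^] (27 * y) \<otimes> C [^] p \<otimes> C [^] (80 * p)"
    using Cp by (simp add: m_assoc nat_pow_mult)
  also have "\<dots> = C [^] q \<otimes> (A [^] (- (27 * x)) \<otimes> C [^] (80 * p))" unfolding R by (simp add: m_assoc)
  also have "\<dots> = C [^] (27 * t) \<otimes> A [^] (- (27 * x) * \<alpha> ^ (80 * p))"
    unfolding A_C_pow t[symmetric] by (simp add: m_assoc[symmetric] nat_pow_mult)
  finally have B1: "B [^] (27 * y) = C [^] (27 * t) \<otimes> A [^] (- (27 * x) * \<alpha> ^ (80 * p))" .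
  define x' where "x' = - x * \<alpha> ^ (80 * p)"
  have "\<not> 3 dvd \<alpha>" using \<alpha>(1) by presburger
  then have "\<not> 3 dvd \<alpha> ^ (80 * p)" using prime_dvd_power[of "3::int" \<alpha> "80 * p"] by auto
  then have x': "\<not> 3 dvd x'"
    using x(2) prime_dvd_mult_iff[of "3::int" "- x" "\<alpha> ^ (80 * p)"] by (auto simp: x'_def)
  \<comment> \<open>Since \<open>A ^ 243\<close> is trivial, the exponent of \<open>A ^ 27\<close>
    matters modulo 9 only; the residue is a natural number, as \<open>A_pow_B\<close>
    expects.\<close>
  define n where "n = nat (x' mod 9)"
  have n: "int n = x' mod 9" by (simp add: n_def)
  have "\<not> 3 dvd n" using x' n by presburger
  moreover have "A [^] (- (27 * x) * \<alpha> ^ (80 * p)) = A [^] (27 * n)"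
  proof -
    have "243 dvd 27 * int n - 27 * x'" unfolding n by presburger
    then have "A [^] (27 * x') = A [^] (27 * int n)" by (rule A_pow_243_cong)
    then show ?thesis by (simp add: x'_def mult.assoc flip: int_pow_int)
  qed
  ultimately show thesis using that B1 y(2) by metis
qed

end

lemma (in group) commutes_with_generate:
  assumes "x \<in> carrier G" "S \<subseteq> carrier G" "\<And>s. s \<in> S \<Longrightarrow> x \<otimes> s = s \<otimes> x" "g \<in> generate G S"
  shows "x \<otimes> g = g \<otimes> x"
  using assms(4)
proof (induction rule: generate.induct)
  case (inv h)
  have h: "h \<in> carrier G" "x \<otimes> h = h \<otimes> x" using inv assms(2,3) by auto
  have "x \<otimes> inv h = inv h \<otimes> (h \<otimes> x) \<otimes> inv h" using h(1) assms(1) by (simp add: m_assoc[symmetric])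
  also have "\<dots> = inv h \<otimes> x" unfolding h(2)[symmetric] using h(1) assms(1) by (simp add: m_assoc)
  finally show ?case .
next
  case (eng h1 h2)
  have h: "h1 \<in> carrier G" "h2 \<in> carrier G"
    using eng(1,2) generate_in_carrier[OF assms(2)] by auto
  have "x \<otimes> (h1 \<otimes> h2) = h1 \<otimes> x \<otimes> h2" using h assms(1) eng.IH(1) by (simp add: m_assoc[symmetric])
  also have "\<dots> = h1 \<otimes> h2 \<otimes> x" using h assms(1) eng.IH(2) by (simp add: m_assoc)
  finally show ?case .
qed (use assms in auto)

context macdonald_3
begin

lemma central_if_commutes:
  assumes "x \<in> carrier G" "x \<otimes> A = A \<otimes> x" "x \<otimes> B = B \<otimes> x" "g \<in> carrier G"
  shows "x \<otimes> g = g \<otimes> x"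
  by (rule commutes_with_generate[of x "{A, B}"]) (use assms gen in auto)

lemma C_pow_unit:
  assumes "\<not> 3 dvd (n::nat)"
  shows "\<exists>w::int. C [^] (27::nat) = (C [^] (27 * n)) [^] w"
proof -
  have "(C [^] (27::nat)) [^] ((3::nat) ^ 1) = \<one>" using C_pow_81 by (simp add: nat_pow_pow)
  moreover have "\<not> 3 dvd int n" using assms by presburger
  ultimately obtain w where "(C [^] (27::nat)) [^] (int n * w) = C [^] (27::nat)"
    using unit_pow_inverse[of "C [^] (27::nat)"] by blast
  moreover have "(C [^] (27::nat)) [^] (int n * w) = (C [^] (27 * n)) [^] w"
    by (simp add: int_pow_pow[symmetric] int_pow_int nat_pow_pow)
  ultimately show ?thesis by metis
qed

text \<open>The left side of \<open>B_pow_eq\<close> commutes with \<open>B\<close>. When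
  \<open>B\<close> is moved through the right side, \<open>C ^ (27 t)\<close> contributes a power of
  \<open>B ^ 81\<close>, and \<open>A ^ (27 n)\<close> contributes \<open>C ^ (27 n)\<close> and a
  power of \<open>A ^ 81\<close>. These contributions must cancel.\<close>

lemma C_pow_27_aux:
  obtains n :: nat and w g :: int
  where "\<not> 3 dvd n" "C [^] (27 * n) = (B [^] (81::int)) [^] w \<otimes> (A [^] (81::int)) [^] g"
proof -
  obtain t n :: nat and y :: int
    where y: "B [^] (27 * y) = C [^] (27 * t) \<otimes> A [^] (27 * n)" "\<not> 3 dvd n" "\<not> 3 dvd y"
    by (rule B_pow_eq)
  let ?D = "C [^] (27 * t)"
  obtain v where "\<beta> ^ 27 = 1 + 81 * v" using pow3_expand[OF \<beta>(1), of 3] by auto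
  then have "[\<beta> ^ 27 = 1] (mod 81)" by (simp add: cong_iff_dvd_diff)
  then have "[(\<beta> ^ 27) ^ t = 1 ^ t] (mod 81)" by (rule cong_pow)
  then have "81 dvd (\<beta> ^ 27) ^ t - 1" by (simp add: cong_iff_dvd_diff)
  then obtain w where "(\<beta> ^ 27) ^ t - 1 = 81 * w" by (rule dvdE)
  then have w: "\<beta> ^ (27 * t) = 1 + 81 * w" unfolding power_mult by linarith
  obtain g where "geo_sum \<alpha> (27 * n) - int (27 * n) = 81 * g"
    using geo_sum_27_mult[OF \<alpha>(1), of n] by (rule dvdE)
  then have g: "geo_sum \<alpha> (27 * n) = int (27 * n) + 81 * g" by linarith
  let ?Z = "(B [^] (81::int)) [^] w"
  have ZA: "?Z \<otimes> A = A \<otimes> ?Z" by (rule int_pow_commute) (auto simp: B_pow_81_central)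
  have ZB: "?Z \<otimes> B = B \<otimes> ?Z" by (simp add: int_pow_pow int_pow_commute)
  have ZD: "?Z \<otimes> ?D = ?D \<otimes> ?Z" by (rule central_if_commutes) (auto simp: ZA ZB)
  have "B \<otimes> (?D \<otimes> A [^] (27 * n)) = (?D \<otimes> A [^] (27 * n)) \<otimes> B"
    unfolding y(1)[symmetric] by (rule int_pow_commute[symmetric]) auto
  also have "\<dots> = (?D \<otimes> B [^] (1::int)) \<otimes> (C [^] (27 * n) \<otimes> A [^] geo_sum \<alpha> (27 * n))"
    by (simp add: m_assoc A_pow_B)
  also have "\<dots> = (B \<otimes> ?Z \<otimes> ?D) \<otimes> (C [^] (27 * n) \<otimes> A [^] geo_sum \<alpha> (27 * n))"
    unfolding C_B_pow w by (simp add: int_pow_mult int_pow_pow)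
  also have "\<dots> = B \<otimes> (?D \<otimes> (?Z \<otimes> (C [^] (27 * n) \<otimes> A [^] geo_sum \<alpha> (27 * n))))"
    using ZD by (simp add: m_assoc)
  finally have "A [^] (27 * n) = ?Z \<otimes> (C [^] (27 * n) \<otimes> A [^] geo_sum \<alpha> (27 * n))"
    by (simp add: l_cancel)
  also have "A [^] geo_sum \<alpha> (27 * n) = (A [^] (81::int)) [^] g \<otimes> A [^] (27 * n)"
    unfolding g by (simp add: int_pow_pow int_pow_mult[symmetric] add.commute flip: int_pow_int)
  finally have "\<one> \<otimes> A [^] (27 * n) = ?Z \<otimes> (C [^] (27 * n) \<otimes> (A [^] (81::int)) [^] g) \<otimes> A [^] (27 * n)"
    by (simp add: m_assoc)
  then have "\<one> = ?Z \<otimes> (C [^] (27 * n) \<otimes> (A [^] (81::int)) [^] g)" by (subst (asm) r_cancel) auto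
  then have "inv (C [^] (27 * n) \<otimes> (A [^] (81::int)) [^] g) = ?Z" by (intro inv_equality) auto
  then have "inv ?Z = C [^] (27 * n) \<otimes> (A [^] (81::int)) [^] g"
    by (metis inv_inv m_closed int_pow_closed nat_pow_closed A_closed C_closed)
  then have "inv ?Z \<otimes> inv ((A [^] (81::int)) [^] g) = C [^] (27 * n)"
    by (simp add: m_assoc)
  then have "C [^] (27 * n) = (B [^] (81::int)) [^] (- w) \<otimes> (A [^] (81::int)) [^] (- g)"
    by (simp add: int_pow_neg)
  then show thesis using that y(2) by blast
qed

lemma C_pow_27_central:
  "C [^] (27::nat) \<otimes> A = A \<otimes> C [^] (27::nat)" "C [^] (27::nat) \<otimes> B = B \<otimes> C [^] (27::nat)"
proof -
  obtain n :: nat and w g :: int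
    where n: "\<not> 3 dvd n" "C [^] (27 * n) = (B [^] (81::int)) [^] w \<otimes> (A [^] (81::int)) [^] g"
    by (rule C_pow_27_aux)
  obtain v :: int where v: "C [^] (27::nat) = (C [^] (27 * n)) [^] v" using C_pow_unit[OF n(1)] by blast
  let ?Z = "(B [^] (81::int)) [^] w" and ?Y = "(A [^] (81::int)) [^] g"
  have ZA: "?Z \<otimes> A = A \<otimes> ?Z" by (rule int_pow_commute) (auto simp: B_pow_81_central)
  have ZB: "?Z \<otimes> B = B \<otimes> ?Z" by (simp add: int_pow_pow int_pow_commute)
  have YB: "?Y \<otimes> B = B \<otimes> ?Y" by (rule int_pow_commute) (auto simp: A_pow_81_central)
  have YA: "?Y \<otimes> A = A \<otimes> ?Y" by (simp add: int_pow_pow int_pow_commute)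
  have "?Z \<otimes> ?Y \<otimes> x = x \<otimes> (?Z \<otimes> ?Y)"
    if "x \<in> carrier G" "?Z \<otimes> x = x \<otimes> ?Z" "?Y \<otimes> x = x \<otimes> ?Y" for x
  proof -
    have "?Z \<otimes> ?Y \<otimes> x = ?Z \<otimes> x \<otimes> ?Y" using that(1,3) by (simp add: m_assoc)
    also have "\<dots> = x \<otimes> (?Z \<otimes> ?Y)" unfolding that(2) using that(1) by (simp add: m_assoc)
    finally show ?thesis .
  qed
  then have "C [^] (27 * n) \<otimes> A = A \<otimes> C [^] (27 * n)" "C [^] (27 * n) \<otimes> B = B \<otimes> C [^] (27 * n)"
    unfolding n(2) using ZA ZB YA YB by auto
  then show "C [^] (27::nat) \<otimes> A = A \<otimes> C [^] (27::nat)" "C [^] (27::nat) \<otimes> B = B \<otimes> C [^] (27::nat)"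
    unfolding v by (auto intro!: int_pow_commute)
qed

text \<open>As \<open>C ^ 27\<close> is central, \<open>A\<close> equals its conjugate
  \<open>A ^ (\<alpha> ^ 27)\<close>, and \<open>\<alpha> ^ 27 - 1\<close> is 81 times a unit. Fed
  back into \<open>C_pow_27_aux\<close>, this makes \<open>C ^ 27\<close> trivial.\<close>

lemma A_pow_81: "A [^] (81::int) = \<one>"
proof -
  obtain u where u: "\<alpha> ^ 27 = 1 + 81 * u" "\<not> 3 dvd u" using pow3_expand[OF \<alpha>(1), of 3] by auto
  have "C [^] (27::nat) \<otimes> A [^] (1::int) = A [^] (1::int) \<otimes> C [^] (27::nat)" using C_pow_27_central by simp
  then have "A [^] (1::int) = A [^] (\<alpha> ^ 27)" unfolding A_C_pow by (subst (asm) l_cancel) auto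
  then have "A [^] (1::int) \<otimes> \<one> = A [^] (1::int) \<otimes> A [^] (81 * u)" unfolding u by (simp add: int_pow_mult)
  then have "A [^] (81 * u) = \<one>" by (subst (asm) l_cancel) auto
  then show ?thesis by (rule unit_pow_A[OF u(2)])
qed

lemma B_pow_81: "B [^] (81::int) = \<one>"
  by (rule macdonald_3.A_pow_81[OF swap_3])

lemma C_pow_27: "C [^] (27::nat) = \<one>"
proof -
  obtain n :: nat and w g :: int
    where n: "\<not> 3 dvd n" "C [^] (27 * n) = (B [^] (81::int)) [^] w \<otimes> (A [^] (81::int)) [^] g"
    by (rule C_pow_27_aux)
  then have "C [^] (27 * n) = \<one>" by (simp add: A_pow_81 B_pow_81)
  then show ?thesis using C_pow_unit[OF n(1)] by auto
qed

lemma B_pow_27: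
  obtains n y :: int where "B [^] (27::int) = A [^] (27 * n)" "A [^] (27::int) = B [^] (27 * y)"
proof -
  obtain t n :: nat and y :: int
    where y: "B [^] (27 * y) = C [^] (27 * t) \<otimes> A [^] (27 * n)" "\<not> 3 dvd n" "\<not> 3 dvd y"
    by (rule B_pow_eq)
  have "C [^] (27 * t) = \<one>" using C_pow_27 by (simp add: pow_eq_id)
  then have eq: "B [^] (27 * y) = A [^] (27 * int n)" using y(1) by (simp flip: int_pow_int)
  obtain y' where y': "B [^] (y * y') = B" using unit_pow_inverse[OF B_closed B_3pow y(3)] by blast
  have "\<not> 3 dvd int n" using y(2) by presburger
  then obtain n' where n': "A [^] (int n * n') = A" using unit_pow_inverse[OF A_closed A_3pow] by blast
  have "B [^] (27::int) = (B [^] (y * y')) [^] (27::int)" using y' by simp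
  also have "\<dots> = (B [^] (27 * y)) [^] y'" unfolding int_pow_pow[OF B_closed] by (simp add: ac_simps)
  also have "\<dots> = A [^] (27 * (int n * y'))" unfolding eq by (simp add: int_pow_pow ac_simps)
  finally have 1: "B [^] (27::int) = A [^] (27 * (int n * y'))" .
  have "A [^] (27::int) = (A [^] (int n * n')) [^] (27::int)" using n' by simp
  also have "\<dots> = (A [^] (27 * int n)) [^] n'" unfolding int_pow_pow[OF A_closed] by (simp add: ac_simps)
  also have "\<dots> = B [^] (27 * (y * n'))" unfolding eq[symmetric] by (simp add: int_pow_pow ac_simps)
  finally show thesis using that 1 by blast
qed

end

section \<open>Lower central series and order of the 3-part\<close>

context group
begin

lemma group_comm_closed [simp]:
  "x \<in> carrier G \<Longrightarrow> y \<in> carrier G \<Longrightarrow> group_comm G x y \<in> carrier G"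
  by (simp add: group_comm_def)

lemma mult_inv_mult: "x \<in> carrier G \<Longrightarrow> y \<in> carrier G \<Longrightarrow> x \<otimes> (inv x \<otimes> y) = y"
  by (simp add: m_assoc[symmetric])

lemma group_comm_eqI:
  assumes "x \<otimes> y = y \<otimes> x \<otimes> z" "x \<in> carrier G" "y \<in> carrier G" "z \<in> carrier G"
  shows "group_comm G x y = z"
proof -
  have "group_comm G x y = inv (y \<otimes> x) \<otimes> (x \<otimes> y)"
    using assms(2,3) by (simp add: group_comm_def inv_mult_group m_assoc)
  also have "\<dots> = z" unfolding assms(1) using assms(2-4) by (simp add: inv_solve_left')
  finally show ?thesis .
qed

lemma group_comm_eqD:
  assumes "x \<in> carrier G" "y \<in> carrier G"
  shows "x \<otimes> y = y \<otimes> x \<otimes> group_comm G x y"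
proof -
  have "y \<otimes> x \<otimes> group_comm G x y = (y \<otimes> x) \<otimes> (inv (y \<otimes> x) \<otimes> (x \<otimes> y))"
    using assms by (simp add: group_comm_def inv_mult_group m_assoc)
  also have "\<dots> = x \<otimes> y" using assms by (intro mult_inv_mult) auto
  finally show ?thesis by simp
qed

lemma group_comm_mem_iff:
  assumes "N \<lhd> G" "x \<in> carrier G" "y \<in> carrier G"
  shows "group_comm G x y \<in> N \<longleftrightarrow> (N #> x) \<otimes>\<^bsub>G Mod N\<^esub> (N #> y) = (N #> y) \<otimes>\<^bsub>G Mod N\<^esub> (N #> x)"
proof -
  interpret N: normal N G by fact
  have "(N #> x) \<otimes>\<^bsub>G Mod N\<^esub> (N #> y) = N #> (x \<otimes> y)" "(N #> y) \<otimes>\<^bsub>G Mod N\<^esub> (N #> x) = N #> (y \<otimes> x)"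
    using assms by (auto simp: FactGroup_def N.rcos_sum)
  moreover have "N #> (x \<otimes> y) = N #> (y \<otimes> x) \<longleftrightarrow> group_comm G x y \<in> N"
  proof -
    have "N #> (x \<otimes> y) = N #> (y \<otimes> x) \<longleftrightarrow> (y \<otimes> x) <# N = (x \<otimes> y) <# N"
      using N.coset_eq assms by auto
    also have "\<dots> \<longleftrightarrow> x \<otimes> y \<in> (y \<otimes> x) <# N"
      using assms by (metis N.is_subgroup l_repr_independence lcos_self m_closed)
    also have "\<dots> \<longleftrightarrow> group_comm G x y \<in> N"
    proof
      assume "x \<otimes> y \<in> (y \<otimes> x) <# N"
      then obtain z where "z \<in> N" "x \<otimes> y = y \<otimes> x \<otimes> z" by (auto simp: l_coset_def)
      then show "group_comm G x y \<in> N" using group_comm_eqI assms by simp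
    next
      assume "group_comm G x y \<in> N"
      then show "x \<otimes> y \<in> (y \<otimes> x) <# N" using group_comm_eqD[OF assms(2,3)] by (auto simp: l_coset_def)
    qed
    finally show ?thesis .
  qed
  ultimately show ?thesis by simp
qed

text \<open>The claim is that the images in the quotient by \<open>N\<close> commute. Centralizers
  are subgroups, so it extends from generators one argument at a time.\<close>

lemma group_comm_generate_mem:
  assumes "N \<lhd> G" "S \<subseteq> carrier G" "T \<subseteq> carrier G"
    and "\<And>x y. x \<in> T \<Longrightarrow> y \<in> S \<Longrightarrow> group_comm G x y \<in> N"
    and "x \<in> generate G T" "y \<in> generate G S"
  shows "group_comm G x y \<in> N"
proof -
  interpret N: normal N G by fact
  interpret Q: group "G Mod N" by (rule N.factorgroup_is_group)
  interpret h: group_hom G "G Mod N" "\<lambda>x. N #> x"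
    by (simp add: group_hom_def group_hom_axioms_def N.r_coset_hom_Mod N.factorgroup_is_group)
  have gT: "generate G T \<subseteq> carrier G" and gS: "generate G S \<subseteq> carrier G"
    using generate_incl assms(2,3) by auto
  have ST: "(\<lambda>x. N #> x) ` S \<subseteq> carrier (G Mod N)" "(\<lambda>x. N #> x) ` T \<subseteq> carrier (G Mod N)"
    using assms(2,3) h.hom_closed by blast+
  have 1: "group_comm G t y \<in> N" if t: "t \<in> T" for t
  proof -
    have tc: "t \<in> carrier G" and yc: "y \<in> carrier G" using t assms(3,6) gS by auto
    have "(N #> t) \<otimes>\<^bsub>G Mod N\<^esub> (N #> y) = (N #> y) \<otimes>\<^bsub>G Mod N\<^esub> (N #> t)"
    proof (rule Q.commutes_with_generate[OF h.hom_closed[OF tc] ST(1)])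
      show "N #> y \<in> generate (G Mod N) ((\<lambda>x. N #> x) ` S)"
        using h.generate_img[OF assms(2)] assms(6) by blast
      fix q assume "q \<in> (\<lambda>x. N #> x) ` S"
      then obtain z where z: "z \<in> S" "q = N #> z" by blast
      show "(N #> t) \<otimes>\<^bsub>G Mod N\<^esub> q = q \<otimes>\<^bsub>G Mod N\<^esub> (N #> t)"
        unfolding z(2) using group_comm_mem_iff[OF assms(1) tc, of z] assms(2,4) t z(1) by blast
    qed
    then show ?thesis using group_comm_mem_iff[OF assms(1) tc yc] by blast
  qed
  have xc: "x \<in> carrier G" and yc: "y \<in> carrier G" using gT gS assms(5,6) by auto
  have "(N #> y) \<otimes>\<^bsub>G Mod N\<^esub> (N #> x) = (N #> x) \<otimes>\<^bsub>G Mod N\<^esub> (N #> y)"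
  proof (rule Q.commutes_with_generate[OF h.hom_closed[OF yc] ST(2)])
    show "N #> x \<in> generate (G Mod N) ((\<lambda>x. N #> x) ` T)"
      using h.generate_img[OF assms(3)] assms(5) by blast
    fix q assume "q \<in> (\<lambda>x. N #> x) ` T"
    then obtain z where z: "z \<in> T" "q = N #> z" by blast
    show "(N #> y) \<otimes>\<^bsub>G Mod N\<^esub> q = q \<otimes>\<^bsub>G Mod N\<^esub> (N #> y)"
      unfolding z(2) using group_comm_mem_iff[OF assms(1) _ yc, of z] assms(3) 1[OF z(1)] z(1) by auto
  qed
  then show ?thesis using group_comm_mem_iff[OF assms(1) xc yc] by simp
qed

lemma group_comm_normal_mem:
  assumes "N \<lhd> G" "x \<in> N" "y \<in> carrier G"
  shows "group_comm G x y \<in> N"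
proof -
  interpret N: normal N G by fact
  have "group_comm G x y = inv x \<otimes> (inv y \<otimes> x \<otimes> inv (inv y))"
    using assms(2,3) by (simp add: group_comm_def m_assoc)
  moreover have "inv y \<otimes> x \<otimes> inv (inv y) \<in> N" using N.inv_op_closed2[of "inv y" x] assms(2,3) by simp
  ultimately show ?thesis using assms(2) by simp
qed

lemma normal_of_group_comm:
  assumes "subgroup K G" "\<And>x y. x \<in> K \<Longrightarrow> y \<in> carrier G \<Longrightarrow> group_comm G x y \<in> K"
  shows "K \<lhd> G"
proof (rule normal_invI[OF assms(1)])
  fix g x assume g: "g \<in> carrier G" and x: "x \<in> K"
  interpret K: subgroup K G by fact
  have "g \<otimes> x \<otimes> inv g = x \<otimes> group_comm G x (inv g)"
    using g x by (simp add: group_comm_def m_assoc[symmetric])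
  then show "g \<otimes> x \<otimes> inv g \<in> K" using assms(2)[OF x, of "inv g"] x g by simp
qed

lemma lower_central_subset: "lower_central G n \<subseteq> carrier G"
proof (induction n)
  case (Suc n)
  have "{group_comm G x y |x y. x \<in> lower_central G n \<and> y \<in> carrier G} \<subseteq> carrier G"
    using Suc by auto
  then show ?case using generate_incl by simp
qed simp

lemma lower_central_subgroup: "subgroup (lower_central G n) G"
proof (cases n)
  case (Suc m)
  have "{group_comm G x y |x y. x \<in> lower_central G m \<and> y \<in> carrier G} \<subseteq> carrier G"
    using lower_central_subset[of m] by auto
  then show ?thesis using generate_is_subgroup Suc by simp
qed (simp add: subgroup_self)

lemma group_comm_lower_central:
  "x \<in> lower_central G n \<Longrightarrow> y \<in> carrier G \<Longrightarrow> group_comm G x y \<in> lower_central G (Suc n)"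
  by (auto intro: generate.incl)

lemma lower_central_Suc_subset:
  assumes "subgroup N G" "\<And>x y. x \<in> lower_central G n \<Longrightarrow> y \<in> carrier G \<Longrightarrow> group_comm G x y \<in> N"
  shows "lower_central G (Suc n) \<subseteq> N"
proof -
  have "{group_comm G x y |x y. x \<in> lower_central G n \<and> y \<in> carrier G} \<subseteq> N" using assms(2) by auto
  then show ?thesis using generate_subgroup_incl[OF _ assms(1)] by simp
qed

lemma lower_central_trivial_mono:
  assumes "lower_central G n = {\<one>}" shows "lower_central G (n + m) = {\<one>}"
proof (induction m)
  case (Suc m)
  have "lower_central G (Suc (n + m)) \<subseteq> {\<one>}"
    by (rule lower_central_Suc_subset[OF triv_subgroup]) (auto simp: Suc group_comm_def simp del: lower_central.simps)
  then show ?case using subgroup.one_closed[OF lower_central_subgroup, of "Suc (n + m)"]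
    by (auto simp del: lower_central.simps)
qed (use assms in simp)

lemma ord_eq_pow3:
  assumes "x \<in> carrier G" "x [^] ((3::nat) ^ Suc i) = \<one>" "x [^] ((3::nat) ^ i) \<noteq> \<one>"
  shows "ord x = 3 ^ Suc i"
proof -
  have "ord x dvd 3 ^ Suc i" "\<not> ord x dvd 3 ^ i" using assms pow_eq_id by auto
  moreover from this(1) obtain j where j: "j \<le> Suc i" "ord x = 3 ^ j"
    using divides_primepow_nat[of 3 "ord x" "Suc i"] by auto
  ultimately have "\<not> j \<le> i" by (auto simp: le_imp_power_dvd)
  then show ?thesis using j by (simp add: le_Suc_eq)
qed

end

context macdonald
begin

lemma comm_A_pow_B: "group_comm G (A [^] (n::nat)) B = inv (A [^] n) \<otimes> (C [^] n \<otimes> A [^] geo_sum \<alpha> n)"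
proof (rule group_comm_eqI)
  have "A [^] n \<otimes> (inv (A [^] n) \<otimes> (C [^] n \<otimes> A [^] geo_sum \<alpha> n)) = C [^] n \<otimes> A [^] geo_sum \<alpha> n"
    by (intro mult_inv_mult) auto
  then show "A [^] n \<otimes> B = B \<otimes> A [^] n \<otimes> (inv (A [^] n) \<otimes> (C [^] n \<otimes> A [^] geo_sum \<alpha> n))"
    unfolding A_pow_B by (simp add: m_assoc)
qed auto

lemma C_pow_A: "C [^] (n::nat) \<otimes> A = A \<otimes> C [^] n \<otimes> A [^] (1 - \<alpha> ^ n)"
proof -
  have "A \<otimes> C [^] n \<otimes> A [^] (1 - \<alpha> ^ n) = A [^] (1::int) \<otimes> C [^] n \<otimes> A [^] (1 - \<alpha> ^ n)" by simp
  also have "\<dots> = C [^] n \<otimes> A" unfolding A_C_pow by (simp add: m_assoc int_pow_mult[symmetric])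
  finally show ?thesis by simp
qed

lemma comm_C_pow_A: "group_comm G (C [^] (n::nat)) A = A [^] (1 - \<alpha> ^ n)"
  by (rule group_comm_eqI) (auto simp: C_pow_A)

lemma comm_A_pow_B_mem:
  assumes "N \<lhd> G" "C [^] (n::nat) \<in> N" "A [^] (geo_sum \<alpha> n - int n) \<in> N"
  shows "group_comm G (A [^] n) B \<in> N"
proof -
  interpret N: normal N G by fact
  have "group_comm G (A [^] n) B = (inv (A [^] n) \<otimes> C [^] n \<otimes> A [^] n) \<otimes> A [^] (geo_sum \<alpha> n - int n)"
    unfolding comm_A_pow_B by (simp add: m_assoc int_pow_mult[symmetric] flip: int_pow_int)
  moreover have "inv (A [^] n) \<otimes> C [^] n \<otimes> A [^] n \<in> N" using N.inv_op_closed1 assms(2) by simp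
  ultimately show ?thesis using assms(3) by simp
qed

end

section \<open>A descending chain bounding the lower central series\<close>

context macdonald_3
begin

text \<open>The chain \<open>U 0, V 0, U 1, V 1, U 2, V 2, U 3, V 3\<close> descends, ends in the
  trivial group, and taking commutators with the whole group moves one place down. Its seven steps
  give the bound on the class.\<close>

definition U :: "nat \<Rightarrow> 'a set" where
  "U i = generate G {A [^] ((3::nat) ^ i), B [^] ((3::nat) ^ i), C [^] ((3::nat) ^ i)}"

definition V :: "nat \<Rightarrow> 'a set" where
  "V i = generate G {A [^] ((3::nat) ^ Suc i), B [^] ((3::nat) ^ Suc i), C [^] ((3::nat) ^ i)}"

lemma subgroup_U: "subgroup (U i) G" and subgroup_V: "subgroup (V i) G"
  unfolding U_def V_def by (auto intro!: generate_is_subgroup)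

lemma gens_U: "A [^] ((3::nat) ^ i) \<in> U i" "B [^] ((3::nat) ^ i) \<in> U i" "C [^] ((3::nat) ^ i) \<in> U i"
  unfolding U_def by (auto intro: generate.incl)

lemma gens_V: "A [^] ((3::nat) ^ Suc i) \<in> V i" "B [^] ((3::nat) ^ Suc i) \<in> V i" "C [^] ((3::nat) ^ i) \<in> V i"
  unfolding V_def by (auto intro: generate.incl simp del: power_Suc)

lemma multiple_pow_mem:
  assumes "subgroup N G" "x \<in> carrier G" "x [^] ((3::nat) ^ i) \<in> N"
  shows "x [^] (3 ^ i * u :: int) \<in> N"
proof -
  have "(x [^] ((3::nat) ^ i)) [^] u \<in> N" using assms subgroup_int_pow_closed by blast
  moreover have "(x [^] ((3::nat) ^ i)) [^] u = x [^] (3 ^ i * u)"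
    using assms(2) by (simp add: int_pow_pow[symmetric] flip: int_pow_int)
  ultimately show ?thesis by simp
qed

lemma pow_mem_V_step:
  assumes "V i \<lhd> G"
  shows "group_comm G (A [^] ((3::nat) ^ i)) B \<in> V i"
proof (rule comm_A_pow_B_mem[OF assms gens_V(3)])
  obtain u where "geo_sum \<alpha> (3 ^ i) = 3 ^ i + 3 ^ Suc i * u" using geo_sum_pow3[OF \<alpha>(1)] by blast
  then have "geo_sum \<alpha> (3 ^ i) - int (3 ^ i) = 3 ^ Suc i * u" by simp
  then show "A [^] (geo_sum \<alpha> (3 ^ i) - int (3 ^ i)) \<in> V i"
    using multiple_pow_mem[OF subgroup_V A_closed gens_V(1)] by presburger
qed

lemma V_swap: "macdonald_3.V G B A (inv C) i = V i"
proof -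
  interpret s: macdonald_3 G B A "inv C" \<beta> \<alpha> s by (rule swap_3)
  have C: "C [^] ((3::nat) ^ i) = inv (inv C [^] ((3::nat) ^ i))" by (simp add: nat_pow_inv)
  show ?thesis
  proof
    show "s.V i \<subseteq> V i" unfolding s.V_def
      by (rule generate_subgroup_incl[OF _ subgroup_V])
         (use gens_V[of i] subgroup.m_inv_closed[OF subgroup_V gens_V(3)] in \<open>auto simp: nat_pow_inv\<close>)
    show "V i \<subseteq> s.V i" unfolding V_def
      by (rule generate_subgroup_incl[OF _ s.subgroup_V])
         (use s.gens_V[of i] subgroup.m_inv_closed[OF s.subgroup_V s.gens_V(3)[of i]] C in auto)
  qed
qed

lemma comm_self_pow: "x \<in> carrier G \<Longrightarrow> group_comm G (x [^] (n::nat)) x = \<one>"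
  by (rule group_comm_eqI) (auto simp: nat_pow_commute)

text \<open>Normality climbs from the bottom of the chain: if \<open>V i\<close> is normal, the
  commutators of \<open>U i\<close> lie in \<open>V i\<close>, which is inside \<open>U i\<close>,
  and so \<open>U i\<close> is normal. \<open>V_step\<close> is the other half of the climb.\<close>

lemma U_step:
  assumes "V i \<lhd> G"
  shows "\<And>x y. x \<in> U i \<Longrightarrow> y \<in> carrier G \<Longrightarrow> group_comm G x y \<in> V i" "U i \<lhd> G"
proof -
  interpret V: normal "V i" G by fact
  have BA: "group_comm G (B [^] ((3::nat) ^ i)) A \<in> V i"
    using macdonald_3.pow_mem_V_step[OF swap_3, of i] assms by (simp add: V_swap)
  show *: "group_comm G x y \<in> V i" if "x \<in> U i" "y \<in> carrier G" for x y
  proof (rule group_comm_generate_mem[OF assms])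
    show "x \<in> generate G {A [^] ((3::nat) ^ i), B [^] ((3::nat) ^ i), C [^] ((3::nat) ^ i)}"
      using that by (simp add: U_def)
    show "y \<in> generate G {A, B}" using that gen by simp
    fix p q assume "p \<in> {A [^] ((3::nat) ^ i), B [^] ((3::nat) ^ i), C [^] ((3::nat) ^ i)}" "q \<in> {A, B}"
    then show "group_comm G p q \<in> V i"
      using BA pow_mem_V_step[OF assms] comm_self_pow V.one_closed
        group_comm_normal_mem[OF assms gens_V(3)] by auto
  qed auto
  have "V i \<subseteq> U i"
    unfolding V_def
  proof (rule generate_subgroup_incl[OF _ subgroup_U])
    have "x [^] ((3::nat) ^ Suc i) \<in> U i" if "x \<in> carrier G" "x [^] ((3::nat) ^ i) \<in> U i" for x
      using multiple_pow_mem[OF subgroup_U that, of 3] that(1) by (simp add: mult.commute flip: int_pow_int)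
    then show "{A [^] ((3::nat) ^ Suc i), B [^] ((3::nat) ^ Suc i), C [^] ((3::nat) ^ i)} \<subseteq> U i"
      using gens_U[of i] by (simp del: power_Suc)
  qed
  then show "U i \<lhd> G" using * by (intro normal_of_group_comm[OF subgroup_U]) auto
qed

lemma C_pow_comm_A_mem:
  "group_comm G (C [^] ((3::nat) ^ i)) A \<in> U (Suc i)"
proof -
  obtain u where "\<alpha> ^ 3 ^ i = 1 + 3 ^ Suc i * u" using pow3_expand[OF \<alpha>(1)] by blast
  then have "1 - \<alpha> ^ 3 ^ i = 3 ^ Suc i * (- u)" by simp
  then show ?thesis
    unfolding comm_C_pow_A using multiple_pow_mem[OF subgroup_U A_closed gens_U(1)] by presburger
qed

lemma V_step:
  assumes "U (Suc i) \<lhd> G"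
  shows "\<And>x y. x \<in> V i \<Longrightarrow> y \<in> carrier G \<Longrightarrow> group_comm G x y \<in> U (Suc i)" "V i \<lhd> G"
proof -
  interpret U: normal "U (Suc i)" G by fact
  have CB: "group_comm G (C [^] ((3::nat) ^ i)) B \<in> U (Suc i)"
  proof -
    let ?c = "C [^] ((3::nat) ^ i)"
    obtain u where "\<beta> ^ 3 ^ i = 1 + 3 ^ Suc i * u" using pow3_expand[OF \<beta>(1)] by blast
    then have "\<beta> ^ 3 ^ i - 1 = 3 ^ Suc i * u" by simp
    then have "B [^] (\<beta> ^ 3 ^ i - 1) \<in> U (Suc i)"
      using multiple_pow_mem[OF subgroup_U B_closed gens_U(2)] by presburger
    then have "inv ?c \<otimes> B [^] (\<beta> ^ 3 ^ i - 1) \<otimes> ?c \<in> U (Suc i)" by (intro U.inv_op_closed1) auto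
    moreover have "group_comm G ?c B = inv ?c \<otimes> B [^] (\<beta> ^ 3 ^ i - 1) \<otimes> ?c"
    proof -
      have "group_comm G ?c B = inv ?c \<otimes> inv B \<otimes> (?c \<otimes> B [^] (1::int))"
        by (simp add: group_comm_def m_assoc)
      also have "\<dots> = inv ?c \<otimes> (B [^] (-1::int) \<otimes> B [^] (\<beta> ^ 3 ^ i)) \<otimes> ?c"
        unfolding C_B_pow by (simp add: m_assoc int_pow_neg)
      also have "B [^] (-1::int) \<otimes> B [^] (\<beta> ^ 3 ^ i) = B [^] (\<beta> ^ 3 ^ i - 1)"
        by (simp add: int_pow_mult[symmetric])
      finally show ?thesis .
    qed
    ultimately show ?thesis by simp
  qed
  show *: "group_comm G x y \<in> U (Suc i)" if "x \<in> V i" "y \<in> carrier G" for x y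
  proof (rule group_comm_generate_mem[OF assms])
    show "x \<in> generate G {A [^] ((3::nat) ^ Suc i), B [^] ((3::nat) ^ Suc i), C [^] ((3::nat) ^ i)}"
      using that by (simp add: V_def)
    show "y \<in> generate G {A, B}" using that gen by simp
    fix p q assume "p \<in> {A [^] ((3::nat) ^ Suc i), B [^] ((3::nat) ^ Suc i), C [^] ((3::nat) ^ i)}" "q \<in> {A, B}"
    then show "group_comm G p q \<in> U (Suc i)"
      using CB C_pow_comm_A_mem group_comm_normal_mem[OF assms gens_U(1)]
        group_comm_normal_mem[OF assms gens_U(2)] by auto
  qed auto
  have "U (Suc i) \<subseteq> V i"
    unfolding U_def
  proof (rule generate_subgroup_incl[OF _ subgroup_V])
    have "C [^] ((3::nat) ^ Suc i) \<in> V i"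
      using multiple_pow_mem[OF subgroup_V C_closed gens_V(3), of i 3] by (simp add: mult.commute flip: int_pow_int)
    then show "{A [^] ((3::nat) ^ Suc i), B [^] ((3::nat) ^ Suc i), C [^] ((3::nat) ^ Suc i)} \<subseteq> V i"
      using gens_V[of i] by (simp del: power_Suc)
  qed
  then show "V i \<lhd> G" using * by (intro normal_of_group_comm[OF subgroup_V]) auto
qed

end

text \<open>If 27 does not divide \<open>n\<close>, then \<open>gcd n 81\<close> divides 9. So for
  \<open>x\<close> of order dividing 81, a subgroup containing \<open>x ^ n\<close> contains
  \<open>x ^ 9\<close>; this reduces each intersection below to one power.\<close>

lemma not_27_dvd_imp:
  assumes "\<not> 27 dvd (n::nat)" shows "\<exists>x::int. 81 dvd int n * x - 9"
proof -
  have "gcd n 81 dvd 3 ^ 4" by simp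
  then obtain i where i: "i \<le> 4" "gcd n 81 = 3 ^ i" using divides_primepow_nat[of 3 "gcd n 81" 4] by auto
  have "\<not> 3 \<le> i"
  proof
    assume "3 \<le> i"
    then have "(3::nat) ^ 3 dvd gcd n 81" unfolding i(2) by (rule le_imp_power_dvd)
    then show False using assms by simp
  qed
  then have "gcd n 81 dvd 3 ^ 2" unfolding i(2) by (intro le_imp_power_dvd) simp
  then obtain k where k: "3 ^ 2 = gcd n 81 * k" by blast
  obtain u v where uv: "u * int n + v * 81 = gcd (int n) 81" using bezout_int by blast
  have "gcd (int n) 81 = int (gcd n 81)" using gcd_int_int_eq[of n 81] by simp
  moreover have "int (3 ^ 2) = int (gcd n 81) * int k" unfolding k by simp
  ultimately have "9 = (u * int n + v * 81) * int k" using uv by simp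
  then have "int n * (u * int k) - 9 = 81 * (- v * int k)" by (simp add: algebra_simps)
  then show ?thesis by (metis dvd_triv_left)
qed

section \<open>Exact order and class when the 27th power of the first generator is
  nontrivial\<close>

locale macdonald_3_faithful = macdonald_3 +
  assumes A_27: "A [^] (27::int) \<noteq> \<one>"
begin

lemma swap_3_faithful: "macdonald_3_faithful G B A (inv C) \<beta> \<alpha> s"
proof (intro macdonald_3_faithful.intro swap_3 macdonald_3_faithful_axioms.intro)
  obtain n y :: int where "B [^] (27::int) = A [^] (27 * n)" and y: "A [^] (27::int) = B [^] (27 * y)"
    by (rule B_pow_27)
  have "A [^] (27::int) = (B [^] (27::int)) [^] y" unfolding y by (simp add: int_pow_pow)
  then show "B [^] (27::int) \<noteq> \<one>" using A_27 by auto
qed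

lemma ord_A_81: "ord A = 81"
proof -
  have "A [^] ((3::nat) ^ Suc 3) = \<one>" "A [^] ((3::nat) ^ 3) \<noteq> \<one>"
    using A_pow_81 A_27 by (auto simp flip: int_pow_int)
  then show ?thesis using ord_eq_pow3[OF A_closed] by fastforce
qed

lemma ord_B_81: "ord B = 81"
  by (rule macdonald_3_faithful.ord_A_81[OF swap_3_faithful])

text \<open>\<open>\<alpha> ^ 9 - 1\<close> is 27 times a unit, so commuting would make
  \<open>A ^ 27\<close> trivial.\<close>

lemma C_pow_9_not_commute: "A \<otimes> C [^] (9::nat) \<noteq> C [^] (9::nat) \<otimes> A"
proof
  assume a: "A \<otimes> C [^] (9::nat) = C [^] (9::nat) \<otimes> A"
  obtain u where u: "\<alpha> ^ 9 = 1 + 27 * u" "\<not> 3 dvd u" using pow3_expand[OF \<alpha>(1), of 2] by auto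
  have "C [^] (9::nat) \<otimes> A [^] (1::int) = A [^] (1::int) \<otimes> C [^] (9::nat)" using a by simp
  then have "A [^] (1::int) = A [^] (\<alpha> ^ 9)" unfolding A_C_pow by (subst (asm) l_cancel) auto
  then have "A [^] (1::int) \<otimes> \<one> = A [^] (1::int) \<otimes> A [^] (27 * u)" unfolding u by (simp add: int_pow_mult)
  then have "A [^] (27 * u) = \<one>" by (subst (asm) l_cancel) auto
  then show False using unit_pow_A[OF u(2)] A_27 by blast
qed

lemma ord_C_27: "ord C = 27"
proof -
  have "C [^] (9::nat) \<noteq> \<one>" using C_pow_9_not_commute by auto
  then show ?thesis using C_pow_27 ord_eq_pow3[OF C_closed, of 2] by simp
qed

lemma prime_dvd_81: "Factorial_Ring.prime p \<Longrightarrow> p dvd (81::nat) \<Longrightarrow> p = 3"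
  using prime_dvd_power[of p 3 4] primes_dvd_imp_eq[of p 3] by simp

lemma split_81: "macdonald_split G A B C \<alpha> \<beta> 81 1 1"
proof (intro macdonald_split.intro macdonald_axioms macdonald_split_axioms.intro gen)
  fix p :: nat assume p: "Factorial_Ring.prime p"
  have "3 dvd \<alpha> - 1" "3 dvd \<beta> - 1" using \<alpha>(1) \<beta>(1) by presburger+
  then show "p dvd ord A \<Longrightarrow> int p dvd \<alpha> - 1" "p dvd ord B \<Longrightarrow> int p dvd \<beta> - 1"
    using prime_dvd_81[OF p] unfolding ord_A_81 ord_B_81 by auto
qed (auto simp: ord_A_81 ord_B_81)

sublocale sp: macdonald_split G A B C \<alpha> \<beta> 81 1 1
  by (rule split_81)

lemma carrier_eq_PS: "carrier G = sp.PS"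
proof
  have "{A, B} \<subseteq> sp.PS" using sp.A_pow_mem sp.B_pow_mem by simp
  then show "carrier G \<subseteq> sp.PS" unfolding gen by (rule generate_subgroup_incl[OF _ sp.subgroup_PS])
  show "sp.PS \<subseteq> carrier G" using sp.PS_carrier by blast
qed

text \<open>A common element is a power of \<open>C\<close> that commutes with \<open>A\<close>. If
  it is nontrivial, \<open>C ^ 9\<close> is one of its powers and would commute with
  \<open>A\<close> too.\<close>

lemma PC_Int_PA: "sp.PC \<inter> sp.PA = {\<one>}"
proof -
  have "c = \<one>" if c: "c \<in> sp.PC" "c \<in> sp.PA" for c
  proof -
    obtain n :: nat where n: "c = C [^] n" using c(1) sp.ord_C generate_pow_mem_nat[of C c 1] by auto
    obtain z :: int where z: "c = A [^] z" using c(2) generate_pow_mem[of A c 1] by auto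
    have comm: "C [^] n \<otimes> A = A \<otimes> C [^] n" unfolding n[symmetric] z by (rule int_pow_commute) auto
    have "27 dvd n"
    proof (rule ccontr)
      assume "\<not> 27 dvd n"
      then obtain x where "81 dvd int n * x - 9" using not_27_dvd_imp by blast
      then have "int (ord C) dvd int n * x - 9" unfolding ord_C_27 by (rule dvd_trans[rotated]) simp
      then have "C [^] (9::int) = C [^] (int n * x)" by (simp add: int_pow_eq)
      also have "\<dots> = (C [^] n) [^] x" by (simp add: int_pow_pow[symmetric] int_pow_int)
      finally have "C [^] (9::nat) = (C [^] n) [^] x" by (simp flip: int_pow_int)
      then have "C [^] (9::nat) \<otimes> A = A \<otimes> C [^] (9::nat)" using int_pow_commute[OF comm] by simp
      then show False using C_pow_9_not_commute by simp
    qed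
    then show ?thesis unfolding n by (simp add: pow_eq_id ord_C_27)
  qed
  then have "sp.PC \<inter> sp.PA \<subseteq> {\<one>}" by blast
  moreover have "\<one> \<in> sp.PC" "\<one> \<in> sp.PA"
    by (rule subgroup.one_closed[OF sp.subgroup_PC], rule subgroup.one_closed[OF sp.subgroup_PA])
  ultimately show ?thesis by blast
qed

lemma card_PX: "card sp.PX = 3 ^ 7"
proof -
  have "card sp.PX = card sp.PC * card sp.PA"
    using card_set_mult[OF sp.subgroup_PC sp.subgroup_PA sp.finite_PC sp.finite_PA] PC_Int_PA by simp
  then show ?thesis using generate_pow_card[OF A_closed] generate_pow_card[OF C_closed] ord_A_81 ord_C_27 by simp
qed

text \<open>Suppose \<open>B ^ 9 = C ^ n A ^ z\<close>. In
  \<open>B ^ 9 A = A C ^ (-9) B ^ S(9)\<close> the last factor is again \<open>C ^ n\<close> times a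
  power of \<open>A\<close>, because \<open>S(9)\<close> is 9 modulo 27 and \<open>B ^ 27\<close> is
  a power of \<open>A\<close>. Comparing both sides puts \<open>C ^ (-9) = C ^ 18\<close> into
  \<open>\<langle>A\<rangle>\<close>.\<close>

lemma B_pow_9_not_mem: "B [^] (9::nat) \<notin> sp.PX"
proof
  assume "B [^] (9::nat) \<in> sp.PX"
  then obtain c a where ca: "c \<in> sp.PC" "a \<in> sp.PA" "B [^] (9::nat) = c \<otimes> a" by (rule set_mult_memE)
  obtain n :: nat where n: "c = C [^] n" using ca(1) sp.ord_C generate_pow_mem_nat[of C c 1] by auto
  obtain z :: int where z: "a = A [^] z" using ca(2) generate_pow_mem[of A a 1] by auto
  have eq: "B [^] (9::nat) = C [^] n \<otimes> A [^] z" unfolding ca(3) n z ..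
  obtain g where g: "geo_sum \<beta> 9 = 9 + 27 * g" using geo_sum_pow3[OF \<beta>(1), of 2] by auto
  obtain v y :: int where v: "B [^] (27::int) = A [^] (27 * v)" and "A [^] (27::int) = B [^] (27 * y)"
    by (rule B_pow_27)
  have "B [^] geo_sum \<beta> 9 = B [^] (9::nat) \<otimes> (B [^] (27::int)) [^] g"
    unfolding g by (simp add: int_pow_pow int_pow_mult[symmetric] flip: int_pow_int)
  also have "\<dots> = C [^] n \<otimes> A [^] (z + 27 * v * g)"
    unfolding v eq by (simp add: int_pow_pow int_pow_mult m_assoc)
  finally have geo: "B [^] geo_sum \<beta> 9 = C [^] n \<otimes> A [^] (z + 27 * v * g)" .
  have invC: "inv C [^] (9::nat) = C [^] (18::nat)"
  proof -
    have "C [^] (18::nat) \<otimes> C [^] (9::nat) = \<one>" using C_pow_27 by (simp add: nat_pow_mult)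
    then have "inv (C [^] (9::nat)) = C [^] (18::nat)" by (intro inv_equality) auto
    then show ?thesis by (simp add: nat_pow_inv)
  qed
  have "C [^] n \<otimes> A [^] (z + 1) = B [^] (9::nat) \<otimes> A" unfolding eq by (simp add: m_assoc int_pow_mult)
  also have "\<dots> = A [^] (1::int) \<otimes> C [^] (18 + n) \<otimes> A [^] (z + 27 * v * g)"
    unfolding B_pow_A geo invC by (simp add: m_assoc nat_pow_mult[symmetric])
  also have "\<dots> = C [^] (n + 18) \<otimes> A [^] (\<alpha> ^ (18 + n) + (z + 27 * v * g))"
    unfolding A_C_pow by (simp add: m_assoc int_pow_mult add.commute)
  also have "\<dots> = C [^] n \<otimes> (C [^] (18::nat) \<otimes> A [^] (\<alpha> ^ (18 + n) + (z + 27 * v * g)))"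
    by (simp add: m_assoc nat_pow_mult[symmetric])
  finally have "A [^] (z + 1) = C [^] (18::nat) \<otimes> A [^] (\<alpha> ^ (18 + n) + (z + 27 * v * g))"
    by (subst (asm) l_cancel) auto
  then have "C [^] (18::nat) = A [^] (z + 1) \<otimes> inv (A [^] (\<alpha> ^ (18 + n) + (z + 27 * v * g)))"
    by (simp add: m_assoc)
  then have "C [^] (18::nat) = A [^] ((z + 1) - (\<alpha> ^ (18 + n) + (z + 27 * v * g)))"
    unfolding int_pow_diff[OF A_closed] .
  then have "C [^] (18::nat) \<in> sp.PA" using generate_pow_mem[of A _ 1] by auto
  moreover have "C [^] (18::nat) \<in> sp.PC" using generate_pow_mem_nat[of C _ 1] sp.ord_C by auto
  ultimately have "C [^] (18::nat) = \<one>" using PC_Int_PA by blast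
  then show False by (simp add: pow_eq_id ord_C_27)
qed

lemma PX_Int_PB: "sp.PX \<inter> sp.PB = generate G {B [^] (27::nat)}"
proof
  obtain v y :: int where v: "B [^] (27::int) = A [^] (27 * v)" and "A [^] (27::int) = B [^] (27 * y)"
    by (rule B_pow_27)
  have "B [^] (27::nat) = A [^] (27 * v)" using v by (simp flip: int_pow_int)
  then have "B [^] (27::nat) \<in> sp.PA" using generate_pow_mem[of A _ 1] by auto
  then have 1: "B [^] (27::nat) \<in> sp.PX" using sp.PA_subset_PX by blast
  have "B [^] (27::nat) \<in> sp.PB" using generate_pow_mem_nat[of B _ 1] ord_B_81 by auto
  then show "generate G {B [^] (27::nat)} \<subseteq> sp.PX \<inter> sp.PB"
    using 1 by (intro generate_subgroup_incl subgroups_Inter_pair sp.subgroup_PX sp.subgroup_PB) auto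
  show "sp.PX \<inter> sp.PB \<subseteq> generate G {B [^] (27::nat)}"
  proof
    fix x assume x: "x \<in> sp.PX \<inter> sp.PB"
    then obtain n :: nat where n: "x = B [^] n" using generate_pow_mem_nat[of B x 1] ord_B_81 by auto
    have "27 dvd n"
    proof (rule ccontr)
      assume "\<not> 27 dvd n"
      then obtain z where "81 dvd int n * z - 9" using not_27_dvd_imp by blast
      then have "B [^] (9::int) = B [^] (int n * z)" by (simp add: int_pow_eq ord_B_81)
      also have "\<dots> = x [^] z" unfolding n by (simp add: int_pow_pow[symmetric] int_pow_int)
      finally have "B [^] (9::nat) = x [^] z" by (simp flip: int_pow_int)
      then have "B [^] (9::nat) \<in> sp.PX" using x subgroup_int_pow_closed[OF sp.subgroup_PX] by auto
      then show False using B_pow_9_not_mem by blast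
    qed
    then show "x \<in> generate G {B [^] (27::nat)}"
      unfolding n using generate_pow_mem_nat[of B _ 27] ord_B_81 by auto
  qed
qed

theorem order_eq: "order G = 3 ^ 10"
proof -
  have "finite sp.PX" using card_PX by (metis card.infinite power_not_zero zero_neq_numeral)
  then have "card sp.PS * card (sp.PX \<inter> sp.PB) = card sp.PX * card sp.PB"
    unfolding sp.PS_def by (rule card_set_mult[OF sp.subgroup_PX sp.subgroup_PB _ sp.finite_PB])
  moreover have "card (sp.PX \<inter> sp.PB) = 3"
  proof -
    have "ord (B [^] (27::nat)) = 3" using ord_pow[of B 27] ord_B_81 by simp
    then show ?thesis unfolding PX_Int_PB using generate_pow_card[of "B [^] (27::nat)"] by simp
  qed
  moreover have "card sp.PB = 81" using generate_pow_card[OF B_closed] ord_B_81 by simp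
  ultimately show ?thesis unfolding order_def carrier_eq_PS card_PX by simp
qed

lemma V_3: "V 3 = {\<one>}"
proof -
  have "A [^] ((3::nat) ^ Suc 3) = \<one>" "B [^] ((3::nat) ^ Suc 3) = \<one>" "C [^] ((3::nat) ^ 3) = \<one>"
    using A_pow_81 B_pow_81 C_pow_27 by (simp_all flip: int_pow_int)
  then have "V 3 = generate G {\<one>}" unfolding V_def by (simp del: power_Suc)
  also have "\<dots> = {\<one>}" by (rule generate_one)
  finally show ?thesis .
qed

lemma U_V_normal: "i \<le> 3 \<Longrightarrow> V (3 - i) \<lhd> G \<and> U (3 - i) \<lhd> G"
proof (induction i)
  case 0
  have "V 3 \<lhd> G" unfolding V_3 by (rule one_is_normal)
  then show ?case using U_step by simp
next
  case (Suc i)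
  then have "U (Suc (3 - Suc i)) \<lhd> G" using Suc_diff_Suc[of i 3] by simp
  then show ?case using V_step U_step by blast
qed

lemma lower_central_U_V:
  "i \<le> 3 \<Longrightarrow> lower_central G (2 * i) \<subseteq> U i \<and> lower_central G (Suc (2 * i)) \<subseteq> V i"
proof (induction i)
  case 0
  have "carrier G \<subseteq> U 0" unfolding gen using gens_U[of 0] by (intro generate_subgroup_incl subgroup_U) auto
  then have 1: "lower_central G 0 \<subseteq> U 0" by simp
  have "V 0 \<lhd> G" using U_V_normal[of 3] by simp
  then have "lower_central G (Suc 0) \<subseteq> V 0"
    using 1 U_step(1) by (intro lower_central_Suc_subset[OF subgroup_V]) blast
  then show ?case using 1 by simp
next
  case (Suc i)
  have n: "V (Suc i) \<lhd> G" "U (Suc i) \<lhd> G" using U_V_normal[of "3 - Suc i"] Suc.prems by auto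
  have "lower_central G (Suc (2 * i)) \<subseteq> V i" using Suc by simp
  then have 1: "lower_central G (Suc (Suc (2 * i))) \<subseteq> U (Suc i)"
    using V_step(1)[OF n(2)] by (intro lower_central_Suc_subset[OF subgroup_U]) blast
  then have "lower_central G (Suc (Suc (Suc (2 * i)))) \<subseteq> V (Suc i)"
    using U_step(1)[OF n(1)] by (intro lower_central_Suc_subset[OF subgroup_V]) blast
  then show ?case using 1 by (simp del: lower_central.simps)
qed

text \<open>Commuting \<open>A ^ n\<close> for \<open>n = 3 ^ i\<close> with \<open>B\<close> and
  then with \<open>A\<close> gives \<open>A ^ (1 - \<alpha> ^ n)\<close>, of which
  \<open>A ^ (3 n)\<close> is a power. Two commutator steps cost one factor 3, so
  \<open>A ^ 27\<close> survives six of them.\<close>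

lemma A_pow_mem_lower_central: "A [^] ((3::nat) ^ i) \<in> lower_central G (2 * i)"
proof (induction i)
  case (Suc i)
  let ?n = "(3::nat) ^ i"
  define x where "x = inv (A [^] ?n) \<otimes> (C [^] ?n \<otimes> A [^] geo_sum \<alpha> ?n)"
  have x: "x \<in> lower_central G (Suc (2 * i))" "x \<in> carrier G"
    using group_comm_lower_central[OF Suc B_closed] by (auto simp: comm_A_pow_B x_def simp del: lower_central.simps)
  have "group_comm G x A = A [^] (1 - \<alpha> ^ ?n)"
  proof (rule group_comm_eqI)
    have AA: "A [^] z \<otimes> A = A \<otimes> A [^] z" for z :: int by (rule int_pow_commute) auto
    have inv: "inv (A [^] ?n) = A [^] (- int ?n)" unfolding int_pow_neg_int[OF A_closed] ..
    have "x \<otimes> A = inv (A [^] ?n) \<otimes> ((C [^] ?n \<otimes> A) \<otimes> A [^] geo_sum \<alpha> ?n)"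
      unfolding x_def using AA by (simp add: m_assoc)
    also have "\<dots> = (inv (A [^] ?n) \<otimes> A) \<otimes> C [^] ?n \<otimes> (A [^] (1 - \<alpha> ^ ?n) \<otimes> A [^] geo_sum \<alpha> ?n)"
      unfolding C_pow_A by (simp add: m_assoc)
    also have "\<dots> = (A \<otimes> inv (A [^] ?n)) \<otimes> C [^] ?n \<otimes> (A [^] geo_sum \<alpha> ?n \<otimes> A [^] (1 - \<alpha> ^ ?n))"
      unfolding inv AA by (simp add: int_pow_mult[symmetric] add.commute)
    also have "\<dots> = A \<otimes> x \<otimes> A [^] (1 - \<alpha> ^ ?n)" unfolding x_def by (simp add: m_assoc)
    finally show "x \<otimes> A = A \<otimes> x \<otimes> A [^] (1 - \<alpha> ^ ?n)" .
  qed (use x in auto)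
  then have mem: "A [^] (1 - \<alpha> ^ ?n) \<in> lower_central G (Suc (Suc (2 * i)))"
    using group_comm_lower_central[OF x(1) A_closed] by simp
  obtain u where u: "\<alpha> ^ ?n = 1 + 3 ^ Suc i * u" "\<not> 3 dvd u" using pow3_expand[OF \<alpha>(1)] by blast
  have "\<not> 3 dvd - u" using u(2) by simp
  then obtain w where w: "A [^] (- u * w) = A" using unit_pow_inverse[OF A_closed A_3pow] by blast
  have "A [^] (3 ^ Suc i :: int) = (A [^] (- u * w)) [^] (3 ^ Suc i :: int)" unfolding w by simp
  also have "\<dots> = (A [^] (1 - \<alpha> ^ ?n)) [^] w" unfolding u int_pow_pow[OF A_closed] by (simp add: ac_simps)
  finally have "A [^] ((3::nat) ^ Suc i) = (A [^] (1 - \<alpha> ^ ?n)) [^] w" by (simp flip: int_pow_int)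
  then have "A [^] ((3::nat) ^ Suc i) \<in> lower_central G (Suc (Suc (2 * i)))"
    using subgroup_int_pow_closed[OF lower_central_subgroup mem] by (simp del: lower_central.simps)
  then show ?case by (simp del: lower_central.simps)
qed simp

theorem class_eq: "nilpotency_class_is G 7"
  unfolding nilpotency_class_is_def
proof (intro conjI allI impI)
  have "lower_central G 7 \<subseteq> {\<one>}" using lower_central_U_V[of 3] unfolding V_3 by simp
  then show "lower_central G 7 = {\<one>}" using subgroup.one_closed[OF lower_central_subgroup, of 7] by blast
  fix d :: nat assume "d < 7"
  then have d: "d + (6 - d) = 6" by simp
  have "A [^] (27::nat) \<in> lower_central G 6" using A_pow_mem_lower_central[of 3] by simp
  moreover have "A [^] (27::nat) \<noteq> \<one>" using A_27 by (simp flip: int_pow_int)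
  ultimately have "lower_central G 6 \<noteq> {\<one>}" by auto
  then show "lower_central G d \<noteq> {\<one>}" using lower_central_trivial_mono[of d "6 - d"] unfolding d by blast
qed

end

section \<open>A model in which the first generator has order 81\<close>

text \<open>The last three conditions are \<open>A B = B A C\<close>, \<open>A C = C A ^ r\<close>
  and \<open>C B = B ^ t C\<close> for a right action, which is why the maps are composed in reverse
  order.\<close>

locale word_model =
  fixes \<Omega> :: "'p set" and f g h :: "'p \<Rightarrow> 'p" and r t :: nat
  assumes f_closed: "p \<in> \<Omega> \<Longrightarrow> f p \<in> \<Omega>"
    and g_closed: "p \<in> \<Omega> \<Longrightarrow> g p \<in> \<Omega>"
    and f_81: "p \<in> \<Omega> \<Longrightarrow> (f ^^ 81) p = p"
    and g_81: "p \<in> \<Omega> \<Longrightarrow> (g ^^ 81) p = p"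
    and gf: "p \<in> \<Omega> \<Longrightarrow> g (f p) = h (f (g p))"
    and hf: "p \<in> \<Omega> \<Longrightarrow> h (f p) = (f ^^ r) (h p)"
    and gh: "p \<in> \<Omega> \<Longrightarrow> g (h p) = h ((g ^^ t) p)"
begin

text \<open>Words act from the right; the inverse of a generator acts as its 80th power.\<close>
fun letter :: "bool \<times> bool \<Rightarrow> 'p \<Rightarrow> 'p" where
  "letter (x, e) = (if x then g else f) ^^ (if e then 80 else 1)"

definition act :: "bool word \<Rightarrow> 'p \<Rightarrow> 'p" where
  "act w p = foldl (\<lambda>p l. letter l p) p w"

lemma act_simps [simp]: "act [] p = p" "act (l # w) p = act w (letter l p)" "act (u @ v) p = act v (act u p)"
  by (simp_all add: act_def)

lemma funpow_closed: "(\<And>p. p \<in> \<Omega> \<Longrightarrow> k p \<in> \<Omega>) \<Longrightarrow> p \<in> \<Omega> \<Longrightarrow> (k ^^ n) p \<in> \<Omega>"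
  by (induction n) auto

lemma letter_closed: "p \<in> \<Omega> \<Longrightarrow> letter l p \<in> \<Omega>"
  by (cases l) (auto simp: f_closed g_closed funpow_closed)

lemma act_closed: "p \<in> \<Omega> \<Longrightarrow> act w p \<in> \<Omega>"
  by (induction w arbitrary: p) (auto simp: letter_closed simp del: letter.simps)

lemma letter_cancel: "p \<in> \<Omega> \<Longrightarrow> letter (x, \<not> b) (letter (x, b) p) = p"
proof -
  assume p: "p \<in> \<Omega>"
  have "(k ^^ 80) (k p) = (k ^^ 81) p" "k ((k ^^ 80) p) = (k ^^ 81) p" for k :: "'p \<Rightarrow> 'p"
    using fun_cong[OF funpow_add[of 80 1 k], of p] fun_cong[OF funpow_add[of 1 80 k], of p] by simp_all
  then show ?thesis using f_81[OF p] g_81[OF p] by simp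
qed

lemma funpow_mod_81:
  assumes "\<And>p. p \<in> \<Omega> \<Longrightarrow> k p \<in> \<Omega>" "\<And>p. p \<in> \<Omega> \<Longrightarrow> (k ^^ 81) p = p" "p \<in> \<Omega>"
  shows "(k ^^ n) p = (k ^^ (n mod 81)) p"
proof -
  have "((k ^^ 81) ^^ m) p = p" for m by (induction m) (use assms in auto)
  then have "(k ^^ (81 * m)) p = p" for m by (simp add: funpow_mult mult.commute)
  moreover have "(k ^^ n) p = (k ^^ (n mod 81)) ((k ^^ (81 * (n div 81))) p)"
    using funpow_add[of "n mod 81" "81 * (n div 81)" k] by simp
  ultimately show ?thesis by simp
qed

lemma act_pow_word:
  assumes "p \<in> \<Omega>"
  shows "act (pow_word [(x, False)] z) p = ((if x then g else f) ^^ nat (z mod 81)) p"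
proof -
  define k where "k = (if x then g else f)"
  have k: "\<And>p. p \<in> \<Omega> \<Longrightarrow> k p \<in> \<Omega>" "\<And>p. p \<in> \<Omega> \<Longrightarrow> (k ^^ 81) p = p"
    using f_closed g_closed f_81 g_81 by (auto simp: k_def)
  have rep: "act (replicate n (x, e)) p = ((k ^^ (if e then 80 else 1)) ^^ n) p" for n e p
    by (induction n arbitrary: p) (auto simp: funpow_swap1 k_def)
  show ?thesis unfolding k_def[symmetric]
  proof (cases "0 \<le> z")
    case True
    have "nat z mod 81 = nat (z mod 81)" using True by (simp add: nat_mod_distrib)
    then show "act (pow_word [(x, False)] z) p = (k ^^ nat (z mod 81)) p"
      using True funpow_mod_81[OF k assms, of "nat z"] by (simp add: pow_word_def rep)
  next
    case False
    \<comment> \<open>An inverse letter acts as an 80th power, and 80 is -1 modulo 81.\<close>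
    have "int ((80 * nat (- z)) mod 81) = (80 * (- z)) mod 81" using False by (simp add: zmod_int)
    also have "\<dots> = (z + 81 * (- z)) mod 81" by (simp add: algebra_simps)
    also have "\<dots> = z mod 81" by (rule mod_mult_self2)
    finally have "(80 * nat (- z)) mod 81 = nat (z mod 81)" by simp
    then have "(k ^^ (80 * nat (- z))) p = (k ^^ nat (z mod 81)) p"
      using funpow_mod_81[OF k assms, of "80 * nat (- z)"] by simp
    then show "act (pow_word [(x, False)] z) p = (k ^^ nat (z mod 81)) p"
      using False by (simp add: pow_word_def inv_word_def rep funpow_mult mult.commute)
  qed
qed

lemma act_comm_word:
  assumes "p \<in> \<Omega>"
  shows "act (comm_word wA wB) p = h p" "h (act (comm_word wB wA) p) = p" "act (comm_word wB wA) (h p) = p"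
proof -
  note c = letter_closed[OF assms]
  have l: "letter (False, False) = f" "letter (True, False) = g" by auto
  \<comment> \<open>The word \<open>B A\<close> takes \<open>q\<close> to \<open>p\<close>, so the
    rule \<open>gf\<close> at \<open>q\<close> identifies \<open>h\<close> with the action of the
    commutator.\<close>
  define q where "q = letter (True, True) (letter (False, True) p)"
  have q: "q \<in> \<Omega>" using assms by (simp add: q_def letter_closed del: letter.simps)
  have gq: "g q = letter (False, True) p"
    unfolding q_def using letter_cancel[of "letter (False, True) p" True True] letter_closed assms l by metis
  have "f (letter (False, True) p) = p" using letter_cancel[OF assms, of False True] l by simp
  moreover have "act (comm_word wA wB) p = g (f q)"
    by (simp add: comm_word_def inv_word_def wA_def wB_def q_def l del: letter.simps)
  ultimately show 1: "act (comm_word wA wB) p = h p" using gf[OF q] gq by simp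
  define q' where "q' = letter (False, True) (letter (True, True) p)"
  have q': "q' \<in> \<Omega>" using assms by (simp add: q'_def letter_closed del: letter.simps)
  have fq: "f q' = letter (True, True) p"
    unfolding q'_def using letter_cancel[of "letter (True, True) p" False True] letter_closed assms l by metis
  have "g (letter (True, True) p) = p" using letter_cancel[OF assms, of True True] l by simp
  moreover have "act (comm_word wB wA) p = f (g q')"
    by (simp add: comm_word_def inv_word_def wA_def wB_def q'_def l del: letter.simps)
  ultimately show "h (act (comm_word wB wA) p) = p" using gf[OF q'] fq by simp
  have "act (comm_word wB wA) (act (comm_word wA wB) p) = p"
  proof -
    let ?a = "letter (False, False)" and ?a' = "letter (False, True)"
      and ?b = "letter (True, False)" and ?b' = "letter (True, True)"
    have "act (comm_word wB wA) (act (comm_word wA wB) p) = ?a (?b (?a' (?b' (?b (?a (?b' (?a' p)))))))"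
      by (simp add: comm_word_def inv_word_def wA_def wB_def del: letter.simps)
    moreover have "?b' (?b z) = z" "?a' (?a z) = z" "?b (?b' z) = z" "?a (?a' z) = z" if "z \<in> \<Omega>" for z
      using letter_cancel[OF that, of True False] letter_cancel[OF that, of False False]
        letter_cancel[OF that, of True True] letter_cancel[OF that, of False True] by (simp_all del: letter.simps)
    ultimately show ?thesis using assms by (simp add: letter_closed del: letter.simps)
  qed
  then show "act (comm_word wB wA) (h p) = p" using 1 by simp
qed

lemma inv_comm_word: "inv_word (comm_word u v) = comm_word v u" for u v :: "'g word"
proof -
  have "inv_word (inv_word w) = w" for w :: "'g word"
    by (simp add: inv_word_def rev_map comp_def case_prod_beta)
  moreover have "inv_word (u @ v) = inv_word v @ inv_word u" for u v :: "'g word"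
    by (simp add: inv_word_def)
  ultimately show ?thesis by (simp add: comm_word_def)
qed

theorem act_word_eq:
  assumes "word_eq (G_rels \<alpha> \<beta>) u v" "\<alpha> mod 81 = int r" "\<beta> mod 81 = int t" "p \<in> \<Omega>"
  shows "act u p = act v p"
  using assms(1,4)
proof (induction arbitrary: p rule: word_eq.induct)
  case (cong u v p' q')
  then show ?case by (simp add: act_closed)
next
  case (cancel x b)
  then show ?case using letter_cancel by (simp del: letter.simps)
next
  case (rel u v)
  then consider "u = conj_word wA (comm_word wA wB)" "v = pow_word wA \<alpha>"
    | "u = conj_word wB (comm_word wB wA)" "v = pow_word wB \<beta>"
    unfolding G_rels_def by auto
  then show ?case
  proof cases
    case 1
    define q where "q = act (comm_word wB wA) p"
    have q: "q \<in> \<Omega>" "h q = p" using rel.prems act_comm_word(2) act_closed by (auto simp: q_def)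
    have "act u p = h (f q)"
      using q by (simp add: 1 conj_word_def inv_comm_word q_def[symmetric] wA_def[symmetric] act_comm_word(1) f_closed
         del: letter.simps) (simp add: wA_def act_comm_word(1)[unfolded wA_def] f_closed)
    also have "\<dots> = (f ^^ r) p" using hf[OF q(1)] q(2) by simp
    also have "\<dots> = act v p" using act_pow_word[OF rel.prems, of False \<alpha>] assms(2) by (simp add: 1 wA_def)
    finally show ?thesis .
  next
    case 2
    have "act u p = act (comm_word wB wA) (g (h p))"
      using rel.prems by (simp add: 2 conj_word_def inv_comm_word act_comm_word(1)) (simp add: wB_def)
    also have "\<dots> = (g ^^ t) p"
      using gh[OF rel.prems] act_comm_word(3) funpow_closed[OF g_closed] rel.prems by simp
    also have "\<dots> = act v p" using act_pow_word[OF rel.prems, of True \<beta>] assms(3) by (simp add: 2 wB_def)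
    finally show ?thesis .
  qed
qed auto

end

text \<open>A table lists, for each \<open>k < 27\<close>, an entry \<open>(m, d, k')\<close> encoding the map
  \<open>(x, k) \<mapsto> (m x + d mod 81, k')\<close>.\<close>
type_synonym table = "(int \<times> int \<times> int) list"

fun lookup :: "table \<Rightarrow> int \<Rightarrow> int \<times> int \<times> int" where
  "lookup [] i = (0, 0, 0)"
| "lookup (x # xs) i = (if i = 0 then x else lookup xs (i - 1))"

text \<open>\<open>T\<close> acts first, as in a right action, so products of tables are written in
  the order of the words.\<close>

definition table_comp :: "table \<Rightarrow> table \<Rightarrow> table" where
  "table_comp T U = map (\<lambda>(m, d, k). case lookup U k of (m', d', k') \<Rightarrow>
     (m * m' mod 81, (m' * d + d') mod 81, k')) T"

fun table_pow :: "table \<Rightarrow> nat \<Rightarrow> table" where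
  "table_pow T 0 = map (\<lambda>k. (1, 0, k)) [0..26]"
| "table_pow T (Suc n) = table_comp T (table_pow T n)"

definition table_ok :: "table \<Rightarrow> bool" where
  "table_ok T \<longleftrightarrow> length T = 27 \<and> list_all (\<lambda>(m, d, k). 0 \<le> k \<and> k < 27) T"

definition table_app :: "table \<Rightarrow> int \<times> int \<Rightarrow> int \<times> int" where
  "table_app T p = (case p of (x, k) \<Rightarrow> case lookup T k of (m, d, k') \<Rightarrow> ((m * x + d) mod 81, k'))"

definition grid :: "(int \<times> int) set" where
  "grid = {0..<81} \<times> {0..<27}"

lemma lookup_nth: "0 \<le> i \<Longrightarrow> nat i < length T \<Longrightarrow> lookup T i = T ! nat i"
proof (induction T i rule: lookup.induct)
  case (2 x xs i)
  then show ?case by (cases "i = 0") (auto simp: nth_Cons' nat_diff_distrib)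
qed simp

lemma table_app_closed:
  assumes "table_ok T" "p \<in> grid" shows "table_app T p \<in> grid"
proof -
  obtain x k where p: "p = (x, k)" "0 \<le> k" "nat k < length T" using assms by (cases p) (auto simp: grid_def table_ok_def)
  obtain m d k' where e: "lookup T k = (m, d, k')" by (cases "lookup T k")
  have "(m, d, k') \<in> set T" using lookup_nth[OF p(2,3)] p(3) e by (metis nth_mem)
  then have "0 \<le> k' \<and> k' < 27" using assms(1) by (auto simp: table_ok_def list_all_iff)
  then show ?thesis by (simp add: table_app_def p(1) e grid_def)
qed

lemma table_comp_ok: "table_ok T \<Longrightarrow> table_ok U \<Longrightarrow> table_ok (table_comp T U)"
proof -
  assume T: "table_ok T" and U: "table_ok U"
  have "0 \<le> k' \<and> k' < 27" if "(m, d, k) \<in> set T" "lookup U k = (m', d', k')" for m d k m' d' k'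
  proof -
    have "0 \<le> k" "nat k < length U" using T U that(1) by (auto simp: table_ok_def list_all_iff)
    then have "(m', d', k') \<in> set U" using lookup_nth[of k U] that(2) by (metis nth_mem)
    then show ?thesis using U by (auto simp: table_ok_def list_all_iff)
  qed
  then show ?thesis using T by (force simp: table_ok_def table_comp_def list_all_iff split: prod.splits)
qed

lemma table_app_comp:
  assumes "table_ok T" "p \<in> grid"
  shows "table_app (table_comp T U) p = table_app U (table_app T p)"
proof -
  obtain x k where p: "p = (x, k)" "0 \<le> k" "nat k < length T" using assms by (cases p) (auto simp: grid_def table_ok_def)
  obtain m d k' where e: "T ! nat k = (m, d, k')" by (cases "T ! nat k")
  obtain m' d' k'' where e': "lookup U k' = (m', d', k'')" by (cases "lookup U k'")
  have 1: "lookup T k = (m, d, k')" using lookup_nth[OF p(2,3)] e by simp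
  have 2: "lookup (table_comp T U) k = (m * m' mod 81, (m' * d + d') mod 81, k'')"
    using lookup_nth[of k "table_comp T U"] p e e' by (simp add: table_comp_def)
  have "[m * m' mod 81 * x + (m' * d + d') mod 81 = m * m' * x + (m' * d + d')] (mod 81)"
    by (intro cong_add cong_mult) (auto simp: cong_def)
  also have "m * m' * x + (m' * d + d') = m' * (m * x + d) + d'" by (simp add: algebra_simps)
  also have "[\<dots> = m' * ((m * x + d) mod 81) + d'] (mod 81)"
    by (intro cong_add cong_mult) (auto simp: cong_def)
  finally have 3: "(m * m' mod 81 * x + (m' * d + d') mod 81) mod 81 = (m' * ((m * x + d) mod 81) + d') mod 81"
    by (simp only: cong_def)
  show ?thesis by (simp only: table_app_def p(1) 1 2 3 e' prod.case)
qed

lemma table_id_ok: "table_ok (map (\<lambda>k. (1, 0, k)) [0..26])"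
  by (auto simp: table_ok_def list_all_iff)

lemma table_app_id:
  assumes "p \<in> grid" shows "table_app (map (\<lambda>k. (1, 0, k)) [0..26]) p = p"
proof -
  obtain x k where p: "p = (x, k)" "0 \<le> x" "x < 81" "0 \<le> k" "k < 27" using assms by (auto simp: grid_def)
  have "lookup (map (\<lambda>k. (1, 0, k)) [0..26]) k = (1, 0, k)"
    using p by (subst lookup_nth) auto
  then show ?thesis using p by (simp add: table_app_def)
qed

lemma table_pow_ok: "table_ok T \<Longrightarrow> table_ok (table_pow T n)"
  by (induction n) (simp_all add: table_id_ok table_comp_ok del: upto_rec_numeral)

lemma table_app_pow:
  assumes "table_ok T" "p \<in> grid"
  shows "table_app (table_pow T n) p = (table_app T ^^ n) p"
  using assms(2)
proof (induction n arbitrary: p)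
  case (Suc n)
  then show ?case
    using table_app_comp[OF assms(1) Suc.prems] table_app_closed[OF assms(1) Suc.prems] by (simp add: funpow_swap1)
qed (simp add: table_app_id del: upto_rec_numeral)

text \<open>The tables of the right action of \<open>a\<close>, \<open>b ^ n\<close> and \<open>c\<close> on the cosets of \<open>\<langle>c\<rangle>\<close>, where \<open>(x, k)\<close>
  stands for the coset of \<open>a ^ x b ^ k\<close> and \<open>b ^ 27 = a ^ (- 27)\<close>. Here \<open>ai\<close> and \<open>bi\<close> are inverses
  of \<open>al\<close> and \<open>be\<close> modulo 81.\<close>
fun rows_a :: "int \<Rightarrow> int \<Rightarrow> nat \<Rightarrow> int \<Rightarrow> int \<Rightarrow> int \<Rightarrow> table" where
  "rows_a ai be 0 w p s = []"
| "rows_a ai be (Suc n) w p s = (w, (w + 54 * (s div 27)) mod 81, s mod 27)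
     # rows_a ai be n (w * ai mod 81) (p * be mod 81) ((s + p * be) mod 81)"

definition table_a :: "int \<Rightarrow> int \<Rightarrow> table" where
  "table_a ai be = rows_a ai be 27 1 1 0"

definition table_b :: "int \<Rightarrow> table" where
  "table_b n = map (\<lambda>k. (1, 54 * ((k + n) div 27) mod 81, (k + n) mod 27)) [0..26]"

definition table_c :: "int \<Rightarrow> int \<Rightarrow> table" where
  "table_c al bi = map (\<lambda>k. (al, 54 * (k * bi mod 81 div 27) mod 81, k * bi mod 81 mod 27)) [0..26]"

text \<open>The ninth power of \<open>a\<close> turns out to be the same for all parameters.\<close>
definition table_a9 :: table where
  "table_a9 = map (\<lambda>k. (1 + 27 * (k mod 3), if k mod 3 = 0 then 9 else 63, k)) [0..26]"

lemma table_a9_pow: "table_pow table_a9 9 = map (\<lambda>k. (1, 0, k)) [0..26]"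
  by code_simp

text \<open>As \<open>al = 7 + 9 * w\<close>, the power \<open>a ^ al\<close> is assembled from
  \<open>a3\<close>, \<open>a3\<close>, \<open>a\<close> and \<open>a9 ^ w\<close>. The two
  definitions that follow pass computed tables on as arguments, in place of local bindings.
  Comparing \<open>a9\<close> with \<open>table_a9\<close> also settles that \<open>a ^ 81\<close>
  is the identity.\<close>

definition check_relations :: "int \<Rightarrow> nat \<Rightarrow> table \<Rightarrow> table \<Rightarrow> table \<Rightarrow> table \<Rightarrow> table \<Rightarrow> bool" where
  "check_relations be w a b c a3 a9 \<longleftrightarrow> table_ok a \<and> table_ok c \<and> lookup a 0 = (1, 1, 0)
     \<and> table_comp a b = table_comp (table_comp b a) c
     \<and> table_comp a c = table_comp c (table_comp (table_comp a3 (table_comp a3 a)) (table_pow a9 w))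
     \<and> table_comp c b = table_comp (table_b be) c
     \<and> a9 = table_a9"

definition check_powers :: "int \<Rightarrow> nat \<Rightarrow> table \<Rightarrow> table \<Rightarrow> table \<Rightarrow> bool" where
  "check_powers be w a c a3 \<longleftrightarrow> check_relations be w a (table_b 1) c a3 (table_pow a3 3)"

definition check_generators :: "int \<Rightarrow> nat \<Rightarrow> table \<Rightarrow> table \<Rightarrow> bool" where
  "check_generators be w a c \<longleftrightarrow> check_powers be w a c (table_pow a 3)"

definition check_tables :: "int \<times> int \<times> int \<times> int \<times> nat \<Rightarrow> bool" where
  "check_tables = (\<lambda>(al, ai, be, bi, w). al = 7 + 9 * int w \<and> 0 \<le> be
     \<and> check_generators be w (table_a ai be) (table_c al bi))"

text \<open>There are nine residues \<open>al\<close> modulo 81 that are 7 modulo 9, each with three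
  residues \<open>be\<close> that agree with it modulo 27. The 27 cases are spread over three
  lists.\<close>

definition parameters_0 :: "(int \<times> int \<times> int \<times> int \<times> nat) list" where
  "parameters_0 = [
    (7, 58, 7, 58, 0), (7, 58, 34, 31, 0), (7, 58, 61, 4, 0),
    (16, 76, 16, 76, 1), (16, 76, 43, 49, 1), (16, 76, 70, 22, 1),
    (25, 13, 25, 13, 2), (25, 13, 52, 67, 2), (25, 13, 79, 40, 2)]"

lemma check_parameters_0: "list_all check_tables parameters_0"
  unfolding parameters_0_def list.pred_inject by (intro conjI TrueI; code_simp)

definition parameters_1 :: "(int \<times> int \<times> int \<times> int \<times> nat) list" where
  "parameters_1 = [
    (34, 31, 34, 31, 3), (34, 31, 61, 4, 3), (34, 31, 7, 58, 3),
    (43, 49, 43, 49, 4), (43, 49, 70, 22, 4), (43, 49, 16, 76, 4),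
    (52, 67, 52, 67, 5), (52, 67, 79, 40, 5), (52, 67, 25, 13, 5)]"

lemma check_parameters_1: "list_all check_tables parameters_1"
  unfolding parameters_1_def list.pred_inject by (intro conjI TrueI; code_simp)

definition parameters_2 :: "(int \<times> int \<times> int \<times> int \<times> nat) list" where
  "parameters_2 = [
    (61, 4, 61, 4, 6), (61, 4, 7, 58, 6), (61, 4, 34, 31, 6),
    (70, 22, 70, 22, 7), (70, 22, 16, 76, 7), (70, 22, 43, 49, 7),
    (79, 40, 79, 40, 8), (79, 40, 25, 13, 8), (79, 40, 52, 67, 8)]"

lemma check_parameters_2: "list_all check_tables parameters_2"
  unfolding parameters_2_def list.pred_inject by (intro conjI TrueI; code_simp)

lemma parameters_complete:
  fixes r t :: int
  assumes "r mod 9 = 7" "r mod 27 = t mod 27" "0 \<le> r" "r < 81" "0 \<le> t" "t < 81"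
  shows "\<exists>ai bi w. (r, ai, t, bi, w) \<in> set (parameters_0 @ parameters_1 @ parameters_2)"
proof -
  have "r = 7 \<or> r = 16 \<or> r = 25 \<or> r = 34 \<or> r = 43 \<or> r = 52 \<or> r = 61 \<or> r = 70 \<or> r = 79"
    using assms(1,3,4) by presburger
  moreover have "t mod 9 = 7"
    using assms(1,2) mod_mod_cancel[of 9 27 r] mod_mod_cancel[of 9 27 t] by simp
  then have "t = 7 \<or> t = 16 \<or> t = 25 \<or> t = 34 \<or> t = 43 \<or> t = 52 \<or> t = 61 \<or> t = 70 \<or> t = 79"
    using assms(5,6) by presburger
  ultimately show ?thesis
    using assms(2) unfolding parameters_0_def parameters_1_def parameters_2_def by (elim disjE) simp_all
qed

lemma table_app_b:
  assumes "p \<in> grid" "0 \<le> n"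
  shows "table_app (table_b n) p = ((fst p + 54 * ((snd p + n) div 27)) mod 81, (snd p + n) mod 27)"
proof -
  obtain x k where p: "p = (x, k)" "0 \<le> k" "k < 27" using assms by (auto simp: grid_def)
  have "lookup (table_b n) k = (1, 54 * ((k + n) div 27) mod 81, (k + n) mod 27)"
    using p unfolding table_b_def by (subst lookup_nth) auto
  then show ?thesis using p by (simp add: table_app_def mod_add_right_eq)
qed

lemma table_b_ok: "table_ok (table_b n)"
  by (auto simp: table_ok_def table_b_def list_all_iff)

lemma table_b_funpow:
  assumes "p \<in> grid"
  shows "(table_app (table_b 1) ^^ n) p = table_app (table_b (int n)) p"
proof (induction n)
  case 0
  then show ?case using assms by (auto simp: table_app_b grid_def)
next
  case (Suc n)
  define k where "k = snd p + int n"
  have "table_app (table_b (int n)) p \<in> grid" by (rule table_app_closed[OF table_b_ok assms])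
  then have "(table_app (table_b 1) ^^ Suc n) p
      = (((fst p + 54 * (k div 27)) mod 81 + 54 * ((k mod 27 + 1) div 27)) mod 81, (k mod 27 + 1) mod 27)"
    using Suc assms by (simp add: table_app_b k_def)
  also have "\<dots> = ((fst p + 54 * (k div 27 + (k mod 27 + 1) div 27)) mod 81, (k + 1) mod 27)"
    by (simp add: mod_add_left_eq mod_simps algebra_simps)
  also have "k div 27 + (k mod 27 + 1) div 27 = (k mod 27 + 1 + k div 27 * 27) div 27"
    by (rule div_mult_self1[symmetric]) simp
  also have "k mod 27 + 1 + k div 27 * 27 = k + 1"
    using div_mult_mod_eq[of k 27] by (simp only: ac_simps)
  finally show ?case using assms by (simp add: table_app_b k_def algebra_simps)
qed

lemma table_word_model:
  assumes "check_tables (al, ai, be, bi, w)"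
  shows "word_model grid (table_app (table_a ai be)) (table_app (table_b 1)) (table_app (table_c al bi)) (nat al) (nat be)"
proof -
  define a c where "a = table_a ai be" and "c = table_c al bi"
  let ?f = "table_app a" and ?h = "table_app c" and ?g = "table_app (table_b 1)"
  have ck: "al = 7 + 9 * int w" "0 \<le> be" "table_ok a" "table_ok c"
    "table_comp a (table_b 1) = table_comp (table_comp (table_b 1) a) c"
    "table_comp a c = table_comp c (table_comp (table_comp (table_pow a 3) (table_comp (table_pow a 3) a))
       (table_pow (table_pow (table_pow a 3) 3) w))"
    "table_comp c (table_b 1) = table_comp (table_b be) c"
    "table_pow (table_pow a 3) 3 = table_a9"
    using assms unfolding check_tables_def check_generators_def check_powers_def check_relations_def
      a_def[symmetric] c_def[symmetric] prod.case by blast+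
  note ok = ck(3,4) table_b_ok table_pow_ok table_comp_ok
  note closed = table_app_closed[OF ck(3)] table_app_closed[OF ck(4)] table_app_closed[OF table_b_ok]
  have a3: "table_app (table_pow a 3) p = (?f ^^ 3) p" "(?f ^^ 3) p \<in> grid" if "p \<in> grid" for p
    using table_app_pow[OF ck(3) that, of 3] table_app_closed[OF table_pow_ok[OF ck(3)] that, of 3] by auto
  have pow3: "(table_app (table_pow a 3) ^^ n) p = (?f ^^ (3 * n)) p" if "p \<in> grid" for n p
  proof (induction n)
    case (Suc n)
    have "(?f ^^ (3 * n)) p \<in> grid"
      using table_app_closed[OF table_pow_ok[OF ck(3)] that] table_app_pow[OF ck(3) that] by metis
    then show ?case using Suc a3(1) by (simp add: funpow_add)
  qed simp
  have a9: "table_app table_a9 p = (?f ^^ 9) p" "(?f ^^ 9) p \<in> grid" if "p \<in> grid" for p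
    using table_app_pow[OF table_pow_ok[OF ck(3), of 3] that, of 3] pow3[OF that, of 3]
      table_app_closed[OF table_pow_ok[OF ck(3), of 9] that] table_app_pow[OF ck(3) that, of 9]
    unfolding ck(8) by auto
  have ok9: "table_ok table_a9" using table_pow_ok[OF table_pow_ok[OF ck(3)], of 3 3] unfolding ck(8) .
  have pow9: "table_app (table_pow table_a9 n) p = (?f ^^ (9 * n)) p" if "p \<in> grid" for n p
    unfolding table_app_pow[OF ok9 that]
  proof (induction n)
    case (Suc n)
    have "(?f ^^ (9 * n)) p \<in> grid"
      using table_app_closed[OF table_pow_ok[OF ck(3)] that] table_app_pow[OF ck(3) that] by metis
    then show ?case using Suc a9(1) by (simp add: funpow_add)
  qed simp
  show ?thesis unfolding a_def[symmetric] c_def[symmetric]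
  proof
    fix p assume p: "p \<in> grid"
    show "?f p \<in> grid" "?g p \<in> grid" using closed p by auto
    show "(?f ^^ 81) p = p"
      using pow9[OF p, of 9] table_app_id[OF p] unfolding table_a9_pow by simp
    show "(?g ^^ 81) p = p"
    proof -
      obtain x k where xk: "p = (x, k)" "0 \<le> x" "x < 81" "0 \<le> k" "k < 27" using p by (auto simp: grid_def)
      have "(k + 81) div 27 = 3" "(k + 81) mod 27 = k"
        using xk(4,5) div_mult_self1[of 27 k 3] mod_mult_self1[of k 3 27]
        by (simp_all add: div_pos_pos_trivial mod_pos_pos_trivial)
      moreover have "(x + 54 * 3) mod 81 = x"
        using xk(2,3) mod_mult_self1[of x 2 81] by (simp add: mod_pos_pos_trivial)
      ultimately show ?thesis unfolding table_b_funpow[OF p] using table_app_b[OF p, of 81] xk(1) by simp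
    qed
    show "?g (?f p) = ?h (?f (?g p))"
      using table_app_comp[OF ck(3) p] table_app_comp[OF table_comp_ok[OF table_b_ok ck(3)] p]
        table_app_comp[OF table_b_ok p] ck(5) by metis
    have "?g (?h p) = ?h (table_app (table_b be) p)"
      using table_app_comp[OF ck(4) p] table_app_comp[OF table_b_ok p] ck(7) by metis
    then show "?g (?h p) = ?h ((?g ^^ nat be) p)" using table_b_funpow[OF p, of "nat be"] ck(2) by simp
    have q: "?h p \<in> grid" using closed p by auto
    define q where "q = ?h p"
    have "?h (?f p) = table_app (table_comp a c) p" using table_app_comp[OF ck(3) p] by simp
    also have "\<dots> = table_app (table_pow table_a9 w) (table_app (table_comp (table_pow a 3) (table_comp (table_pow a 3) a)) q)"
      unfolding ck(6,8) q_def using p q ok by (simp add: table_app_comp)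
    also have "table_app (table_comp (table_pow a 3) (table_comp (table_pow a 3) a)) q = ?f ((?f ^^ 3) ((?f ^^ 3) q))"
      using q ok a3 unfolding q_def by (simp add: table_app_comp)
    also have "table_app (table_pow table_a9 w) \<dots> = (?f ^^ (9 * w)) (?f ((?f ^^ 3) ((?f ^^ 3) q)))"
      using q a3 closed unfolding q_def by (intro pow9) auto
    also have "\<dots> = (?f ^^ (9 * w + (1 + (3 + 3)))) q" by (simp only: funpow_add o_apply One_nat_def funpow.simps id_apply)
    also have "9 * w + (1 + (3 + 3)) = nat al" unfolding ck(1) by simp
    finally show "?h (?f p) = (?f ^^ nat al) (?h p)" unfolding q_def .
  qed
qed

text \<open>Row 0 of the table of \<open>a\<close> is the translation by 1 that keeps
  \<open>k = 0\<close>, so the orbit of \<open>(0, 0)\<close> is a cycle of length 81. The relations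
  alone make this an action; the tables are never identified with actual cosets.\<close>

theorem word_pow_A_trivial_dvd:
  assumes "\<alpha> mod 9 = 7" "\<alpha> mod 27 = \<beta> mod 27" "word_eq (G_rels \<alpha> \<beta>) (pow_word wA (int n)) []"
  shows "81 dvd n"
proof -
  have "(\<alpha> mod 81) mod 9 = 7" "(\<alpha> mod 81) mod 27 = (\<beta> mod 81) mod 27"
    using assms(1,2) by (simp_all add: mod_mod_cancel)
  then have "\<exists>ai bi w. (\<alpha> mod 81, ai, \<beta> mod 81, bi, w) \<in> set (parameters_0 @ parameters_1 @ parameters_2)"
    by (rule parameters_complete) simp_all
  then obtain ai bi w where mem: "(\<alpha> mod 81, ai, \<beta> mod 81, bi, w) \<in> set (parameters_0 @ parameters_1 @ parameters_2)"
    by blast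
  have "list_all check_tables (parameters_0 @ parameters_1 @ parameters_2)"
    by (simp only: list_all_append check_parameters_0 check_parameters_1 check_parameters_2)
  then have ck: "check_tables (\<alpha> mod 81, ai, \<beta> mod 81, bi, w)"
    using mem unfolding list_all_iff by blast
  interpret word_model grid "table_app (table_a ai (\<beta> mod 81))" "table_app (table_b 1)"
    "table_app (table_c (\<alpha> mod 81) bi)" "nat (\<alpha> mod 81)" "nat (\<beta> mod 81)"
    by (rule table_word_model[OF ck])
  have a0: "lookup (table_a ai (\<beta> mod 81)) 0 = (1, 1, 0)"
    using ck unfolding check_tables_def check_generators_def check_powers_def check_relations_def prod.case by blast
  have pow: "(table_app (table_a ai (\<beta> mod 81)) ^^ m) (0, 0) = (int m mod 81, 0)" for m
    by (induction m) (simp_all add: table_app_def a0 mod_simps add.commute)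
  have p: "(0, 0) \<in> grid" by (simp add: grid_def)
  have "act (pow_word wA (int n)) (0, 0) = act [] (0, 0)" by (rule act_word_eq[OF assms(3)]) (auto simp: p)
  then have "(int (nat (int n mod 81)) mod 81, 0) = (0 :: int, 0 :: int)"
    using act_pow_word[OF p, of False "int n"] unfolding wA_def by (simp add: pow)
  then have "81 dvd int n" by (simp add: dvd_eq_mod_eq_0)
  then show ?thesis by presburger
qed

section \<open>Presented groups\<close>

lemma word_eq_append:
  assumes "word_eq R u u'" "word_eq R v v'" shows "word_eq R (u @ v) (u' @ v')"
  using word_eq.cong[OF assms(1), of "[]" v] word_eq.cong[OF assms(2), of u' "[]"] word_eq.trans by fastforce

lemma word_class_eq_iff: "word_class R u = word_class R v \<longleftrightarrow> word_eq R u v"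
  unfolding word_class_def using word_eq.refl word_eq.sym word_eq.trans by blast

lemma pres_mult_word_class: "pres_mult R (word_class R u) (word_class R v) = word_class R (u @ v)"
proof -
  have "word_eq R w (SOME x. x \<in> word_class R w)" for w
    using someI[of "\<lambda>x. x \<in> word_class R w" w] by (simp add: word_class_def word_eq.refl)
  then show ?thesis unfolding pres_mult_def word_class_eq_iff
    by (intro word_eq.sym[OF word_eq_append])
qed

lemma word_eq_inv_word: "word_eq R (w @ inv_word w) []" "word_eq R (inv_word w @ w) []"
proof -
  show *: "word_eq R (w @ inv_word w) []" for w
  proof (induction w)
    case (Cons l w)
    obtain x b where l: "l = (x, b)" by (cases l)
    have "word_eq R ([l] @ (w @ inv_word w) @ [(x, \<not> b)]) ([l] @ [] @ [(x, \<not> b)])"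
      by (rule word_eq.cong[OF Cons])
    moreover have "word_eq R ([l] @ [] @ [(x, \<not> b)]) []" using word_eq.cancel[of R x b] l by simp
    moreover have "(l # w) @ inv_word (l # w) = [l] @ (w @ inv_word w) @ [(x, \<not> b)]"
      by (simp add: inv_word_def l)
    ultimately show ?case using word_eq.trans by metis
  qed (simp add: inv_word_def word_eq.refl)
  have "inv_word (inv_word w) = w" by (simp add: inv_word_def rev_map comp_def case_prod_beta)
  then show "word_eq R (inv_word w @ w) []" using *[of "inv_word w"] by simp
qed

lemma pres_group_simps:
  "carrier (pres_group R) = range (word_class R)"
  "word_class R u \<otimes>\<^bsub>pres_group R\<^esub> word_class R v = word_class R (u @ v)"
  "\<one>\<^bsub>pres_group R\<^esub> = word_class R []"
  by (simp_all add: pres_group_def pres_mult_word_class)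

lemma group_pres_group: "group (pres_group R)"
proof (rule groupI)
  fix x assume "x \<in> carrier (pres_group R)"
  then obtain w where w: "x = word_class R w" by (auto simp: pres_group_simps)
  have "word_class R (inv_word w) \<otimes>\<^bsub>pres_group R\<^esub> x = \<one>\<^bsub>pres_group R\<^esub>"
    unfolding w pres_group_simps word_class_eq_iff by (rule word_eq_inv_word)
  then show "\<exists>y\<in>carrier (pres_group R). y \<otimes>\<^bsub>pres_group R\<^esub> x = \<one>\<^bsub>pres_group R\<^esub>"
    by (auto simp: pres_group_simps(1))
qed (auto simp: pres_group_simps)

lemma word_class_closed: "word_class R w \<in> carrier (pres_group R)"
  by (simp add: pres_group_simps)

lemma word_class_inv: "inv\<^bsub>pres_group R\<^esub> word_class R w = word_class R (inv_word w)"
proof (rule group.inv_equality[OF group_pres_group _ word_class_closed word_class_closed])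
  show "word_class R (inv_word w) \<otimes>\<^bsub>pres_group R\<^esub> word_class R w = \<one>\<^bsub>pres_group R\<^esub>"
    unfolding pres_group_simps word_class_eq_iff by (rule word_eq_inv_word)
qed

lemma word_class_nat_pow: "word_class R w [^]\<^bsub>pres_group R\<^esub> n = word_class R (concat (replicate n w))"
proof (induction n)
  case (Suc n)
  have "concat (replicate n w) @ w = w @ concat (replicate n w)" by (induction n) auto
  then show ?case by (simp add: Suc pres_group_simps)
qed (simp add: pres_group_simps)

lemma word_class_int_pow: "word_class R w [^]\<^bsub>pres_group R\<^esub> z = word_class R (pow_word w z)"
proof (cases "0 \<le> z")
  case True
  then show ?thesis by (simp add: int_pow_def2 word_class_nat_pow pow_word_def)
next
  case False
  have "word_class R w [^]\<^bsub>pres_group R\<^esub> z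
      = inv\<^bsub>pres_group R\<^esub> (word_class R w [^]\<^bsub>pres_group R\<^esub> nat (- z))"
    using False by (simp only: int_pow_def2 not_le if_True)
  also have "\<dots> = (inv\<^bsub>pres_group R\<^esub> word_class R w) [^]\<^bsub>pres_group R\<^esub> nat (- z)"
    by (rule group.nat_pow_inv[OF group_pres_group word_class_closed, symmetric])
  finally show ?thesis using False by (simp only: word_class_inv word_class_nat_pow pow_word_def if_False)
qed

lemma macdonald_Gab: "macdonald (Gab \<alpha> \<beta>) (genA \<alpha> \<beta>) (genB \<alpha> \<beta>) (genC \<alpha> \<beta>) \<alpha> \<beta>"
proof -
  let ?R = "G_rels \<alpha> \<beta>"
  interpret group "pres_group ?R" by (rule group_pres_group)
  let ?A = "word_class ?R wA" and ?B = "word_class ?R wB" and ?C = "word_class ?R (comm_word wA wB)"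
  have C: "?C = inv\<^bsub>pres_group ?R\<^esub> ?A \<otimes>\<^bsub>pres_group ?R\<^esub> inv\<^bsub>pres_group ?R\<^esub> ?B \<otimes>\<^bsub>pres_group ?R\<^esub> ?A \<otimes>\<^bsub>pres_group ?R\<^esub> ?B"
    by (simp add: word_class_inv pres_group_simps comm_word_def)
  have C': "word_class ?R (comm_word wB wA) = inv\<^bsub>pres_group ?R\<^esub> ?C"
    unfolding C by (simp add: word_class_closed inv_mult_group m_assoc)
      (simp add: word_class_inv pres_group_simps comm_word_def)
  have "word_class ?R (conj_word wA (comm_word wA wB)) = word_class ?R (pow_word wA \<alpha>)"
    "word_class ?R (conj_word wB (comm_word wB wA)) = word_class ?R (pow_word wB \<beta>)"
    unfolding word_class_eq_iff by (auto intro: word_eq.rel simp: G_rels_def)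
  then have 1: "inv\<^bsub>pres_group ?R\<^esub> ?C \<otimes>\<^bsub>pres_group ?R\<^esub> ?A \<otimes>\<^bsub>pres_group ?R\<^esub> ?C = ?A [^]\<^bsub>pres_group ?R\<^esub> \<alpha>"
    and 2: "?C \<otimes>\<^bsub>pres_group ?R\<^esub> ?B \<otimes>\<^bsub>pres_group ?R\<^esub> inv\<^bsub>pres_group ?R\<^esub> ?C = ?B [^]\<^bsub>pres_group ?R\<^esub> \<beta>"
  proof -
    assume a: "word_class ?R (conj_word wA (comm_word wA wB)) = word_class ?R (pow_word wA \<alpha>)"
      "word_class ?R (conj_word wB (comm_word wB wA)) = word_class ?R (pow_word wB \<beta>)"
    have cj: "word_class ?R (conj_word u v) = inv\<^bsub>pres_group ?R\<^esub> (word_class ?R v) \<otimes>\<^bsub>pres_group ?R\<^esub> word_class ?R u \<otimes>\<^bsub>pres_group ?R\<^esub> word_class ?R v" for u v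
      by (simp add: conj_word_def word_class_inv pres_group_simps)
    show "inv\<^bsub>pres_group ?R\<^esub> ?C \<otimes>\<^bsub>pres_group ?R\<^esub> ?A \<otimes>\<^bsub>pres_group ?R\<^esub> ?C = ?A [^]\<^bsub>pres_group ?R\<^esub> \<alpha>"
      using a(1) unfolding cj word_class_int_pow .
    show "?C \<otimes>\<^bsub>pres_group ?R\<^esub> ?B \<otimes>\<^bsub>pres_group ?R\<^esub> inv\<^bsub>pres_group ?R\<^esub> ?C = ?B [^]\<^bsub>pres_group ?R\<^esub> \<beta>"
      using a(2) unfolding cj word_class_int_pow C' by (simp add: word_class_closed)
  qed
  show ?thesis
    unfolding Gab_def genA_def genB_def genC_def
  proof (intro macdonald.intro group_pres_group macdonald_axioms.intro word_class_closed)
    show "?A \<otimes>\<^bsub>pres_group ?R\<^esub> ?B = ?B \<otimes>\<^bsub>pres_group ?R\<^esub> ?A \<otimes>\<^bsub>pres_group ?R\<^esub> ?C"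
      unfolding C by (simp add: word_class_closed m_assoc mult_inv_mult)
    show "?A \<otimes>\<^bsub>pres_group ?R\<^esub> ?C = ?C \<otimes>\<^bsub>pres_group ?R\<^esub> ?A [^]\<^bsub>pres_group ?R\<^esub> \<alpha>"
      unfolding 1[symmetric] by (simp add: word_class_closed m_assoc mult_inv_mult)
    show "?C \<otimes>\<^bsub>pres_group ?R\<^esub> ?B = ?B [^]\<^bsub>pres_group ?R\<^esub> \<beta> \<otimes>\<^bsub>pres_group ?R\<^esub> ?C"
      unfolding 2[symmetric] by (simp add: word_class_closed m_assoc)
  qed
qed

lemma generate_Gab: "carrier (Gab \<alpha> \<beta>) = generate (Gab \<alpha> \<beta>) {genA \<alpha> \<beta>, genB \<alpha> \<beta>}"
proof
  let ?R = "G_rels \<alpha> \<beta>"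
  interpret group "pres_group ?R" by (rule group_pres_group)
  let ?S = "generate (pres_group ?R) {word_class ?R wA, word_class ?R wB}"
  have sub: "subgroup ?S (pres_group ?R)" by (rule generate_is_subgroup) (auto simp: word_class_closed)
  have letter: "word_class ?R [(x, e)] \<in> ?S" for x e
  proof -
    have "word_class ?R [(x, False)] \<in> ?S"
      by (cases x) (auto simp: wA_def wB_def intro: generate.incl)
    moreover from this have "inv\<^bsub>pres_group ?R\<^esub> word_class ?R [(x, False)] \<in> ?S"
      by (rule subgroup.m_inv_closed[OF sub])
    ultimately show ?thesis by (cases e) (auto simp: word_class_inv inv_word_def)
  qed
  have "word_class ?R w \<in> ?S" for w
  proof (induction w)
    case Nil
    then show ?case using subgroup.one_closed[OF sub] by (simp add: pres_group_simps)
  next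
    case (Cons l w)
    obtain x e where l: "l = (x, e)" by (cases l)
    have "word_class ?R (l # w) = word_class ?R [(x, e)] \<otimes>\<^bsub>pres_group ?R\<^esub> word_class ?R w"
      by (simp add: pres_group_simps l)
    then show ?case using subgroup.m_closed[OF sub letter Cons] by simp
  qed
  then show "carrier (Gab \<alpha> \<beta>) \<subseteq> generate (Gab \<alpha> \<beta>) {genA \<alpha> \<beta>, genB \<alpha> \<beta>}"
    unfolding Gab_def genA_def genB_def pres_group_simps(1) by blast
  show "generate (Gab \<alpha> \<beta>) {genA \<alpha> \<beta>, genB \<alpha> \<beta>} \<subseteq> carrier (Gab \<alpha> \<beta>)"
    unfolding Gab_def genA_def genB_def using subgroup.subset[OF sub] .
qed

section \<open>Sylow decomposition\<close>

lemma (in group) ord_subgroup: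
  "group.ord (G\<lparr>carrier := H\<rparr>) x = ord x" if "subgroup H G"
  unfolding group.ord_def[OF subgroup_imp_group[OF that]] ord_def
  by (simp add: nat_pow_consistent[symmetric])

lemma (in group) ord_dvd_card_subgroup:
  assumes "subgroup H G" "x \<in> H" shows "ord x dvd card H"
  using group.ord_dvd_group_order[OF subgroup_imp_group[OF assms(1)], of x] assms(2)
  by (simp add: ord_subgroup[OF assms(1)] order_def)

text \<open>\<open>sylow_part\<close> and \<open>pprime_part\<close> are given by orders of
  elements; a direct product of a 3-group and a group of order prime to 3 identifies them with its
  two factors.\<close>

locale coprime_decomposition = group G for G (structure) +
  fixes H1 H2 :: "'a set" and N :: nat
  assumes normal_1: "H1 \<lhd> G" and normal_2: "H2 \<lhd> G"
    and card_1: "card H1 dvd 3 ^ N" and card_2: "coprime (card H2) 3"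
    and product: "carrier G = H1 <#> H2"
begin

sublocale N1: normal H1 G by (rule normal_1)
sublocale N2: normal H2 G by (rule normal_2)

lemma inter: "x \<in> H1 \<Longrightarrow> x \<in> H2 \<Longrightarrow> x = \<one>"
proof -
  assume x: "x \<in> H1" "x \<in> H2"
  have "ord x dvd 3 ^ N" "ord x dvd card H2"
    using ord_dvd_card_subgroup[OF N1.is_subgroup x(1)] ord_dvd_card_subgroup[OF N2.is_subgroup x(2)] card_1
      dvd_trans by blast+
  moreover have "coprime (3 ^ N) (card H2)" using card_2 by (simp add: coprime_commute)
  ultimately have "ord x = 1" using coprime_common_divisor_nat by blast
  then show "x = \<one>" using ord_eq_1[of x] x by simp
qed

lemma commute:
  assumes "x \<in> H1" "y \<in> H2" shows "x \<otimes> y = y \<otimes> x"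
proof -
  have c: "x \<in> carrier G" "y \<in> carrier G" using assms by auto
  have "group_comm G x y \<in> H1" using group_comm_normal_mem[OF normal_1 assms(1) c(2)] .
  moreover have "group_comm G x y = inv x \<otimes> inv y \<otimes> inv (inv x) \<otimes> y"
    using c by (simp add: group_comm_def)
  then have "group_comm G x y \<in> H2"
    using N2.inv_op_closed2[of "inv x" "inv y"] assms c by (simp add: N2.m_closed)
  ultimately have "group_comm G x y = \<one>" using inter by blast
  then show ?thesis using group_comm_eqD[OF c] c by simp
qed

lemma unique:
  assumes "x \<in> H1" "x' \<in> H1" "y \<in> H2" "y' \<in> H2" "x \<otimes> y = x' \<otimes> y'"
  shows "x = x'" "y = y'"
proof -
  have c: "x \<in> carrier G" "x' \<in> carrier G" "y \<in> carrier G" "y' \<in> carrier G" using assms by auto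
  have "inv x' \<otimes> x = inv x' \<otimes> (x \<otimes> y) \<otimes> inv y" using c by (simp add: m_assoc)
  also have "\<dots> = y' \<otimes> inv y" unfolding assms(5) using c by (simp add: m_assoc[symmetric])
  finally have eq: "inv x' \<otimes> x = y' \<otimes> inv y" .
  have "inv x' \<otimes> x \<in> H1" using assms(1,2) by simp
  moreover have "inv x' \<otimes> x \<in> H2" unfolding eq using assms(3,4) by simp
  ultimately have "inv x' \<otimes> x = \<one>" by (rule inter)
  then have "x' \<otimes> (inv x' \<otimes> x) = x'" using c by simp
  then show "x = x'" using mult_inv_mult[of x' x] c by simp
  then show "y = y'" using assms(5) c by simp
qed

lemma decompose:
  assumes "g \<in> carrier G" obtains x y where "x \<in> H1" "y \<in> H2" "g = x \<otimes> y"
  using assms unfolding product by (rule set_mult_memE)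

lemma pow_decompose:
  assumes "x \<in> H1" "y \<in> H2" "(x \<otimes> y) [^] (n::nat) = \<one>"
  shows "x [^] n = \<one>" "y [^] n = \<one>"
proof -
  have "x [^] n \<otimes> y [^] n = \<one> \<otimes> \<one>"
    using assms commute[OF assms(1,2)] by (simp add: pow_mult_distrib[symmetric])
  moreover have "x [^] n \<in> H1" "y [^] n \<in> H2"
    using subgroup_int_pow_closed[OF N1.is_subgroup assms(1), of "int n"]
      subgroup_int_pow_closed[OF N2.is_subgroup assms(2), of "int n"] by (simp_all add: int_pow_int)
  ultimately show "x [^] n = \<one>" "y [^] n = \<one>"
    using unique[of "x [^] n" \<one> "y [^] n" \<one>] by auto
qed

lemma ord_1: "x \<in> H1 \<Longrightarrow> ord x dvd 3 ^ N"
  using ord_dvd_card_subgroup[OF N1.is_subgroup] card_1 dvd_trans by blast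

lemma ord_2: "y \<in> H2 \<Longrightarrow> coprime (ord y) 3"
  using ord_dvd_card_subgroup[OF N2.is_subgroup, of y] card_2 coprime_divisors[OF _ dvd_refl] by blast

lemma sylow_part_eq: "sylow_part G 3 = G\<lparr>carrier := H1\<rparr>"
proof -
  have "{g \<in> carrier G. \<exists>k. ord g = 3 ^ k} = H1"
  proof
    show "H1 \<subseteq> {g \<in> carrier G. \<exists>k. ord g = 3 ^ k}"
    proof
      fix x assume x: "x \<in> H1"
      obtain k where "ord x = 3 ^ k" using ord_1[OF x] divides_primepow_nat[of 3 "ord x" N] by auto
      then show "x \<in> {g \<in> carrier G. \<exists>k. ord g = 3 ^ k}" using x by auto
    qed
    show "{g \<in> carrier G. \<exists>k. ord g = 3 ^ k} \<subseteq> H1"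
    proof
      fix g assume "g \<in> {g \<in> carrier G. \<exists>k. ord g = 3 ^ k}"
      then obtain k where g: "g \<in> carrier G" "ord g = 3 ^ k" by blast
      obtain x y where xy: "x \<in> H1" "y \<in> H2" "g = x \<otimes> y" by (rule decompose[OF g(1)])
      have "g [^] ((3::nat) ^ k) = \<one>" unfolding g(2)[symmetric] by (rule pow_ord_eq_1[OF g(1)])
      then have "y [^] ((3::nat) ^ k) = \<one>" unfolding xy(3) by (rule pow_decompose(2)[OF xy(1,2)])
      then have "ord y dvd 3 ^ k" using xy(2) by (simp add: pow_eq_id)
      moreover have "coprime (ord y) (3 ^ k)" using ord_2[OF xy(2)] by simp
      ultimately have "ord y = 1" using coprime_common_divisor_nat[OF _ dvd_refl] by blast
      then have "y = \<one>" using ord_eq_1[of y] xy(2) by simp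
      then show "g \<in> H1" using xy by simp
    qed
  qed
  then show ?thesis by (simp add: sylow_part_def)
qed

lemma pprime_part_eq: "pprime_part G 3 = H2"
proof
  show "H2 \<subseteq> pprime_part G 3" using ord_2 by (auto simp: pprime_part_def)
  show "pprime_part G 3 \<subseteq> H2"
  proof
    fix g assume "g \<in> pprime_part G 3"
    then have g: "g \<in> carrier G" "coprime (ord g) 3" by (auto simp: pprime_part_def)
    obtain x y where xy: "x \<in> H1" "y \<in> H2" "g = x \<otimes> y" by (rule decompose[OF g(1)])
    define n where "n = ord g"
    have "g [^] n = \<one>" unfolding n_def by (rule pow_ord_eq_1[OF g(1)])
    then have "x [^] n = \<one>" unfolding xy(3) by (rule pow_decompose(1)[OF xy(1,2)])
    then have "x [^] ord g = \<one>" unfolding n_def .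
    then have "ord x dvd ord g" using xy(1) by (simp add: pow_eq_id)
    moreover have "coprime (ord g) (3 ^ N)" using g(2) by simp
    ultimately have "ord x = 1" using ord_1[OF xy(1)] coprime_common_divisor_nat by blast
    then have "x = \<one>" using ord_eq_1[of x] xy(1) by simp
    then show "g \<in> H2" using xy by simp
  qed
qed

lemma sylow_proj_eq:
  assumes "x \<in> H1" "y \<in> H2" shows "sylow_proj G 3 (x \<otimes> y) = x"
  unfolding sylow_proj_def sylow_part_eq pprime_part_eq
proof (rule the_equality)
  show "x \<in> carrier (G\<lparr>carrier := H1\<rparr>) \<and> (\<exists>y'\<in>H2. x \<otimes> y = x \<otimes> y')" using assms by auto
  fix x' assume "x' \<in> carrier (G\<lparr>carrier := H1\<rparr>) \<and> (\<exists>y'\<in>H2. x \<otimes> y = x' \<otimes> y')"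
  then show "x' = x" using unique(1)[OF assms(1) _ assms(2)] by auto
qed

end


section \<open>From the presented group to its 3-part\<close>

lemma cong_one_imp_int_dvd:
  assumes "[k = 1] (mod (m::nat))" shows "int m dvd int k - 1"
proof -
  have "[int k = int 1] (mod int m)" unfolding cong_int_iff by (rule assms)
  then show ?thesis by (simp add: cong_iff_dvd_diff)
qed

context macdonald
begin

text \<open>Adding multiples of 27 times the orders preserves the relations and the residues modulo
  27. Positive exponents make the key relation available at every index, as
  \<open>prime_dvd_ord_A\<close> and \<open>good_index\<close> require.\<close>

lemma positive_exponents:
  assumes "ord A > 0" "ord B > 0"
  obtains \<alpha>' \<beta>' where "\<alpha>' > 0" "\<beta>' > 0" "27 dvd \<alpha>' - \<alpha>" "27 dvd \<beta>' - \<beta>"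
    "macdonald G A B C \<alpha>' \<beta>'"
proof
  have pos: "z + 27 * int n * (\<bar>z\<bar> + 1) > 0" if "n > 0" for z :: int and n
  proof -
    define q where "q = 27 * int n * (\<bar>z\<bar> + 1)"
    have "1 * (\<bar>z\<bar> + 1) \<le> q" unfolding q_def using that by (intro mult_right_mono) auto
    then show ?thesis unfolding q_def[symmetric] by (smt (verit))
  qed
  show "\<alpha> + 27 * int (ord A) * (\<bar>\<alpha>\<bar> + 1) > 0" "\<beta> + 27 * int (ord B) * (\<bar>\<beta>\<bar> + 1) > 0"
    using assms by (auto intro: pos)
  show "macdonald G A B C (\<alpha> + 27 * int (ord A) * (\<bar>\<alpha>\<bar> + 1)) (\<beta> + 27 * int (ord B) * (\<bar>\<beta>\<bar> + 1))"
    by (rule change_exponents) auto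
qed (auto simp: mult.assoc)

lemma pow_split:
  assumes "x \<in> carrier G" "int (ord x) dvd int (k1 + k2) - 1"
  shows "x = x [^] (k1::nat) \<otimes> x [^] (k2::nat)"
proof -
  have "x [^] (1::int) = x [^] (int (k1 + k2))" using int_pow_eq[OF assms(1)] assms(2) by blast
  then have "x = x [^] (k1 + k2)" unfolding int_pow_int using assms(1) by simp
  then show ?thesis by (simp only: nat_pow_mult[OF assms(1)])
qed

lemma sylow_decomposition:
  assumes gen: "carrier G = generate G {A, B}" and "\<bar>\<alpha>\<bar> \<ge> 2" "\<bar>\<beta>\<bar> \<ge> 2"
  obtains H1 H2 N s k1 k2 \<alpha>' \<beta>' where "coprime_decomposition G H1 H2 N"
    "A [^] (k1::nat) \<in> H1" "B [^] k1 \<in> H1" "C [^] k1 \<in> H1"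
    "A [^] (k2::nat) \<in> H2" "B [^] k2 \<in> H2" "C [^] k2 \<in> H2"
    "A = A [^] k1 \<otimes> A [^] k2" "B = B [^] k1 \<otimes> B [^] k2" "C = C [^] k1 \<otimes> C [^] k2"
    "(A [^] k1) [^] ((3::nat) ^ s) = \<one>" "(B [^] k1) [^] ((3::nat) ^ s) = \<one>"
    "\<alpha>' > 0" "\<beta>' > 0" "27 dvd \<alpha>' - \<alpha>" "27 dvd \<beta>' - \<beta>" "macdonald G A B C \<alpha>' \<beta>'"
    "3 dvd ord A \<longrightarrow> \<not> 3 dvd k1"
proof -
  have oA: "ord A > 0" by (rule ord_A_pos) fact
  have oB: "ord B > 0" by (rule macdonald.ord_A_pos[OF swap]) fact
  obtain \<alpha>' \<beta>' where pos: "\<alpha>' > 0" "\<beta>' > 0" "27 dvd \<alpha>' - \<alpha>" "27 dvd \<beta>' - \<beta>"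
    and m: "macdonald G A B C \<alpha>' \<beta>'" by (rule positive_exponents[OF oA oB])
  have prA: "int p dvd \<alpha>' - 1" if "Factorial_Ring.prime p" "p dvd ord A" for p
    by (rule macdonald.prime_dvd_ord_A[OF m pos(1,2) oA that])
  have prB: "int p dvd \<beta>' - 1" if "Factorial_Ring.prime p" "p dvd ord B" for p
    by (rule macdonald.prime_dvd_ord_A[OF macdonald.swap[OF m] pos(2,1) oB that])
  define n where "n = ord A * ord B"
  have "n \<noteq> 0" using oA oB by (simp add: n_def)
  then obtain m' where m': "n = 3 ^ multiplicity 3 n * m'" "\<not> 3 dvd m'"
    using multiplicity_decompose'[of n "3::nat"] by auto
  define s where "s = multiplicity 3 n"
  have n: "n = 3 ^ s * m'" using m'(1) by (simp add: s_def)
  have cop3: "coprime m' 3" using m'(2) prime_imp_coprime[of "3::nat" m'] by (simp add: coprime_commute)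
  then have cop: "coprime (3 ^ s) m'" by (simp add: coprime_commute)
  \<comment> \<open>\<open>k1\<close> and \<open>k2\<close> are the complementary idempotents modulo
    \<open>n\<close>: for \<open>x\<close> of order dividing \<open>n\<close>, \<open>x ^ k1\<close>
    is its 3-part and \<open>x ^ k2\<close> its 3'-part.\<close>
  obtain k1 where k1: "[k1 = 1] (mod 3 ^ s)" "[k1 = 0] (mod m')"
    using binary_chinese_remainder_nat[OF cop] by blast
  obtain k2 where k2: "[k2 = 0] (mod 3 ^ s)" "[k2 = 1] (mod m')"
    using binary_chinese_remainder_nat[OF cop] by blast
  have k1': "int (3 ^ s) dvd int k1 - 1" "m' dvd k1"
    by (rule cong_one_imp_int_dvd[OF k1(1)], use k1(2) in \<open>simp add: cong_0_iff\<close>)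
  have k2': "int m' dvd int k2 - 1" "3 ^ s dvd k2"
    by (rule cong_one_imp_int_dvd[OF k2(2)], use k2(1) in \<open>simp add: cong_0_iff\<close>)
  have dA: "ord A dvd n" and dB: "ord B dvd n" by (simp_all add: n_def)
  have dn: "ord A dvd 3 ^ s * m'" "ord B dvd 3 ^ s * m'" "ord A dvd m' * 3 ^ s" "ord B dvd m' * 3 ^ s"
    using dA dB unfolding n by (simp_all only: mult.commute)
  have s1: "macdonald_split G A B C \<alpha>' \<beta>' (3 ^ s) m' k1"
    by (intro macdonald_split.intro m macdonald_split_axioms.intro gen oA oB dn prA prB k1'; assumption)
  have s2: "macdonald_split G A B C \<alpha>' \<beta>' m' (3 ^ s) k2"
    by (intro macdonald_split.intro m macdonald_split_axioms.intro gen oA oB dn prA prB k2'; assumption)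
  interpret s1: macdonald_split G A B C \<alpha>' \<beta>' "3 ^ s" m' k1 by (rule s1)
  interpret s2: macdonald_split G A B C \<alpha>' \<beta>' m' "3 ^ s" k2 by (rule s2)
  have "[k1 + k2 = 1 + 0] (mod 3 ^ s)" "[k1 + k2 = 0 + 1] (mod m')"
    by (rule cong_add[OF k1(1) k2(1)], rule cong_add[OF k1(2) k2(2)])
  then have "[k1 + k2 = 1] (mod n)" unfolding n using coprime_cong_mult_nat[OF _ _ cop] by simp
  then have kk: "int n dvd int (k1 + k2) - 1" by (rule cong_one_imp_int_dvd)
  have ordk: "int (ord x) dvd int (k1 + k2) - 1" if "ord x dvd n" for x
    using kk that by (meson dvd_trans int_dvd_int_iff)
  have dC: "ord C dvd n" using s1.ord_C_dvd dA dvd_trans by blast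
  have eqA: "A = A [^] k1 \<otimes> A [^] k2" by (rule pow_split[OF A_closed ordk[OF dA]])
  have eqB: "B = B [^] k1 \<otimes> B [^] k2" by (rule pow_split[OF B_closed ordk[OF dB]])
  have eqC: "C = C [^] k1 \<otimes> C [^] k2" by (rule pow_split[OF C_closed ordk[OF dC]])
  have prod: "subgroup (s1.PS <#> s2.PS) G"
  proof (rule subgroup_set_mult[OF s1.subgroup_PS s2.subgroup_PS])
    fix k h assume k: "k \<in> s2.PS" and h: "h \<in> s1.PS"
    have c: "k \<in> carrier G" "h \<in> carrier G" using s2.PS_carrier[OF k] s1.PS_carrier[OF h] by auto
    have "k \<otimes> h \<otimes> inv k \<in> s1.PS" using normal.inv_op_closed2[OF s1.PS_normal c(1) h] .
    moreover have "k \<otimes> h = (k \<otimes> h \<otimes> inv k) \<otimes> k" using c by (simp add: m_assoc)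
    ultimately show "k \<otimes> h \<in> s1.PS <#> s2.PS" using k set_mult_memI by metis
  qed
  have carr: "carrier G = s1.PS <#> s2.PS"
  proof
    have "A \<in> s1.PS <#> s2.PS" "B \<in> s1.PS <#> s2.PS"
      using set_mult_memI[OF s1.A_pow_mem s2.A_pow_mem] set_mult_memI[OF s1.B_pow_mem s2.B_pow_mem] eqA eqB by auto
    then have "generate G {A, B} \<subseteq> s1.PS <#> s2.PS" by (intro generate_subgroup_incl[OF _ prod]) auto
    then show "carrier G \<subseteq> s1.PS <#> s2.PS" using gen by simp
    show "s1.PS <#> s2.PS \<subseteq> carrier G" using subgroup.subset[OF prod] .
  qed
  have cd: "coprime_decomposition G s1.PS s2.PS (s * 3)"
  proof (intro coprime_decomposition.intro coprime_decomposition_axioms.intro is_group s1.PS_normal s2.PS_normal carr)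
    show "card s1.PS dvd 3 ^ (s * 3)" using s1.card_PS_dvd by (simp add: power_mult)
    have "coprime (m' ^ 3) 3" using cop3 by simp
    then show "coprime (card s2.PS) 3" using s2.card_PS_dvd coprime_divisors[OF _ dvd_refl] by blast
  qed
  have pow: "(x [^] k1) [^] ((3::nat) ^ s) = \<one>" if "x \<in> carrier G" "ord x dvd n" for x
  proof -
    have "n dvd k1 * 3 ^ s" unfolding n using k1'(2) by (simp add: mult.commute mult_dvd_mono)
    then have "ord x dvd k1 * 3 ^ s" using that(2) dvd_trans by blast
    then show ?thesis using that(1) by (simp add: nat_pow_pow pow_eq_id)
  qed
  \<comment> \<open>This later carries the nontriviality of a power of \<open>A\<close> over to its
    3-part.\<close>
  have not3: "3 dvd ord A \<longrightarrow> \<not> 3 dvd k1"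
  proof (intro impI notI)
    assume "3 dvd ord A" and 3: "3 dvd k1"
    then have "3 dvd n" using dA dvd_trans by blast
    then have "s \<noteq> 0" using m'(2) n by (cases s) auto
    then have "(3::int) dvd int (3 ^ s)" by (simp add: dvd_power)
    then have "(3::int) dvd int k1 - 1" using k1'(1) dvd_trans by blast
    then show False using 3 by presburger
  qed
  show thesis
    by (rule that[OF cd s1.A_pow_mem s1.B_pow_mem s1.C_pow_mem s2.A_pow_mem s2.B_pow_mem s2.C_pow_mem
      eqA eqB eqC pow[OF A_closed dA] pow[OF B_closed dB] pos m not3])
qed

end

text \<open>Factorizations over \<open>H1\<close> and \<open>H2\<close> are unique, so each relation
  holds in the first factor by itself. For generation, the subgroup generated by \<open>a\<close>
  and \<open>b\<close>, multiplied by \<open>H2\<close>, contains \<open>A\<close> and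
  \<open>B\<close> and hence everything.\<close>

lemma (in coprime_decomposition) macdonald_component:
  assumes "macdonald G A B C \<alpha> \<beta>" "carrier G = generate G {A, B}"
    and mem: "a \<in> H1" "b \<in> H1" "c \<in> H1" "a' \<in> H2" "b' \<in> H2" "c' \<in> H2"
    and eq: "A = a \<otimes> a'" "B = b \<otimes> b'" "C = c \<otimes> c'"
  shows "macdonald (G\<lparr>carrier := H1\<rparr>) a b c \<alpha> \<beta>" "H1 = generate (G\<lparr>carrier := H1\<rparr>) {a, b}"
proof -
  interpret m: macdonald G A B C \<alpha> \<beta> by fact
  have cl [simp]: "a \<in> carrier G" "b \<in> carrier G" "c \<in> carrier G" "a' \<in> carrier G" "b' \<in> carrier G" "c' \<in> carrier G"
    using mem by auto
  have swap: "(x \<otimes> x') \<otimes> (y \<otimes> y') = (x \<otimes> y) \<otimes> (x' \<otimes> y')"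
    if "x \<in> H1" "y \<in> H1" "x' \<in> H2" "y' \<in> H2" for x x' y y'
  proof -
    have c: "x \<in> carrier G" "y \<in> carrier G" "x' \<in> carrier G" "y' \<in> carrier G" using that by auto
    have "(x \<otimes> x') \<otimes> (y \<otimes> y') = x \<otimes> (x' \<otimes> y) \<otimes> y'" using c by (simp add: m_assoc)
    also have "x' \<otimes> y = y \<otimes> x'" using commute[OF that(2,3)] by simp
    finally show ?thesis using c by (simp add: m_assoc)
  qed
  have pow: "(x \<otimes> x') [^] (z::int) = x [^] z \<otimes> x' [^] z" "x [^] z \<in> H1" "x' [^] z \<in> H2"
    if "x \<in> H1" "x' \<in> H2" for x x' z
    using int_pow_mult_distrib[OF commute[OF that]] that subgroup_int_pow_closed N1.is_subgroup N2.is_subgroup by auto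
  have AB: "A \<otimes> B = (a \<otimes> b) \<otimes> (a' \<otimes> b')" unfolding eq by (rule swap[OF mem(1,2,4,5)])
  have BA: "B \<otimes> A = (b \<otimes> a) \<otimes> (b' \<otimes> a')" unfolding eq by (rule swap[OF mem(2,1,5,4)])
  have "B \<otimes> A \<otimes> C = (b \<otimes> a \<otimes> c) \<otimes> (b' \<otimes> a' \<otimes> c')"
    unfolding BA unfolding eq(3) using mem by (intro swap) auto
  then have "(a \<otimes> b) \<otimes> (a' \<otimes> b') = (b \<otimes> a \<otimes> c) \<otimes> (b' \<otimes> a' \<otimes> c')" using m.AB AB by simp
  then have 1: "a \<otimes> b = b \<otimes> a \<otimes> c" 
    by (rule unique(1)[rotated 4]) (use mem in auto)
  have "(a \<otimes> c) \<otimes> (a' \<otimes> c') = (c \<otimes> a [^] \<alpha>) \<otimes> (c' \<otimes> a' [^] \<alpha>)"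
  proof -
    have "A \<otimes> C = (a \<otimes> c) \<otimes> (a' \<otimes> c')" unfolding eq by (rule swap[OF mem(1,3,4,6)])
    moreover have "C \<otimes> A [^] \<alpha> = (c \<otimes> a [^] \<alpha>) \<otimes> (c' \<otimes> a' [^] \<alpha>)"
      unfolding eq pow(1)[OF mem(1,4)] by (rule swap[OF mem(3) pow(2)[OF mem(1,4)] mem(6) pow(3)[OF mem(1,4)]])
    ultimately show ?thesis using m.AC by simp
  qed
  then have 2: "a \<otimes> c = c \<otimes> a [^] \<alpha>"
    by (rule unique(1)[rotated 4]) (use mem pow(2)[OF mem(1,4)] pow(3)[OF mem(1,4)] in auto)
  have "(c \<otimes> b) \<otimes> (c' \<otimes> b') = (b [^] \<beta> \<otimes> c) \<otimes> (b' [^] \<beta> \<otimes> c')"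
  proof -
    have "C \<otimes> B = (c \<otimes> b) \<otimes> (c' \<otimes> b')" unfolding eq by (rule swap[OF mem(3,2,6,5)])
    moreover have "B [^] \<beta> \<otimes> C = (b [^] \<beta> \<otimes> c) \<otimes> (b' [^] \<beta> \<otimes> c')"
      unfolding eq pow(1)[OF mem(2,5)] by (rule swap[OF pow(2)[OF mem(2,5)] mem(3) pow(3)[OF mem(2,5)] mem(6)])
    ultimately show ?thesis using m.CB by simp
  qed
  then have 3: "c \<otimes> b = b [^] \<beta> \<otimes> c"
    by (rule unique(1)[rotated 4]) (use mem pow(2)[OF mem(2,5)] pow(3)[OF mem(2,5)] in auto)
  show "macdonald (G\<lparr>carrier := H1\<rparr>) a b c \<alpha> \<beta>"
    using 1 2 3 mem int_pow_consistent[OF N1.is_subgroup]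
    by (intro macdonald.intro macdonald_axioms.intro subgroup_imp_group N1.is_subgroup) auto
  let ?K = "generate G {a, b}"
  have ab: "{a, b} \<subseteq> H1" using mem by simp
  have K: "subgroup ?K G" "?K \<subseteq> H1"
    using generate_is_subgroup[of "{a, b}"] generate_subgroup_incl[OF ab N1.is_subgroup] by auto
  have "subgroup (?K <#> H2) G"
  proof (rule subgroup_set_mult[OF K(1) N2.is_subgroup])
    fix k h assume "k \<in> H2" "h \<in> ?K"
    then show "k \<otimes> h \<in> ?K <#> H2" using commute[of h k] K(2) set_mult_memI[of h ?K k H2] by auto
  qed
  moreover have "{A, B} \<subseteq> ?K <#> H2"
    unfolding eq using mem by (auto intro!: set_mult_memI generate.incl)
  ultimately have sub: "carrier G \<subseteq> ?K <#> H2" unfolding assms(2) by (rule generate_subgroup_incl[rotated])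
  have "H1 \<subseteq> ?K"
  proof
    fix x assume x: "x \<in> H1"
    then have "x \<in> ?K <#> H2" using sub by auto
    then obtain y z where yz: "y \<in> ?K" "z \<in> H2" "x = y \<otimes> z" by (rule set_mult_memE)
    have "x \<otimes> \<one> = y \<otimes> z" using x yz by simp
    then have "x = y" using unique(1)[of x y \<one> z] x yz K(2) by auto
    then show "x \<in> ?K" using yz by simp
  qed
  then show "H1 = generate (G\<lparr>carrier := H1\<rparr>) {a, b}"
    using K(2) generate_consistent[OF ab N1.is_subgroup] by simp
qed

lemma ord_genA_dvd:
  assumes "\<alpha> mod 9 = 7" "\<alpha> mod 27 = \<beta> mod 27" "genA \<alpha> \<beta> [^]\<^bsub>Gab \<alpha> \<beta>\<^esub> (n::nat) = \<one>\<^bsub>Gab \<alpha> \<beta>\<^esub>"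
  shows "81 dvd n"
proof -
  have "word_class (G_rels \<alpha> \<beta>) (pow_word wA (int n)) = word_class (G_rels \<alpha> \<beta>) []"
    using assms(3) unfolding Gab_def genA_def
    by (simp only: int_pow_int[symmetric] word_class_int_pow pres_group_simps(3))
  then show ?thesis using word_pow_A_trivial_dvd[OF assms(1,2)] by (simp only: word_class_eq_iff)
qed

theorem theorem9p1:
  fixes \<alpha> \<beta> :: int
  assumes "\<alpha> mod 9 = 7" and "\<beta> mod 9 = 7" and "\<alpha> mod 27 = \<beta> mod 27"
  defines "G \<equiv> Gab \<alpha> \<beta>"
  defines "G3 \<equiv> sylow_part G 3"
  defines "a \<equiv> sylow_proj G 3 (genA \<alpha> \<beta>)"
      and "b \<equiv> sylow_proj G 3 (genB \<alpha> \<beta>)"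
      and "c \<equiv> sylow_proj G 3 (genC \<alpha> \<beta>)"
  shows "order G3 = 3 ^ 10 \<and> nilpotency_class_is G3 7 \<and>
         group.ord G3 a = 81 \<and> group.ord G3 b = 81 \<and> group.ord G3 c = 27"
proof -
  interpret m: macdonald G "genA \<alpha> \<beta>" "genB \<alpha> \<beta>" "genC \<alpha> \<beta>" \<alpha> \<beta>
    unfolding G_def by (rule macdonald_Gab)
  let ?A = "genA \<alpha> \<beta>" and ?B = "genB \<alpha> \<beta>" and ?C = "genC \<alpha> \<beta>"
  have gen: "carrier G = generate G {?A, ?B}" unfolding G_def by (rule generate_Gab)
  have large: "\<bar>\<alpha>\<bar> \<ge> 2" "\<bar>\<beta>\<bar> \<ge> 2" using assms(1,2) by presburger+
  obtain H1 H2 N s k1 k2 \<alpha>' \<beta>' where cd: "coprime_decomposition G H1 H2 N"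
    and mem: "?A [^]\<^bsub>G\<^esub> (k1::nat) \<in> H1" "?B [^]\<^bsub>G\<^esub> k1 \<in> H1" "?C [^]\<^bsub>G\<^esub> k1 \<in> H1"
      "?A [^]\<^bsub>G\<^esub> (k2::nat) \<in> H2" "?B [^]\<^bsub>G\<^esub> k2 \<in> H2" "?C [^]\<^bsub>G\<^esub> k2 \<in> H2"
    and eq: "?A = ?A [^]\<^bsub>G\<^esub> k1 \<otimes>\<^bsub>G\<^esub> ?A [^]\<^bsub>G\<^esub> k2" "?B = ?B [^]\<^bsub>G\<^esub> k1 \<otimes>\<^bsub>G\<^esub> ?B [^]\<^bsub>G\<^esub> k2"
      "?C = ?C [^]\<^bsub>G\<^esub> k1 \<otimes>\<^bsub>G\<^esub> ?C [^]\<^bsub>G\<^esub> k2"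
    and pow: "(?A [^]\<^bsub>G\<^esub> k1) [^]\<^bsub>G\<^esub> ((3::nat) ^ s) = \<one>\<^bsub>G\<^esub>" "(?B [^]\<^bsub>G\<^esub> k1) [^]\<^bsub>G\<^esub> ((3::nat) ^ s) = \<one>\<^bsub>G\<^esub>"
    and pos: "\<alpha>' > 0" "\<beta>' > 0" and cong: "27 dvd \<alpha>' - \<alpha>" "27 dvd \<beta>' - \<beta>"
    and m': "macdonald G ?A ?B ?C \<alpha>' \<beta>'" and k1: "3 dvd m.ord ?A \<longrightarrow> \<not> 3 dvd k1"
    by (rule m.sylow_decomposition[OF gen large])
  interpret cd: coprime_decomposition G H1 H2 N by (rule cd)
  define x y z where "x = ?A [^]\<^bsub>G\<^esub> k1" and "y = ?B [^]\<^bsub>G\<^esub> k1" and "z = ?C [^]\<^bsub>G\<^esub> k1"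
  have G3: "G3 = G\<lparr>carrier := H1\<rparr>" unfolding G3_def by (rule cd.sylow_part_eq)
  have "sylow_proj G 3 (?A [^]\<^bsub>G\<^esub> k1 \<otimes>\<^bsub>G\<^esub> ?A [^]\<^bsub>G\<^esub> k2) = x"
    "sylow_proj G 3 (?B [^]\<^bsub>G\<^esub> k1 \<otimes>\<^bsub>G\<^esub> ?B [^]\<^bsub>G\<^esub> k2) = y"
    "sylow_proj G 3 (?C [^]\<^bsub>G\<^esub> k1 \<otimes>\<^bsub>G\<^esub> ?C [^]\<^bsub>G\<^esub> k2) = z"
    unfolding x_def y_def z_def
    by (rule cd.sylow_proj_eq[OF mem(1,4)], rule cd.sylow_proj_eq[OF mem(2,5)], rule cd.sylow_proj_eq[OF mem(3,6)])
  then have proj: "a = x" "b = y" "c = z" unfolding a_def b_def c_def eq[symmetric] .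
  have mac: "macdonald G3 x y z \<alpha>' \<beta>'" "H1 = generate G3 {x, y}"
    unfolding G3 x_def y_def z_def
    by (rule cd.macdonald_component(1)[OF m' gen mem eq], rule cd.macdonald_component(2)[OF m' gen mem eq])
  have np: "w [^]\<^bsub>G3\<^esub> (i::nat) = w [^]\<^bsub>G\<^esub> i" for w i
    unfolding G3 by (rule m.nat_pow_consistent[symmetric])
  have ordA: "81 dvd m.ord ?A"
    using ord_genA_dvd[OF assms(1,3), of "m.ord ?A"] m.pow_ord_eq_1[OF m.A_closed] unfolding G_def by blast
  have f: "macdonald_3_faithful G3 x y z \<alpha>' \<beta>' s"
  proof (intro macdonald_3_faithful.intro macdonald_3.intro mac(1) macdonald_3_axioms.intro
      macdonald_3_faithful_axioms.intro pos)
    show "x [^]\<^bsub>G3\<^esub> ((3::nat) ^ s) = \<one>\<^bsub>G3\<^esub>" "y [^]\<^bsub>G3\<^esub> ((3::nat) ^ s) = \<one>\<^bsub>G3\<^esub>"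
      unfolding np using pow by (simp_all add: x_def y_def G3)
    show "carrier G3 = generate G3 {x, y}" using mac(2) by (simp add: G3)
    have r: "\<alpha>' mod 27 = \<alpha> mod 27" "\<beta>' mod 27 = \<beta> mod 27" using cong by (simp_all add: mod_eq_dvd_iff)
    have m9: "w mod 27 mod 9 = w mod 9" for w :: int by (simp add: mod_mod_cancel)
    show "\<alpha>' mod 27 = \<beta>' mod 27" using r assms(3) by simp
    show "\<alpha>' mod 9 = 7" using m9[of \<alpha>'] m9[of \<alpha>] r(1) assms(1) by simp
    show "\<beta>' mod 9 = 7" using m9[of \<beta>'] m9[of \<beta>] r(2) assms(2) by simp
    show "x [^]\<^bsub>G3\<^esub> (27::int) \<noteq> \<one>\<^bsub>G3\<^esub>"
    proof
      assume "x [^]\<^bsub>G3\<^esub> (27::int) = \<one>\<^bsub>G3\<^esub>"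
      then have "x [^]\<^bsub>G3\<^esub> (27::nat) = \<one>\<^bsub>G3\<^esub>" using int_pow_int[of G3 x 27] by simp
      then have "?A [^]\<^bsub>G\<^esub> (k1 * 27) = \<one>\<^bsub>G\<^esub>" unfolding np by (simp add: x_def G3 m.nat_pow_pow)
      \<comment> \<open>This would force 3 to divide \<open>k1\<close>; but 81 divides the order of
        \<open>A\<close>, so \<open>k1\<close> is prime to 3.\<close>
      then have "81 dvd k1 * 27" using ord_genA_dvd[OF assms(1,3)] unfolding G_def by blast
      then have "3 dvd k1" by presburger
      moreover have "3 dvd m.ord ?A" using ordA by (rule dvd_trans[rotated]) simp
      ultimately show False using k1 by blast
    qed
  qed
  interpret f: macdonald_3_faithful G3 x y z \<alpha>' \<beta>' s by (rule f)
  show ?thesis unfolding proj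
    using f.order_eq f.class_eq f.ord_A_81 f.ord_B_81 f.ord_C_27 by blast
qed

end
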